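(* Fix a constant $d$. Let $G$ be a connected weighted graph satisfying $e(G)\le v(G)+d$. Then there is a polynomial-time computable optimal querying strategy for $G$.
   Context: Query-commit problem. A weighted graph is $G=(V,E,p)$ with $p:E\to(0,1]$; isolated nodes are ignored; $v(G),e(G)$ are the numbers of nodes and edges. A realization $\sigma\sim G$ contains each edge $e$ independently with probability $p_e$. A querying strategy starts with empty matching and residual graph $G$; in each step it queries an edge $e$; if $e\in\sigma$, $e$ is added to the matching and all edges sharing an endpoint with $e$ are removed from the residual graph, otherwise $e$ is removed. The next query may depend only on outcomes of previous queries. A strategy is optimal if it maximizes the expected size of the matching obtained over all strategies. A strategy is polynomial-time computable if the time used to decide the query in each step, including any preprocessing time, is bounded by a polynomial in the size of the description of the input graph. *)

theory Defs
  imports "HOL-Probability.Probability" "HOL-Computational_Algebra.Polynomial" "HOL-Library.Log_Nat"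
begin

section \<open>Weighted graphs\<close>

record 'a wgraph =
  edges :: "'a set set"
  prob :: "'a set \<Rightarrow> real"

definition weighted_graph :: "'a wgraph \<Rightarrow> bool" where
  "weighted_graph G \<longleftrightarrow>
     finite (edges G) \<and> (\<forall>e\<in>edges G. card e = 2 \<and> 0 < prob G e \<and> prob G e \<le> 1)"

text \<open>Isolated nodes are ignored, so the nodes are the endpoints of the edges.\<close>

definition nodes :: "'a wgraph \<Rightarrow> 'a set" where
  "nodes G = \<Union>(edges G)"

definition connected_graph :: "'a wgraph \<Rightarrow> bool" where
  "connected_graph G \<longleftrightarrow>
     (\<forall>u\<in>nodes G. \<forall>v\<in>nodes G. (u, v) \<in> {(x, y). {x, y} \<in> edges G}\<^sup>*)"

definition realization :: "'a wgraph \<Rightarrow> 'a set set pmf" where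
  "realization G =
     map_pmf (\<lambda>f. {e \<in> edges G. f e})
       (Pi_pmf (edges G) False (\<lambda>e. bernoulli_pmf (prob G e)))"


section \<open>Querying strategies\<close>

text \<open>
  A history lists the queries made so far together with their outcomes, oldest first.
  A strategy maps a history to the next query.
\<close>

type_synonym 'a history = "('a set \<times> bool) list"
type_synonym 'a strategy = "'a history \<Rightarrow> 'a set"

definition residual :: "'a wgraph \<Rightarrow> 'a history \<Rightarrow> 'a set set" where
  "residual G h =
     fold (\<lambda>(e, present) R. if present then {f \<in> R. f \<inter> e = {}} else R - {e}) h (edges G)"

text \<open>The history after (at most) \<open>n\<close> queries when the realization is \<open>\<sigma>\<close>.\<close>

fun transcript :: "'a wgraph \<Rightarrow> 'a strategy \<Rightarrow> 'a set set \<Rightarrow> nat \<Rightarrow> 'a history" where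
  "transcript G s \<sigma> 0 = []"
| "transcript G s \<sigma> (Suc n) =
     (let h = transcript G s \<sigma> n
      in if residual G h = {} then h else h @ [(s h, s h \<in> \<sigma>)])"

definition histories :: "'a wgraph \<Rightarrow> 'a strategy \<Rightarrow> 'a history set" where
  "histories G s = {transcript G s \<sigma> n | \<sigma> n. \<sigma> \<subseteq> edges G}"

definition querying_strategy :: "'a wgraph \<Rightarrow> 'a strategy \<Rightarrow> bool" where
  "querying_strategy G s \<longleftrightarrow>
     (\<forall>h\<in>histories G s. residual G h \<noteq> {} \<longrightarrow> s h \<in> residual G h)"

text \<open>
  Each query to a residual edge removes that edge, so \<open>card (edges G)\<close> queries exhaust the
  residual graph.
\<close>

definition matching :: "'a wgraph \<Rightarrow> 'a strategy \<Rightarrow> 'a set set \<Rightarrow> 'a set set" where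
  "matching G s \<sigma> = {e. (e, True) \<in> set (transcript G s \<sigma> (card (edges G)))}"

definition expected_size :: "'a wgraph \<Rightarrow> 'a strategy \<Rightarrow> real" where
  "expected_size G s =
     measure_pmf.expectation (realization G) (\<lambda>\<sigma>. real (card (matching G s \<sigma>)))"

definition optimal_strategy :: "'a wgraph \<Rightarrow> 'a strategy \<Rightarrow> bool" where
  "optimal_strategy G s \<longleftrightarrow>
     querying_strategy G s \<and>
     (\<forall>s'. querying_strategy G s' \<longrightarrow> expected_size G s' \<le> expected_size G s)"


section \<open>Descriptions of graphs\<close>

text \<open>
  A finite description lists the edges; the entry \<open>(u, v, a, b)\<close> stands for the edge \<open>{u, v}\<close>
  with probability \<open>a / b\<close>. All four numbers are written in binary. The same graph has many
  descriptions, differing in the order of the edges and the representation of the fractions.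
\<close>

type_synonym description = "(nat \<times> nat \<times> nat \<times> nat) list"

definition describes :: "description \<Rightarrow> nat wgraph \<Rightarrow> bool" where
  "describes D G \<longleftrightarrow>
     distinct (map (\<lambda>(u, v, a, b). {u, v}) D) \<and>
     edges G = set (map (\<lambda>(u, v, a, b). {u, v}) D) \<and>
     (\<forall>(u, v, a, b)\<in>set D. b \<noteq> 0 \<and> prob G {u, v} = real a / real b)"

definition description_size :: "description \<Rightarrow> nat" where
  "description_size D =
     (\<Sum>(u, v, a, b)\<leftarrow>D. floorlog 2 u + floorlog 2 v + floorlog 2 a + floorlog 2 b)"


section \<open>A model of computation\<close>

text \<open>
  A first-order, call-by-value functional language over binary trees with natural numbers at the
  leaves, under the logarithmic cost criterion: an arithmetic operation is charged the bit lengths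
  of its operands, and every other operation is charged one unit. Values are immutable, so that
  building or taking apart a cell and passing a value amount to copying a pointer; hence running
  times in this model agree with those of Turing machines and of logarithmic-cost random access
  machines up to a polynomial. A divergent or ill-formed computation has no
  derivation in the semantics.
\<close>

datatype val = Num nat | Cell val val

datatype binop = Plus | Minus | Times | Quot

datatype expr =
    Var nat
  | Lit nat
  | Arith binop expr expr
  | Cons_cell expr expr
  | Left expr
  | Right expr
  | If_nonzero expr expr expr
  | Let_in expr expr
  | Call nat "expr list"

text \<open>
  A program is a list of function bodies. In a body, \<open>Var i\<close> is the \<open>i\<close>-th entry of the
  environment, which initially consists of the arguments; \<open>Let_in\<close> adds an entry at the front.
  Execution starts with function \<open>0\<close>.
\<close>

type_synonym program = "expr list"

fun arith :: "binop \<Rightarrow> nat \<Rightarrow> nat \<Rightarrow> nat" where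
  "arith Plus m n = m + n"
| "arith Minus m n = m - n"
| "arith Times m n = m * n"
| "arith Quot m n = m div n"

text \<open>\<open>eval P env x v t\<close>: the expression \<open>x\<close> evaluates to \<open>v\<close> at cost \<open>t\<close>.\<close>

inductive eval :: "program \<Rightarrow> val list \<Rightarrow> expr \<Rightarrow> val \<Rightarrow> nat \<Rightarrow> bool"
  and evals :: "program \<Rightarrow> val list \<Rightarrow> expr list \<Rightarrow> val list \<Rightarrow> nat \<Rightarrow> bool"
  for P :: program where
  Var: "i < length env \<Longrightarrow> eval P env (Var i) (env ! i) 1"
| Lit: "eval P env (Lit n) (Num n) 1"
| Arith: "eval P env x (Num m) t1 \<Longrightarrow> eval P env y (Num n) t2 \<Longrightarrow>
    eval P env (Arith f x y) (Num (arith f m n)) (t1 + t2 + floorlog 2 m + floorlog 2 n + 1)"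
| Cons_cell: "eval P env x v t1 \<Longrightarrow> eval P env y w t2 \<Longrightarrow>
    eval P env (Cons_cell x y) (Cell v w) (t1 + t2 + 1)"
| Left: "eval P env x (Cell v w) t \<Longrightarrow> eval P env (Left x) v (t + 1)"
| Right: "eval P env x (Cell v w) t \<Longrightarrow> eval P env (Right x) w (t + 1)"
| If_then: "eval P env x u t1 \<Longrightarrow> u \<noteq> Num 0 \<Longrightarrow> eval P env y v t2 \<Longrightarrow>
    eval P env (If_nonzero x y z) v (t1 + t2 + 1)"
| If_else: "eval P env x (Num 0) t1 \<Longrightarrow> eval P env z v t2 \<Longrightarrow>
    eval P env (If_nonzero x y z) v (t1 + t2 + 1)"
| Let_in: "eval P env x u t1 \<Longrightarrow> eval P (u # env) y v t2 \<Longrightarrow>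
    eval P env (Let_in x y) v (t1 + t2 + 1)"
| Call: "evals P env xs vs t1 \<Longrightarrow> f < length P \<Longrightarrow> eval P vs (P ! f) v t2 \<Longrightarrow>
    eval P env (Call f xs) v (t1 + t2 + 1)"
| Nil: "evals P env [] [] 0"
| Cons: "eval P env x v t1 \<Longrightarrow> evals P env xs vs t2 \<Longrightarrow>
    evals P env (x # xs) (v # vs) (t1 + t2)"

definition computes_within :: "program \<Rightarrow> val list \<Rightarrow> val \<Rightarrow> nat \<Rightarrow> bool" where
  "computes_within P args v T \<longleftrightarrow> P \<noteq> [] \<and> (\<exists>t\<le>T. eval P args (P ! 0) v t)"

definition list_val :: "('a \<Rightarrow> val) \<Rightarrow> 'a list \<Rightarrow> val" where
  "list_val f xs = foldr (\<lambda>x. Cell (f x)) xs (Num 0)"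

definition edge_val :: "nat set \<Rightarrow> val" where
  "edge_val e = Cell (Num (Min e)) (Num (Max e))"

definition history_val :: "nat history \<Rightarrow> val" where
  "history_val = list_val (\<lambda>(e, present). Cell (edge_val e) (Num (of_bool present)))"

definition description_val :: "description \<Rightarrow> val" where
  "description_val =
     list_val (\<lambda>(u, v, a, b). Cell (Cell (Num u) (Num v)) (Cell (Num a) (Num b)))"


section \<open>Polynomial-time computable strategies\<close>

text \<open>
  \<open>S D\<close> is the strategy used for the graph described by \<open>D\<close>. One program has to find the next
  query, from scratch, for all graphs of the class \<open>C\<close> and all histories that can arise. Work
  done in a preprocessing phase or in earlier steps is thus repeated, and charged, in each step;
  as there are at most \<open>card (edges G)\<close> steps, this does not affect polynomiality.
\<close>

definition polytime_computable ::
    "nat wgraph set \<Rightarrow> (description \<Rightarrow> nat strategy) \<Rightarrow> bool" where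
  "polytime_computable C S \<longleftrightarrow>
     (\<exists>P. \<exists>q :: nat poly. \<forall>G\<in>C. \<forall>D. describes D G \<longrightarrow>
        (\<forall>h\<in>histories G (S D). residual G h \<noteq> {} \<longrightarrow>
           computes_within P [description_val D, history_val h] (edge_val (S D h))
             (poly q (description_size D))))"

end

theory Submission
  imports Defs
begin

text \<open>
  The optimal value \<open>opt\<close> of a residual graph satisfies the Bellman recursion over the edge that is
  queried next. Querying a pendant edge \<open>{u, v}\<close> with leaf \<open>u\<close> is always optimal. Hence, if every
  node is available independently with a given probability, a leaf \<open>u\<close> with edge \<open>{u, v}\<close> can be
  eliminated: the expected gain is added to the value and the availability of \<open>v\<close> is multiplied by
  \<open>1 - p r\<close>, where \<open>p\<close> is the probability of the edge and \<open>r\<close> the availability of \<open>u\<close>. When no leaf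
  is left, the search branches on the availability of a node, and once all nodes are certain to be
  available, on the edge to be queried.

  Every branching deletes something from a graph of minimum degree two. Let \<open>X\<close> be the complement of
  the edge set of a spanning tree, so that \<open>card X \<le> d + 1\<close>. Among the subgraphs \<open>K\<close> of minimum degree two,
  the potential \<open>card K - card (\<Union>K) + card (K \<inter> X)\<close> is strictly monotone, and it lies between \<open>0\<close> and
  \<open>2 (d + 1)\<close>; so the branching depth is bounded by a constant and the search has polynomially many
  calls. The product of all denominators does not grow under leaf elimination, which keeps the
  numbers small.
\<close>

section \<open>The value of the optimal strategy\<close>

lemma card_residual_less:
  assumes "finite E" "e \<in> E"
  shows "card {f \<in> E - {e}. f \<inter> e = {}} < card E" "card (E - {e}) < card E"
  using assms by (auto intro!: psubset_card_mono simp del: card_Diff_singleton card_Diff_insert)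

function opt :: "('a set \<Rightarrow> real) \<Rightarrow> 'a set set \<Rightarrow> real" where
  "opt p E = (if finite E \<and> E \<noteq> {}
     then Max ((\<lambda>e. p e * (1 + opt p {f \<in> E - {e}. f \<inter> e = {}}) + (1 - p e) * opt p (E - {e})) ` E)
     else 0)"
  by auto
termination
  by (relation "Wellfounded.measure (\<lambda>(p, E). card E)")
    (simp_all only: in_measure split_conv card_residual_less wf_measure)

declare opt.simps [simp del]

lemma convex_mono:
  fixes p :: real
  assumes "a \<le> a'" "b \<le> b'" "0 \<le> p" "p \<le> 1"
  shows "p * a + (1 - p) * b \<le> p * a' + (1 - p) * b'"
  using assms by (intro add_mono mult_left_mono) auto

lemma opt_empty [simp]: "opt p {} = 0"
  by (simp add: opt.simps)

lemma opt_ge: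
  assumes "finite E" "e \<in> E"
  shows "p e * (1 + opt p {f \<in> E - {e}. f \<inter> e = {}}) + (1 - p e) * opt p (E - {e}) \<le> opt p E"
proof -
  let ?f = "\<lambda>e. p e * (1 + opt p {f \<in> E - {e}. f \<inter> e = {}}) + (1 - p e) * opt p (E - {e})"
  have "opt p E = Max (?f ` E)" using assms by (subst opt.simps) auto
  moreover have "?f e \<le> Max (?f ` E)" using assms by (intro Max_ge) auto
  ultimately show ?thesis by simp
qed

lemma opt_attained:
  assumes "finite E" "E \<noteq> {}"
  obtains e where "e \<in> E"
    "opt p E = p e * (1 + opt p {f \<in> E - {e}. f \<inter> e = {}}) + (1 - p e) * opt p (E - {e})"
proof -
  let ?f = "\<lambda>e. p e * (1 + opt p {f \<in> E - {e}. f \<inter> e = {}}) + (1 - p e) * opt p (E - {e})"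
  have "Max (?f ` E) \<in> ?f ` E" using assms by (intro Max_in) auto
  moreover have "opt p E = Max (?f ` E)" using assms by (subst opt.simps) auto
  ultimately show ?thesis using that by auto
qed

definition prob_on :: "('a set \<Rightarrow> real) \<Rightarrow> 'a set set \<Rightarrow> bool" where
  "prob_on p E \<longleftrightarrow> (\<forall>e\<in>E. 0 \<le> p e \<and> p e \<le> 1)"

lemma prob_on_subset: "prob_on p E \<Longrightarrow> F \<subseteq> E \<Longrightarrow> prob_on p F"
  by (auto simp: prob_on_def)

lemma opt_mono:
  assumes "finite E" "prob_on p E" "F \<subseteq> E"
  shows "opt p F \<le> opt p E"
  using assms
proof (induction "card E" arbitrary: E F rule: less_induct)
  case less
  have sub: "finite H" "prob_on p H" if "H \<subseteq> E" for H
    using that less.prems finite_subset prob_on_subset by metis+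
  have finF: "finite F" using less.prems finite_subset by blast
  show ?case
  proof (cases "F = {}")
    case True
    show ?thesis
    proof (cases "E = {}")
      case False
      then obtain e where e: "e \<in> E" by auto
      have c: "card {f \<in> E - {e}. f \<inter> e = {}} < card E" "card (E - {e}) < card E"
        using less.prems e by (blast intro: card_residual_less)+
      have "opt p {} \<le> opt p {f \<in> E - {e}. f \<inter> e = {}}" "opt p {} \<le> opt p (E - {e})"
        using sub by (intro less.hyps c; auto)+
      moreover have "0 \<le> p e" "p e \<le> 1" using less.prems e by (auto simp: prob_on_def)
      ultimately have "0 \<le> p e * (1 + opt p {f \<in> E - {e}. f \<inter> e = {}}) + (1 - p e) * opt p (E - {e})"
        by simp
      also have "\<dots> \<le> opt p E" using less.prems e by (intro opt_ge)
      finally show ?thesis using True by simp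
    qed (simp add: True)
  next
    case False
    then obtain e where e: "e \<in> F"
      and eq: "opt p F = p e * (1 + opt p {f \<in> F - {e}. f \<inter> e = {}}) + (1 - p e) * opt p (F - {e})"
      using opt_attained finF by blast
    have eE: "e \<in> E" using e less.prems by auto
    have c: "card {f \<in> E - {e}. f \<inter> e = {}} < card E" "card (E - {e}) < card E"
      using less.prems eE by (blast intro: card_residual_less)+
    have "opt p {f \<in> F - {e}. f \<inter> e = {}} \<le> opt p {f \<in> E - {e}. f \<inter> e = {}}"
      using less.prems eE sub by (intro less.hyps c) auto
    moreover have "opt p (F - {e}) \<le> opt p (E - {e})"
      using less.prems eE sub by (intro less.hyps c) auto
    moreover have "0 \<le> p e" "p e \<le> 1" using less.prems eE by (auto simp: prob_on_def)
    ultimately have "opt p F \<le> p e * (1 + opt p {f \<in> E - {e}. f \<inter> e = {}}) + (1 - p e) * opt p (E - {e})"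
      unfolding eq by (intro add_mono mult_left_mono) auto
    also have "\<dots> \<le> opt p E" using less.prems eE by (intro opt_ge)
    finally show ?thesis .
  qed
qed

lemma opt_pendant:
  assumes "finite E" "prob_on p E" "{u, v} \<in> E" "\<And>f. f \<in> E \<Longrightarrow> u \<in> f \<Longrightarrow> f = {u, v}"
  shows "opt p E = p {u, v} * (1 + opt p {f \<in> E. v \<notin> f}) + (1 - p {u, v}) * opt p (E - {{u, v}})"
proof (rule antisym)
  have "u \<notin> f" if "f \<in> E" "f \<noteq> {u, v}" for f using that assms(4) by blast
  then have "{f \<in> E - {{u, v}}. f \<inter> {u, v} = {}} = {f \<in> E. v \<notin> f}" by auto
  then show "p {u, v} * (1 + opt p {f \<in> E. v \<notin> f}) + (1 - p {u, v}) * opt p (E - {{u, v}}) \<le> opt p E"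
    using opt_ge[OF assms(1,3), of p] by simp
next
  let ?e = "{u, v}"
  show "opt p E \<le> p ?e * (1 + opt p {f \<in> E. v \<notin> f}) + (1 - p ?e) * opt p (E - {?e})"
    using assms
  proof (induction "card E" arbitrary: E rule: less_induct)
    case less
    have pe: "0 \<le> p ?e" "p ?e \<le> 1" using less.prems(2,3) by (auto simp: prob_on_def)
    obtain f where f: "f \<in> E"
      and eq: "opt p E = p f * (1 + opt p {g \<in> E - {f}. g \<inter> f = {}}) + (1 - p f) * opt p (E - {f})"
      using opt_attained[of E p] less.prems(1,3) by blast
    have pf: "0 \<le> p f" "p f \<le> 1" using less.prems(2) f by (auto simp: prob_on_def)
    have nu: "u \<notin> g" if "g \<in> E" "g \<noteq> ?e" for g using that less.prems(4) by blast
    have sub: "finite F \<and> prob_on p F" if "F \<subseteq> E" for F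
      using that less.prems(1,2) finite_subset prob_on_subset by metis
    define A where "A = opt p {g \<in> E - {f}. g \<inter> f = {}}"
    define B where "B = opt p (E - {f})"
    show ?case
    proof (cases "f = ?e")
      case True
      have "{g \<in> E - {f}. g \<inter> f = {}} = {g \<in> E. v \<notin> g}" using nu True by auto
      then show ?thesis using eq True by simp
    next
      case ne: False
      have unf: "u \<notin> f" using nu f ne by auto
      define Ee where "Ee = opt p {g \<in> (E - {?e}) - {f}. g \<inter> f = {}}"
      define Be where "Be = opt p ((E - {?e}) - {f})"
      have e1: "p f * (1 + Ee) + (1 - p f) * Be \<le> opt p (E - {?e})"
        unfolding Ee_def Be_def using f ne sub[of "E - {?e}"] by (intro opt_ge) auto
      have c: "card {g \<in> E - {f}. g \<inter> f = {}} < card E" "card (E - {f}) < card E"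
        using less.prems(1) f by (blast intro: card_residual_less)+
      have "B \<le> p ?e * (1 + opt p {g \<in> E - {f}. v \<notin> g}) + (1 - p ?e) * opt p ((E - {f}) - {?e})"
        unfolding B_def using f ne less.prems(3) sub[of "E - {f}"] less.prems(4)
        by (intro less.hyps c) blast+
      moreover have "E - {f} - {?e} = E - {?e} - {f}" by blast
      ultimately have IB: "B \<le> p ?e * (1 + opt p {g \<in> E - {f}. v \<notin> g}) + (1 - p ?e) * Be"
        by (simp only: Be_def)
      show ?thesis
      proof (cases "v \<in> f")
        case True
        have "{g \<in> E - {f}. v \<notin> g} = {g \<in> E. v \<notin> g}" using True by auto
        with IB have IB': "B \<le> p ?e * (1 + opt p {g \<in> E. v \<notin> g}) + (1 - p ?e) * Be" by simp
        have A1: "A \<le> opt p {g \<in> E. v \<notin> g}" unfolding A_def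
          using True sub[of "{g \<in> E. v \<notin> g}"] by (intro opt_mono) auto
        have A2: "A \<le> Ee" unfolding A_def Ee_def
          using True sub[of "{g \<in> (E - {?e}) - {f}. g \<inter> f = {}}"] by (intro opt_mono) auto
        have "1 + A = p ?e * (1 + A) + (1 - p ?e) * (1 + A)" by (simp add: algebra_simps)
        also have "\<dots> \<le> p ?e * (1 + opt p {g \<in> E. v \<notin> g}) + (1 - p ?e) * (1 + Ee)"
          using A1 A2 pe by (intro convex_mono) auto
        finally have IA: "1 + A \<le> p ?e * (1 + opt p {g \<in> E. v \<notin> g}) + (1 - p ?e) * (1 + Ee)" .
        have "opt p E = p f * (1 + A) + (1 - p f) * B" using eq by (simp add: A_def B_def)
        also have "\<dots> \<le> p f * (p ?e * (1 + opt p {g \<in> E. v \<notin> g}) + (1 - p ?e) * (1 + Ee))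
            + (1 - p f) * (p ?e * (1 + opt p {g \<in> E. v \<notin> g}) + (1 - p ?e) * Be)"
          using IA IB' pf by (intro convex_mono) auto
        also have "\<dots> = p ?e * (1 + opt p {g \<in> E. v \<notin> g}) + (1 - p ?e) * (p f * (1 + Ee) + (1 - p f) * Be)"
          by (simp add: algebra_simps)
        also have "\<dots> \<le> p ?e * (1 + opt p {g \<in> E. v \<notin> g}) + (1 - p ?e) * opt p (E - {?e})"
          using e1 pe by (intro convex_mono) auto
        finally show ?thesis .
      next
        case False
        let ?Av = "opt p {g \<in> {g \<in> E. v \<notin> g} - {f}. g \<inter> f = {}}"
        let ?Bv = "opt p ({g \<in> E. v \<notin> g} - {f})"
        have e2: "p f * (1 + ?Av) + (1 - p f) * ?Bv \<le> opt p {g \<in> E. v \<notin> g}"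
          using f False sub[of "{g \<in> E. v \<notin> g}"] by (intro opt_ge) auto
        let ?H = "{g \<in> E - {f}. g \<inter> f = {}}"
        have "A \<le> p ?e * (1 + opt p {g \<in> ?H. v \<notin> g}) + (1 - p ?e) * opt p (?H - {?e})"
          unfolding A_def using f ne False unf less.prems(3,4) sub[of ?H]
          by (intro less.hyps c) blast+
        moreover have "{g \<in> ?H. v \<notin> g} = {g \<in> {g \<in> E. v \<notin> g} - {f}. g \<inter> f = {}}"
          "?H - {?e} = {g \<in> (E - {?e}) - {f}. g \<inter> f = {}}" by auto
        ultimately have IA: "A \<le> p ?e * (1 + ?Av) + (1 - p ?e) * Ee" by (simp add: Ee_def)
        have "{g \<in> E - {f}. v \<notin> g} = {g \<in> E. v \<notin> g} - {f}" by auto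
        with IB have IB': "B \<le> p ?e * (1 + ?Bv) + (1 - p ?e) * Be" by simp
        have "opt p E = p f * (1 + A) + (1 - p f) * B" using eq by (simp add: A_def B_def)
        also have "\<dots> \<le> p f * (1 + (p ?e * (1 + ?Av) + (1 - p ?e) * Ee))
            + (1 - p f) * (p ?e * (1 + ?Bv) + (1 - p ?e) * Be)"
          using IA IB' pf by (intro convex_mono) auto
        also have "\<dots> = p ?e * (1 + (p f * (1 + ?Av) + (1 - p f) * ?Bv))
            + (1 - p ?e) * (p f * (1 + Ee) + (1 - p f) * Be)"
          by (simp add: algebra_simps)
        also have "\<dots> \<le> p ?e * (1 + opt p {g \<in> E. v \<notin> g}) + (1 - p ?e) * opt p (E - {?e})"
          using e1 e2 pe by (intro convex_mono) auto
        finally show ?thesis .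
      qed
    qed
  qed
qed

section \<open>Strategies\<close>

lemma residual_Nil [simp]: "residual G [] = edges G"
  by (simp add: residual_def)

lemma residual_snoc [simp]:
  "residual G (h @ [(e, b)]) =
     (if b then {f \<in> residual G h. f \<inter> e = {}} else residual G h - {e})"
  by (simp add: residual_def)

lemma residual_subset: "residual G h \<subseteq> edges G"
  by (induction h rule: rev_induct) (auto split: if_splits)

lemma residual_nonempty_edge: "weighted_graph G \<Longrightarrow> f \<in> residual G h \<Longrightarrow> f \<noteq> {}"
  using residual_subset[of G h] by (force simp: weighted_graph_def)

lemma residual_not_queried:
  assumes "weighted_graph G" "(e, b) \<in> set h"
  shows "e \<notin> residual G h"
  using assms(2)
proof (induction h rule: rev_induct)
  case (snoc a h)
  obtain e' b' where a: "a = (e', b')" by force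
  show ?case using snoc a residual_nonempty_edge[OF assms(1), of _ h] by auto
qed simp

lemma transcript_cong:
  assumes "\<And>e b. (e, b) \<in> set (transcript G s \<sigma> m) \<Longrightarrow> e \<in> \<sigma> \<longleftrightarrow> e \<in> \<tau>"
  shows "transcript G s \<tau> m = transcript G s \<sigma> m"
  using assms
proof (induction m)
  case (Suc m)
  let ?h = "transcript G s \<sigma> m"
  have "set ?h \<subseteq> set (transcript G s \<sigma> (Suc m))" by (auto simp: Let_def)
  then have IH: "transcript G s \<tau> m = ?h" using Suc.prems by (intro Suc.IH) blast
  show ?case
  proof (cases "residual G ?h = {}")
    case False
    then have "(s ?h, s ?h \<in> \<sigma>) \<in> set (transcript G s \<sigma> (Suc m))" by (simp add: Let_def)
    then have "s ?h \<in> \<sigma> \<longleftrightarrow> s ?h \<in> \<tau>" by (rule Suc.prems)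
    then show ?thesis by (simp add: IH Let_def)
  qed (simp add: IH)
qed simp

lemma transcript_in_histories: "\<sigma> \<subseteq> edges G \<Longrightarrow> transcript G s \<sigma> n \<in> histories G s"
  by (auto simp: histories_def)

lemma Nil_in_histories: "[] \<in> histories G s"
  using transcript_in_histories[of "{}" G s 0] by simp

lemma histories_snoc:
  assumes "weighted_graph G" "querying_strategy G s" "h \<in> histories G s" "residual G h \<noteq> {}"
  shows "h @ [(s h, b)] \<in> histories G s"
proof -
  obtain \<sigma> m where \<sigma>: "\<sigma> \<subseteq> edges G" "h = transcript G s \<sigma> m"
    using assms(3) by (auto simp: histories_def)
  have e: "s h \<in> residual G h" using assms by (auto simp: querying_strategy_def)
  define \<tau> where "\<tau> = (if b then insert (s h) \<sigma> else \<sigma> - {s h})"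
  have "transcript G s \<tau> m = transcript G s \<sigma> m"
    using residual_not_queried[OF assms(1)] e \<sigma>(2) by (intro transcript_cong) (auto simp: \<tau>_def)
  then have "transcript G s \<tau> (Suc m) = h @ [(s h, b)]"
    using \<sigma>(2) assms(4) by (simp add: \<tau>_def Let_def)
  moreover have "\<tau> \<subseteq> edges G" using \<sigma>(1) e residual_subset[of G h] by (auto simp: \<tau>_def)
  ultimately show ?thesis using transcript_in_histories by metis
qed

fun play :: "'a wgraph \<Rightarrow> 'a strategy \<Rightarrow> 'a set set \<Rightarrow> nat \<Rightarrow> 'a history \<Rightarrow> 'a history" where
  "play G s \<sigma> 0 h = h"
| "play G s \<sigma> (Suc n) h =
     (if residual G h = {} then h else play G s \<sigma> n (h @ [(s h, s h \<in> \<sigma>)]))"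

lemma play_residual_empty: "residual G h = {} \<Longrightarrow> play G s \<sigma> n h = h"
  by (cases n) auto

lemma play_Suc:
  "play G s \<sigma> (Suc n) h =
     (let h' = play G s \<sigma> n h in if residual G h' = {} then h' else h' @ [(s h', s h' \<in> \<sigma>)])"
proof (induction n arbitrary: h)
  case (Suc n)
  show ?case
  proof (cases "residual G h = {}")
    case False
    then show ?thesis using Suc.IH[of "h @ [(s h, s h \<in> \<sigma>)]"]
      by (simp del: residual_snoc play.simps add: play.simps(2)[of G s \<sigma> "Suc n"] play.simps(2)[of G s \<sigma> n h])
  qed (simp add: play_residual_empty)
qed (simp add: Let_def)

lemma transcript_eq_play: "transcript G s \<sigma> n = play G s \<sigma> n []"
  by (induction n) (simp_all add: play_Suc del: play.simps(2))

lemma play_insert: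
  assumes "weighted_graph G" "querying_strategy G s" "h \<in> histories G s" "e \<notin> residual G h"
  shows "play G s (insert e \<sigma>) n h = play G s \<sigma> n h"
  using assms(3,4)
proof (induction n arbitrary: h)
  case (Suc n)
  show ?case
  proof (cases "residual G h = {}")
    case False
    then have "s h \<in> residual G h" using Suc.prems assms by (auto simp: querying_strategy_def)
    then have se: "s h \<noteq> e" using Suc.prems by auto
    have "play G s (insert e \<sigma>) n (h @ [(s h, s h \<in> \<sigma>)]) = play G s \<sigma> n (h @ [(s h, s h \<in> \<sigma>)])"
      using Suc.prems by (intro Suc.IH histories_snoc[OF assms(1,2) Suc.prems(1) False]) auto
    then show ?thesis using False se by (simp del: residual_snoc)
  qed simp
qed simp

definition expect :: "('a set \<Rightarrow> real) \<Rightarrow> 'a set set \<Rightarrow> ('a set set \<Rightarrow> real) \<Rightarrow> real" where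
  "expect p B f = measure_pmf.expectation (Pi_pmf B False (\<lambda>e. bernoulli_pmf (p e))) (\<lambda>g. f {e \<in> B. g e})"

lemma expect_const [simp]: "expect p B (\<lambda>_. c) = c"
  by (simp add: expect_def)

lemma expect_split:
  assumes "finite B" "e \<in> B" "0 \<le> p e" "p e \<le> 1"
  shows "expect p B f = p e * expect p (B - {e}) (\<lambda>\<sigma>. f (insert e \<sigma>)) + (1 - p e) * expect p (B - {e}) f"
proof -
  let ?q = "\<lambda>e. bernoulli_pmf (p e)"
  define A where "A = B - {e}"
  have A: "finite A" "e \<notin> A" "B = insert e A" using assms by (auto simp: A_def)
  have fin: "finite (set_pmf (Pi_pmf A False ?q))"
    by (rule finite_subset[OF set_Pi_pmf_subset'[OF A(1)]])
       (auto intro!: finite_PiE_dflt simp: A(1))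
  have "expect p B f = measure_pmf.expectation
      (bind_pmf (bernoulli_pmf (p e)) (\<lambda>y. map_pmf (\<lambda>g. g(e := y)) (Pi_pmf A False ?q))) (\<lambda>g. f {x \<in> B. g x})"
    unfolding expect_def A(3) using A
    by (subst Pi_pmf_insert) (auto simp: map_pmf_def bind_assoc_pmf bind_return_pmf pair_pmf_def)
  also have "\<dots> = p e * measure_pmf.expectation (Pi_pmf A False ?q) (\<lambda>g. f {x \<in> B. (g(e := True)) x})
      + (1 - p e) * measure_pmf.expectation (Pi_pmf A False ?q) (\<lambda>g. f {x \<in> B. (g(e := False)) x})"
    using assms fin by (subst pmf_expectation_bind[where A = UNIV]) (auto simp: UNIV_bool)
  also have "(\<lambda>g. f {x \<in> B. (g(e := True)) x}) = (\<lambda>g. f (insert e {x \<in> A. g x}))"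
    using A by (intro ext arg_cong[of _ _ f]) auto
  also have "(\<lambda>g. f {x \<in> B. (g(e := False)) x}) = (\<lambda>g. f {x \<in> A. g x})"
    using A by (intro ext arg_cong[of _ _ f]) auto
  finally show ?thesis by (simp add: expect_def A_def)
qed

definition found :: "'a history \<Rightarrow> nat" where
  "found h = card {e. (e, True) \<in> set h}"

lemma expected_size_eq:
  "expected_size G s = expect (prob G) (edges G) (\<lambda>\<sigma>. real (found (play G s \<sigma> (card (edges G)) [])))"
  by (simp add: expected_size_def realization_def expect_def matching_def found_def transcript_eq_play)

lemma found_snoc:
  assumes "weighted_graph G" "e \<in> residual G h"
  shows "found (h @ [(e, b)]) = found h + of_bool b"
proof (cases b)
  case True
  have "{f. (f, True) \<in> set (h @ [(e, b)])} = insert e {f. (f, True) \<in> set h}" using True by auto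
  moreover have "finite {f. (f, True) \<in> set h}"
    by (rule finite_subset[of _ "fst ` set h"]) force+
  moreover have "e \<notin> {f. (f, True) \<in> set h}" using residual_not_queried assms by blast
  ultimately show ?thesis using True by (simp add: found_def)
qed (simp add: found_def)

lemma expect_play_Suc:
  assumes "weighted_graph G" "querying_strategy G s" "h \<in> histories G s"
    "residual G h \<subseteq> B" "B \<subseteq> edges G" "residual G h \<noteq> {}"
  shows "expect (prob G) B (\<lambda>\<sigma>. real (found (play G s \<sigma> (Suc n) h))) =
    prob G (s h) * expect (prob G) (B - {s h}) (\<lambda>\<sigma>. real (found (play G s \<sigma> n (h @ [(s h, True)]))))
    + (1 - prob G (s h)) * expect (prob G) (B - {s h}) (\<lambda>\<sigma>. real (found (play G s \<sigma> n (h @ [(s h, False)]))))"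
proof -
  have e: "s h \<in> residual G h" using assms by (auto simp: querying_strategy_def)
  have ne: "s h \<noteq> {}" using e residual_nonempty_edge[OF assms(1)] by blast
  have fin: "finite B" using assms(1,5) finite_subset by (auto simp: weighted_graph_def)
  have p: "0 \<le> prob G (s h)" "prob G (s h) \<le> 1"
    using e residual_subset[of G h] assms(1) by (force simp: weighted_graph_def)+
  have T: "play G s (insert (s h) \<sigma>) (Suc n) h = play G s \<sigma> n (h @ [(s h, True)])" for \<sigma>
    using assms(6) ne by (simp add: play_insert[OF assms(1,2) histories_snoc[OF assms(1-3,6)]])
  have F: "expect (prob G) (B - {s h}) (\<lambda>\<sigma>. real (found (play G s \<sigma> (Suc n) h)))
      = expect (prob G) (B - {s h}) (\<lambda>\<sigma>. real (found (play G s \<sigma> n (h @ [(s h, False)]))))"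
    unfolding expect_def using assms(6) by (intro Bochner_Integration.integral_cong) auto
  show ?thesis
    using expect_split[OF fin, of "s h" "prob G"] e assms(4) p by (simp add: T F subset_iff del: play.simps)
qed

lemma residual_step:
  assumes "weighted_graph G" "e \<in> residual G h"
  shows "residual G (h @ [(e, True)]) = {f \<in> residual G h - {e}. f \<inter> e = {}}"
proof -
  have "e \<noteq> {}" using assms residual_nonempty_edge by blast
  then show ?thesis by auto
qed

lemma expect_play_le:
  assumes "weighted_graph G" "querying_strategy G s" "h \<in> histories G s"
    "residual G h \<subseteq> B" "B \<subseteq> edges G"
  shows "expect (prob G) B (\<lambda>\<sigma>. real (found (play G s \<sigma> n h))) \<le> found h + opt (prob G) (residual G h)"
  using assms(3-)
proof (induction n arbitrary: h B)
  case 0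
  have "finite (residual G h)" "prob_on (prob G) (residual G h)"
    using assms(1) residual_subset[of G h]
    by (auto simp: weighted_graph_def prob_on_def finite_subset subset_iff less_imp_le)
  then have "opt (prob G) {} \<le> opt (prob G) (residual G h)" by (intro opt_mono) auto
  then show ?case by simp
next
  case (Suc n)
  show ?case
  proof (cases "residual G h = {}")
    case False
    have e: "s h \<in> residual G h" using False assms Suc.prems by (auto simp: querying_strategy_def)
    have p: "0 \<le> prob G (s h)" "prob G (s h) \<le> 1"
      using e residual_subset[of G h] assms(1) by (force simp: weighted_graph_def)+
    have fin: "finite (residual G h)"
      using assms(1) residual_subset[of G h] by (auto simp: weighted_graph_def finite_subset)
    have "expect (prob G) (B - {s h}) (\<lambda>\<sigma>. real (found (play G s \<sigma> n (h @ [(s h, b)]))))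
        \<le> found (h @ [(s h, b)]) + opt (prob G) (residual G (h @ [(s h, b)]))" for b
    proof (rule Suc.IH)
      show "h @ [(s h, b)] \<in> histories G s" using histories_snoc assms Suc.prems False by blast
      show "residual G (h @ [(s h, b)]) \<subseteq> B - {s h}"
        using Suc.prems residual_not_queried[OF assms(1), of "s h" b "h @ [(s h, b)]"]
        by (auto split: if_splits)
    qed (use Suc.prems in auto)
    note IH = this[of True] this[of False]
    have "expect (prob G) B (\<lambda>\<sigma>. real (found (play G s \<sigma> (Suc n) h))) \<le>
        prob G (s h) * (found (h @ [(s h, True)]) + opt (prob G) (residual G (h @ [(s h, True)])))
        + (1 - prob G (s h)) * (found (h @ [(s h, False)]) + opt (prob G) (residual G (h @ [(s h, False)])))"
      unfolding expect_play_Suc[OF assms(1,2) Suc.prems False]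
      using IH p by (intro convex_mono)
    also have "\<dots> = found h + (prob G (s h) * (1 + opt (prob G) {f \<in> residual G h - {s h}. f \<inter> s h = {}})
        + (1 - prob G (s h)) * opt (prob G) (residual G h - {s h}))"
      unfolding residual_step[OF assms(1) e] found_snoc[OF assms(1) e] by (simp add: algebra_simps)
    also have "\<dots> \<le> found h + opt (prob G) (residual G h)"
      using opt_ge[OF fin e, of "prob G"] by simp
    finally show ?thesis .
  qed simp
qed

lemma expect_play_eq:
  assumes "weighted_graph G" "querying_strategy G s" "h \<in> histories G s"
    "residual G h \<subseteq> B" "B \<subseteq> edges G" "card (residual G h) \<le> n"
    and greedy: "\<And>h. h \<in> histories G s \<Longrightarrow> residual G h \<noteq> {} \<Longrightarrow>
      opt (prob G) (residual G h) =
        prob G (s h) * (1 + opt (prob G) {f \<in> residual G h - {s h}. f \<inter> s h = {}})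
        + (1 - prob G (s h)) * opt (prob G) (residual G h - {s h})"
  shows "expect (prob G) B (\<lambda>\<sigma>. real (found (play G s \<sigma> n h))) = found h + opt (prob G) (residual G h)"
  using assms(3-6)
proof (induction n arbitrary: h B)
  case 0
  have "finite (residual G h)"
    using assms(1) residual_subset[of G h] by (auto simp: weighted_graph_def finite_subset)
  then show ?case using 0 by simp
next
  case (Suc n)
  show ?case
  proof (cases "residual G h = {}")
    case False
    have e: "s h \<in> residual G h" using False assms Suc.prems by (auto simp: querying_strategy_def)
    have fin: "finite (residual G h)"
      using assms(1) residual_subset[of G h] by (auto simp: weighted_graph_def finite_subset)
    have "expect (prob G) (B - {s h}) (\<lambda>\<sigma>. real (found (play G s \<sigma> n (h @ [(s h, b)]))))
        = found (h @ [(s h, b)]) + opt (prob G) (residual G (h @ [(s h, b)]))" for b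
    proof (rule Suc.IH)
      show "h @ [(s h, b)] \<in> histories G s" using histories_snoc assms Suc.prems False by blast
      show "residual G (h @ [(s h, b)]) \<subseteq> B - {s h}"
        using Suc.prems residual_not_queried[OF assms(1), of "s h" b "h @ [(s h, b)]"]
        by (auto split: if_splits)
      have "residual G (h @ [(s h, b)]) \<subseteq> residual G h - {s h}"
        using residual_not_queried[OF assms(1), of "s h" b "h @ [(s h, b)]"] by (auto split: if_splits)
      then have "card (residual G (h @ [(s h, b)])) \<le> card (residual G h - {s h})"
        using fin by (intro card_mono) auto
      also have "\<dots> < card (residual G h)" using card_residual_less(2)[OF fin e] .
      finally show "card (residual G (h @ [(s h, b)])) \<le> n" using Suc.prems by simp
    qed (use Suc.prems in auto)
    note IH = this[of True] this[of False]
    have "expect (prob G) B (\<lambda>\<sigma>. real (found (play G s \<sigma> (Suc n) h))) =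
        prob G (s h) * (found (h @ [(s h, True)]) + opt (prob G) (residual G (h @ [(s h, True)])))
        + (1 - prob G (s h)) * (found (h @ [(s h, False)]) + opt (prob G) (residual G (h @ [(s h, False)])))"
      unfolding expect_play_Suc[OF assms(1,2) Suc.prems(1-3) False] IH ..
    also have "\<dots> = found h + (prob G (s h) * (1 + opt (prob G) {f \<in> residual G h - {s h}. f \<inter> s h = {}})
        + (1 - prob G (s h)) * opt (prob G) (residual G h - {s h}))"
      unfolding residual_step[OF assms(1) e] found_snoc[OF assms(1) e] by (simp add: algebra_simps)
    also have "\<dots> = found h + opt (prob G) (residual G h)"
      using greedy[OF Suc.prems(1) False] by simp
    finally show ?thesis .
  qed simp
qed

lemma optimal_strategyI:
  assumes G: "weighted_graph G"
    and query: "\<And>h. h \<in> histories G s \<Longrightarrow> residual G h \<noteq> {} \<Longrightarrow> s h \<in> residual G h"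
    and greedy: "\<And>h. h \<in> histories G s \<Longrightarrow> residual G h \<noteq> {} \<Longrightarrow>
      opt (prob G) (residual G h) =
        prob G (s h) * (1 + opt (prob G) {f \<in> residual G h - {s h}. f \<inter> s h = {}})
        + (1 - prob G (s h)) * opt (prob G) (residual G h - {s h})"
  shows "optimal_strategy G s"
proof -
  have q: "querying_strategy G s" using query by (simp add: querying_strategy_def)
  have "expected_size G s' \<le> opt (prob G) (edges G)" if "querying_strategy G s'" for s'
    using expect_play_le[OF G that Nil_in_histories, of "edges G"]
    by (simp add: expected_size_eq found_def)
  moreover have "expected_size G s = opt (prob G) (edges G)"
    using expect_play_eq[OF G q Nil_in_histories, of "edges G" "card (edges G)"] greedy
    by (simp add: expected_size_eq found_def)
  ultimately show ?thesis using q by (simp add: optimal_strategy_def)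
qed

section \<open>Subgraphs of minimum degree two\<close>

definition min_degree_two :: "'a set set \<Rightarrow> bool" where
  "min_degree_two F \<longleftrightarrow> (\<forall>v\<in>\<Union>F. \<exists>e\<in>F. \<exists>f\<in>F. e \<noteq> f \<and> v \<in> e \<and> v \<in> f)"

lemma min_degree_two_potential:
  assumes fin: "finite K" and two: "\<And>e. e \<in> K \<Longrightarrow> card e = 2" and K: "min_degree_two K"
    and FK: "F \<subset> K"
    and X: "\<And>C. C \<subseteq> K \<Longrightarrow> min_degree_two C \<Longrightarrow> C \<noteq> {} \<Longrightarrow> C \<inter> X \<noteq> {}"
  shows "card F + card (F \<inter> X) + card (\<Union>K) < card K + card (K \<inter> X) + card (\<Union>F)"
proof -
  have fine: "finite e" if "e \<in> K" for e using two[OF that] card.infinite by fastforce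
  have finU: "finite (\<Union>K)" using fin fine by blast
  define W where "W = \<Union>K - \<Union>F"
  define I where "I = {e \<in> K. e \<inter> W \<noteq> {}}"
  have finW: "finite W" and finI: "finite I" using finU fin by (auto simp: W_def I_def)
  have IF: "I \<subseteq> K - F" by (auto simp: I_def W_def)
  have UF: "\<Union>F \<subseteq> \<Union>K" using FK by auto
  have cW: "card W + card (\<Union>F) = card (\<Union>K)"
    using card_Diff_subset[OF finite_subset[OF UF finU] UF] card_mono[OF finU UF] by (simp add: W_def)
  have FK': "F \<subseteq> K" using FK by blast
  have cF: "card (K - F) + card F = card K"
    using card_Diff_subset[OF finite_subset[OF FK' fin] FK'] card_mono[OF fin FK'] by simp
  have "(\<Sum>w\<in>W. 2) \<le> (\<Sum>w\<in>W. card {e \<in> I. w \<in> e})"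
  proof (intro sum_mono)
    fix w assume w: "w \<in> W"
    then obtain e f where ef: "e \<in> K" "f \<in> K" "e \<noteq> f" "w \<in> e" "w \<in> f"
      using K unfolding min_degree_two_def W_def by blast
    then have "{e, f} \<subseteq> {e \<in> I. w \<in> e}" using w by (auto simp: I_def)
    then have "card {e, f} \<le> card {e \<in> I. w \<in> e}" using finI by (intro card_mono) auto
    then show "2 \<le> card {e \<in> I. w \<in> e}" using ef by simp
  qed
  also have "\<dots> = (\<Sum>e\<in>I. card {w \<in> W. w \<in> e})"
    using sum.swap_restrict[OF finW finI, of "\<lambda>_ _. 1::nat" "\<lambda>w e. w \<in> e"] by simp
  finally have cnt: "2 * card W \<le> (\<Sum>e\<in>I. card {w \<in> W. w \<in> e})" by simp
  have eW: "card {w \<in> W. w \<in> e} \<le> 2" if "e \<in> I" for e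
    using that two[of e] fine[of e] card_mono[of e "{w \<in> W. w \<in> e}"] by (auto simp: I_def)
  then have "(\<Sum>e\<in>I. card {w \<in> W. w \<in> e}) \<le> (\<Sum>e\<in>I. 2)" by (intro sum_mono)
  with cnt have WI: "card W \<le> card I" by simp
  have IKF: "card I \<le> card (K - F)" using IF fin by (intro card_mono) auto
  have FX: "card (F \<inter> X) \<le> card (K \<inter> X)" using FK fin by (intro card_mono) auto
  show ?thesis
  proof (rule ccontr)
    assume "\<not> ?thesis"
    then have eq: "card I = card W" "card I = card (K - F)" "card (F \<inter> X) = card (K \<inter> X)"
      using WI IKF FX cW cF by linarith+
    have I: "I = K - F" using IF eq fin by (intro card_subset_eq) auto
    have full: "card {w \<in> W. w \<in> e} = 2" if "e \<in> I" for e
    proof (rule ccontr)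
      assume "card {w \<in> W. w \<in> e} \<noteq> 2"
      then have "card {w \<in> W. w \<in> e} < 2" using eW[OF that] by simp
      then have "(\<Sum>e\<in>I. card {w \<in> W. w \<in> e}) < (\<Sum>e\<in>I. 2)"
        using eW that finI by (intro sum_strict_mono_ex1) auto
      then show False using cnt eq by simp
    qed
    have sub: "e \<subseteq> W" if "e \<in> I" for e
    proof -
      have "{w \<in> W. w \<in> e} = e"
        using full[OF that] two[of e] fine[of e] that by (intro card_subset_eq) (auto simp: I_def)
      then show ?thesis by auto
    qed
    have "min_degree_two I" unfolding min_degree_two_def
    proof
      fix v assume "v \<in> \<Union>I"
      then have v: "v \<in> W" using sub by auto
      then obtain e f where ef: "e \<in> K" "f \<in> K" "e \<noteq> f" "v \<in> e" "v \<in> f"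
        using K unfolding min_degree_two_def W_def by blast
      then have "e \<in> I" "f \<in> I" using v by (auto simp: I_def)
      then show "\<exists>e\<in>I. \<exists>f\<in>I. e \<noteq> f \<and> v \<in> e \<and> v \<in> f" using ef by blast
    qed
    moreover have "I \<noteq> {}" using I FK by auto
    ultimately obtain e where "e \<in> I" "e \<in> X" using X[of I] I_def by blast
    then have "F \<inter> X \<subset> K \<inter> X" using I FK by auto
    then have "card (F \<inter> X) < card (K \<inter> X)" using fin by (intro psubset_card_mono) auto
    then show False using eq by simp
  qed
qed

lemma spanning_forest:
  assumes G: "weighted_graph G" "connected_graph G" and n: "1 \<le> n" "n \<le> card (nodes G)"
  shows "\<exists>U T. U \<subseteq> nodes G \<and> card U = n \<and> T \<subseteq> edges G \<and> \<Union>T \<subseteq> U \<and> card T + 1 = n \<and>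
    (\<forall>A\<subseteq>T. card A \<le> card (\<Union>A)) \<and> (\<forall>C\<subseteq>T. min_degree_two C \<longrightarrow> C = {})"
  using n
proof (induction n rule: nat_induct_at_least)
  case base
  then obtain v where "v \<in> nodes G" by (metis card.empty not_one_le_zero ex_in_conv)
  then show ?case by (intro exI[of _ "{v}"] exI[of _ "{}"]) auto
next
  case (Suc n)
  have finE: "finite (edges G)" and two: "\<And>e. e \<in> edges G \<Longrightarrow> card e = 2"
    using G(1) by (auto simp: weighted_graph_def)
  have fine: "finite e" if "e \<in> edges G" for e using two[OF that] card.infinite by fastforce
  have finV: "finite (nodes G)" using finE fine by (auto simp: nodes_def)
  obtain U T where UT: "U \<subseteq> nodes G" "card U = n" "T \<subseteq> edges G" "\<Union>T \<subseteq> U" "card T + 1 = n"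
    "\<And>A. A \<subseteq> T \<Longrightarrow> card A \<le> card (\<Union>A)" "\<And>C. C \<subseteq> T \<Longrightarrow> min_degree_two C \<Longrightarrow> C = {}"
    using Suc by auto
  obtain a where a: "a \<in> U" using UT(2) Suc.hyps by (metis card.empty not_one_le_zero ex_in_conv)
  obtain b where b: "b \<in> nodes G" "b \<notin> U" using UT(1,2) Suc.prems by (metis not_less_eq_eq order_refl subsetI subset_antisym)
  have "(a, b) \<in> {(x, y). {x, y} \<in> edges G}\<^sup>*" using G(2) a b UT(1) by (auto simp: connected_graph_def)
  then have "\<exists>x y. x \<in> U \<and> y \<notin> U \<and> {x, y} \<in> edges G"
    using a b(2) by (induction rule: converse_rtrancl_induct) blast+
  then obtain x y where xy: "x \<in> U" "y \<notin> U" "{x, y} \<in> edges G" by blast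
  let ?e = "{x, y}"
  have yT: "y \<notin> f" if "f \<in> T" for f using that xy(2) UT(4) by blast
  have eT: "?e \<notin> T" using yT by blast
  have finT: "finite T" using UT(3) finE finite_subset by blast
  have finU: "finite U" using UT(1) finV finite_subset by blast
  have yn: "y \<in> nodes G" using xy(3) by (auto simp: nodes_def)
  show ?case
  proof (intro exI[of _ "insert y U"] exI[of _ "insert ?e T"] conjI allI impI)
    show "insert y U \<subseteq> nodes G" using UT(1) yn by blast
    show "card (insert y U) = Suc n" using UT(2) finU xy(2) by simp
    show "insert ?e T \<subseteq> edges G" using UT(3) xy(3) by blast
    show "\<Union>(insert ?e T) \<subseteq> insert y U" using UT(4) xy(1) by blast
    show "card (insert ?e T) + 1 = Suc n" using UT(5) finT eT by simp
  next
    fix A assume A: "A \<subseteq> insert ?e T"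
    show "card A \<le> card (\<Union>A)"
    proof (cases "?e \<in> A")
      case True
      have AT: "A - {?e} \<subseteq> T" using A by blast
      have finA: "finite A" using A finT finite_subset by blast
      have "A \<subseteq> edges G" using A UT(3) xy(3) by blast
      then have finUA: "finite (\<Union>A)" using finA fine by blast
      have "card A = Suc (card (A - {?e}))" using True finA by (metis card.remove)
      also have "\<dots> \<le> Suc (card (\<Union>(A - {?e})))" using UT(6)[OF AT] by simp
      also have "\<dots> = card (insert y (\<Union>(A - {?e})))"
        using yT AT finite_subset[OF _ finUA, of "\<Union>(A - {?e})"] by (subst card_insert_disjoint) auto
      also have "\<dots> \<le> card (\<Union>A)" using finUA True by (intro card_mono) auto
      finally show ?thesis .
    next
      case False
      then show ?thesis using A UT(6) by blast
    qed
  next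
    fix C assume C: "C \<subseteq> insert ?e T" "min_degree_two C"
    have "?e \<notin> C"
    proof
      assume "?e \<in> C"
      then have "y \<in> \<Union>C" by blast
      then obtain f g where fg: "f \<in> C" "g \<in> C" "f \<noteq> g" "y \<in> f" "y \<in> g"
        using C(2) unfolding min_degree_two_def by blast
      then have "f = ?e" "g = ?e" using C(1) yT by blast+
      then show False using fg by simp
    qed
    then show "C = {}" using C UT(7) by blast
  qed
qed

lemma sparse_potential_bound:
  assumes G: "weighted_graph G" "connected_graph G"
    and d: "int (card (edges G)) \<le> int (card (nodes G)) + d"
  obtains X where "\<And>C. C \<subseteq> edges G \<Longrightarrow> min_degree_two C \<Longrightarrow> C \<noteq> {} \<Longrightarrow> C \<inter> X \<noteq> {}"
    "\<And>F. F \<subseteq> edges G \<Longrightarrow> card F + card (F \<inter> X) \<le> card (\<Union>F) + nat (2 * (d + 1))"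
proof (cases "edges G = {}")
  case True
  then show ?thesis using that[of "{}"] by auto
next
  case False
  have finE: "finite (edges G)" and two: "\<And>e. e \<in> edges G \<Longrightarrow> card e = 2"
    using G(1) by (auto simp: weighted_graph_def)
  have fine: "finite e" if "e \<in> edges G" for e using two[OF that] card.infinite by fastforce
  have finV: "finite (nodes G)" using finE fine by (auto simp: nodes_def)
  have "nodes G \<noteq> {}" using False two by (fastforce simp: nodes_def)
  then have "1 \<le> card (nodes G)" using finV by (simp add: Suc_le_eq card_gt_0_iff)
  then obtain T where T: "T \<subseteq> edges G" "card T + 1 = card (nodes G)"
    "\<And>A. A \<subseteq> T \<Longrightarrow> card A \<le> card (\<Union>A)" "\<And>C. C \<subseteq> T \<Longrightarrow> min_degree_two C \<Longrightarrow> C = {}"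
    using spanning_forest[OF G _ order_refl] by auto
  define X where "X = edges G - T"
  have finT: "finite T" using T(1) finE finite_subset by blast
  have "card X + card T = card (edges G)"
    using T(1) finE finT by (simp add: X_def card_Diff_subset card_mono)
  then have cX: "int (card X) \<le> d + 1" using T(2) d by linarith
  show ?thesis
  proof (rule that[of X])
    fix C assume "C \<subseteq> edges G" "min_degree_two C" "C \<noteq> {}"
    then show "C \<inter> X \<noteq> {}" using T(4)[of C] by (auto simp: X_def)
  next
    fix F assume F: "F \<subseteq> edges G"
    have finF: "finite F" "finite (\<Union>F)" using F finE fine finite_subset by blast+
    have "(F \<inter> T) \<union> (F \<inter> X) = F" using F by (auto simp: X_def)
    then have "card F \<le> card (F \<inter> T) + card (F \<inter> X)"
      using card_Un_le[of "F \<inter> T" "F \<inter> X"] by simp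
    moreover have "card (F \<inter> T) \<le> card (\<Union>(F \<inter> T))" by (rule T(3)) simp
    moreover have "card (\<Union>(F \<inter> T)) \<le> card (\<Union>F)" using finF by (intro card_mono) auto
    moreover have "card (F \<inter> X) \<le> card X" using finE by (intro card_mono) (auto simp: X_def)
    moreover have "2 * card X \<le> nat (2 * (d + 1))" 
      using cX of_nat_0_le_iff[of "card X", where 'a = int] by (subst le_nat_iff) simp_all
    ultimately show "card F + card (F \<inter> X) \<le> card (\<Union>F) + nat (2 * (d + 1))"
      by linarith
  qed
qed

section \<open>Random availability of nodes\<close>

fun avail_opt :: "('a set \<Rightarrow> real) \<Rightarrow> ('a \<times> real) list \<Rightarrow> 'a set set \<Rightarrow> real" where
  "avail_opt p [] E = opt p E"
| "avail_opt p ((x, r) # L) E = (1 - r) * avail_opt p L {f \<in> E. x \<notin> f} + r * avail_opt p L E"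

definition avail_prob :: "('a \<times> real) list \<Rightarrow> 'a \<Rightarrow> real" where
  "avail_prob L x = prod_list (map snd (filter (\<lambda>(y, r). y = x) L))"

lemma avail_prob_simps [simp]:
  "avail_prob [] x = 1"
  "avail_prob ((y, r) # L) x = (if y = x then r * avail_prob L x else avail_prob L x)"
  by (auto simp: avail_prob_def)

lemma remove_node_absent: "x \<notin> \<Union>E \<Longrightarrow> {f \<in> E. x \<notin> f} = E"
  by auto

lemma avail_opt_absent: "x \<notin> \<Union>E \<Longrightarrow> avail_opt p ((x, r) # L) E = avail_opt p L E"
  by (simp add: remove_node_absent algebra_simps)

lemma avail_opt_filter_absent:
  "x \<notin> \<Union>E \<Longrightarrow> avail_opt p (filter (\<lambda>(y, r). y \<noteq> x) L) E = avail_opt p L E"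
proof (induction L arbitrary: E)
  case (Cons a L)
  obtain y r where a: "a = (y, r)" by force
  have "x \<notin> \<Union>{f \<in> E. y \<notin> f}" using Cons.prems by blast
  then show ?case
    using Cons.IH[of "{f \<in> E. y \<notin> f}"] Cons.IH[of E] Cons.prems avail_opt_absent[of x E p r L]
    by (auto simp: a)
qed simp

lemma avail_opt_pendant:
  assumes "finite E" "prob_on p E" "u \<noteq> v" "{u, v} \<in> E" "\<And>f. f \<in> E \<Longrightarrow> u \<in> f \<Longrightarrow> f = {u, v}"
  shows "avail_opt p L E = avail_prob L v * (p {u, v} * avail_prob L u)
    + avail_opt p ((v, 1 - p {u, v} * avail_prob L u) # L) (E - {{u, v}})"
  using assms
proof (induction L arbitrary: E)
  case Nil
  have "{f \<in> E - {{u, v}}. v \<notin> f} = {f \<in> E. v \<notin> f}" by auto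
  then show ?case using opt_pendant[OF Nil(1,2,4,5)] by (simp add: algebra_simps)
next
  case (Cons a L)
  obtain x r where a: "a = (x, r)" by force
  let ?e = "{u, v}"
  have eqs: "{f \<in> E - {?e}. v \<notin> f} = {f \<in> E. v \<notin> f}" for E :: "'a set set" by auto
  have un: "u \<notin> \<Union>(E - {?e})" "u \<notin> \<Union>{f \<in> E. v \<notin> f}" using Cons.prems(5) by blast+
  have IH: "avail_opt p L F = avail_prob L v * (p ?e * avail_prob L u)
      + p ?e * avail_prob L u * avail_opt p L {f \<in> F. v \<notin> f}
      + (1 - p ?e * avail_prob L u) * avail_opt p L (F - {?e})" if "F \<subseteq> E" "?e \<in> F" for F
  proof -
    have "avail_opt p L F = avail_prob L v * (p ?e * avail_prob L u)
        + avail_opt p ((v, 1 - p ?e * avail_prob L u) # L) (F - {?e})"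
      using that Cons.prems finite_subset[OF that(1)] prob_on_subset[OF _ that(1)] by (intro Cons.IH) blast+
    then show ?thesis by (simp add: eqs del: Diff_iff)
  qed
  have goal: ?case if "avail_opt p (a # L) E = avail_prob (a # L) v * (p ?e * avail_prob (a # L) u)
      + p ?e * avail_prob (a # L) u * avail_opt p (a # L) {f \<in> E. v \<notin> f}
      + (1 - p ?e * avail_prob (a # L) u) * avail_opt p (a # L) (E - {?e})"
    using that unfolding avail_opt.simps(2)[of p v] eqs by simp
  consider "x = u" | "x = v" "x \<noteq> u" | "x \<noteq> u" "x \<noteq> v" by blast
  then show ?case
  proof cases
    case 1
    have "{f \<in> E. u \<notin> f} = E - {?e}" using Cons.prems(5) by blast
    then have *: "avail_opt p (a # L) E = (1 - r) * avail_opt p L (E - {?e}) + r * avail_opt p L E"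
      using 1 by (simp add: a)
    have **: "avail_prob (a # L) v = avail_prob L v" "avail_prob (a # L) u = r * avail_prob L u"
      "avail_opt p (a # L) {f \<in> E. v \<notin> f} = avail_opt p L {f \<in> E. v \<notin> f}"
      "avail_opt p (a # L) (E - {?e}) = avail_opt p L (E - {?e})"
      using 1 Cons.prems(3) avail_opt_absent[OF un(1)] avail_opt_absent[OF un(2)] by (simp_all only: a avail_prob_simps if_True if_False refl)
    show ?thesis
      by (rule goal) (simp only: * ** IH[OF order_refl Cons.prems(4)], simp only: algebra_simps)
  next
    case 2
    have *: "avail_opt p (a # L) E = (1 - r) * avail_opt p L {f \<in> E. v \<notin> f} + r * avail_opt p L E"
      using 2 by (simp add: a)
    have v: "v \<notin> \<Union>{f \<in> E. v \<notin> f}" by blast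
    have **: "avail_prob (a # L) v = r * avail_prob L v" "avail_prob (a # L) u = avail_prob L u"
      "avail_opt p (a # L) {f \<in> E. v \<notin> f} = avail_opt p L {f \<in> E. v \<notin> f}"
      "avail_opt p (a # L) (E - {?e}) = (1 - r) * avail_opt p L {f \<in> E. v \<notin> f} + r * avail_opt p L (E - {?e})"
      using 2 Cons.prems(3) avail_opt_absent[OF v] by (simp_all only: a avail_prob_simps if_True if_False refl avail_opt.simps eqs)
    show ?thesis
      by (rule goal) (simp only: * ** IH[OF order_refl Cons.prems(4)], simp only: algebra_simps)
  next
    case 3
    have ex: "{f \<in> E. x \<notin> f} \<subseteq> E" "?e \<in> {f \<in> E. x \<notin> f}" using 3 Cons.prems(4) by auto
    have *: "avail_opt p (a # L) F = (1 - r) * avail_opt p L {f \<in> F. x \<notin> f} + r * avail_opt p L F" for F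
      by (simp add: a)
    have sw: "{f \<in> {f \<in> E. v \<notin> f}. x \<notin> f} = {f \<in> {f \<in> E. x \<notin> f}. v \<notin> f}"
      "{f \<in> E - {?e}. x \<notin> f} = {f \<in> E. x \<notin> f} - {?e}" by auto
    have **: "avail_prob (a # L) v = avail_prob L v" "avail_prob (a # L) u = avail_prob L u"
      using 3 by (simp_all add: a)
    show ?thesis
      by (rule goal) (simp only: * ** sw IH[OF order_refl Cons.prems(4)] IH[OF ex], simp only: algebra_simps)
  qed
qed

section \<open>The algorithm\<close>

type_synonym entry = "nat \<times> nat \<times> nat \<times> nat"

fun ends :: "entry \<Rightarrow> nat set" where
  "ends (u, v, r) = {u, v}"

definition edge_set :: "entry list \<Rightarrow> nat set set" where
  "edge_set E = ends ` set E"

definition delete_node :: "nat \<Rightarrow> entry list \<Rightarrow> entry list" where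
  "delete_node x E = filter (\<lambda>e. x \<notin> ends e) E"

definition delete_edge :: "nat \<Rightarrow> nat \<Rightarrow> entry list \<Rightarrow> entry list" where
  "delete_edge x y E = filter (\<lambda>e. ends e \<noteq> {x, y}) E"

definition deg :: "nat \<Rightarrow> entry list \<Rightarrow> nat" where
  "deg x E = length (filter (\<lambda>e. x \<in> ends e) E)"

fun find_leaf :: "entry list \<Rightarrow> entry list \<Rightarrow> entry option" where
  "find_leaf [] E = None"
| "find_leaf ((u, v, r) # T) E =
     (if deg u E - 1 = 0 then Some (u, v, r)
      else if deg v E - 1 = 0 then Some (v, u, r) else find_leaf T E)"

definition fmul :: "nat \<times> nat \<Rightarrow> nat \<times> nat \<Rightarrow> nat \<times> nat" where
  "fmul x y = (fst x * fst y, snd x * snd y)"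

definition fadd :: "nat \<times> nat \<Rightarrow> nat \<times> nat \<Rightarrow> nat \<times> nat" where
  "fadd x y = (fst x * snd y + fst y * snd x, snd x * snd y)"

definition fcompl :: "nat \<times> nat \<Rightarrow> nat \<times> nat" where
  "fcompl x = (snd x - fst x, snd x)"

fun availability :: "nat \<Rightarrow> entry list \<Rightarrow> nat \<times> nat" where
  "availability x [] = (1, 1)"
| "availability x ((u, v, r) # L) = (if u \<noteq> x then availability x L else fmul r (availability x L))"

fun best :: "(entry \<Rightarrow> nat \<times> nat) \<Rightarrow> entry list \<Rightarrow> (nat \<times> nat) \<times> nat \<times> nat" where
  "best s [] = ((0, 1), (0, 0))"
| "best s ((u, v, r) # T) =
     (let b = best s T; c = s (u, v, r)
      in if fst c * snd (fst b) < fst (fst b) * snd c then b else (c, (u, v)))"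

lemma best_cong [fundef_cong]:
  "S = T \<Longrightarrow> (\<And>c. c \<in> set T \<Longrightarrow> s c = t c) \<Longrightarrow> best s S = best t T"
proof (induction T arbitrary: S)
  case (Cons c T)
  then show ?case by (cases c) (auto simp: Let_def)
qed simp

lemma length_delete_node: "length (delete_node x E) + deg x E = length E"
  using sum_length_filter_compl[of "\<lambda>e. x \<in> ends e" E] by (simp add: delete_node_def deg_def)

lemma deg_pos: "e \<in> set E \<Longrightarrow> x \<in> ends e \<Longrightarrow> 0 < deg x E"
  by (auto simp: deg_def filter_empty_conv)

lemma length_delete_edge_less: "(u, v, r) \<in> set E \<Longrightarrow> length (delete_edge u v E) < length E"
  unfolding delete_edge_def by (rule length_filter_less[of "(u, v, r)"]) auto

lemma length_delete_endpoints_less: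
  assumes "(u, v, r) \<in> set E"
  shows "length (delete_node v (delete_node u E)) < length E"
  using length_delete_node[of v "delete_node u E"] length_delete_node[of u E] deg_pos[OF assms, of u]
  by auto

lemma find_leaf_Some:
  assumes "find_leaf T E = Some (u, v, r)" "set T \<subseteq> set E"
  shows "(u, v, r) \<in> set T \<or> (v, u, r) \<in> set T" "deg u E = 1"
proof -
  have "((u, v, r) \<in> set T \<or> (v, u, r) \<in> set T) \<and> deg u E = 1"
    using assms
  proof (induction T E rule: find_leaf.induct)
    case (2 x y s T E)
    have "0 < deg x E" "0 < deg y E"
      using deg_pos[of "(x, y, s)" E] 2(3) by auto
    then show ?case using 2 by (auto split: if_splits)
  qed simp
  then show "(u, v, r) \<in> set T \<or> (v, u, r) \<in> set T" "deg u E = 1" by auto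
qed

lemma find_leaf_length_less:
  assumes "find_leaf E E = Some (u, v, r)"
  shows "length (delete_node u E) < length E"
  using length_delete_node[of u E] find_leaf_Some(2)[OF assms] by simp

lemma length_delete_node_le: "length (delete_node x E) \<le> length E"
  by (simp add: delete_node_def)

definition score :: "(entry list \<Rightarrow> nat \<times> nat) \<Rightarrow> entry list \<Rightarrow> entry \<Rightarrow> nat \<times> nat" where
  "score val E = (\<lambda>(u, v, r). fadd (fmul r (fadd (1, 1) (val (delete_node v (delete_node u E)))))
     (fmul (fcompl r) (val (delete_edge u v E))))"

lemma score_cong [fundef_cong]:
  assumes "E = E'" "c = c'"
    "\<And>u v r. c' = (u, v, r) \<Longrightarrow> val (delete_node v (delete_node u E')) = val' (delete_node v (delete_node u E'))"
    "\<And>u v r. c' = (u, v, r) \<Longrightarrow> val (delete_edge u v E') = val' (delete_edge u v E')"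
  shows "score val E c = score val' E' c'"
  using assms by (cases c') (auto simp: score_def)

lemma search_measure:
  assumes "find_leaf E E = Some (u, v, r)"
  shows "Suc (2 * length (delete_node u E) + length (delete_node u L)) < 2 * length E + length L"
  using find_leaf_length_less[OF assms] length_delete_node_le[of u L] by linarith

text \<open>
  \<open>search_value E L\<close> is the optimal value of the graph \<open>E\<close> when nodes are available at random: an entry
  \<open>(x, x, r)\<close> of \<open>L\<close> says that \<open>x\<close> is available with probability \<open>r\<close>. A node may have several entries,
  whose probabilities multiply, or none, and entries of nodes outside \<open>E\<close> are skipped.
\<close>

function search_value :: "entry list \<Rightarrow> entry list \<Rightarrow> nat \<times> nat" where
  "search_value E L =
     (if E = [] then (0, 1)
      else case find_leaf E E of
        Some (u, v, r) \<Rightarrow>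
          fadd (fmul (availability v L) (fmul r (availability u L)))
            (search_value (delete_node u E) ((v, v, fcompl (fmul r (availability u L))) # delete_node u L))
      | None \<Rightarrow>
          (case L of
             [] \<Rightarrow> fst (best (\<lambda>c. score (\<lambda>F. search_value F []) E c) E)
           | (x, y, r) # L' \<Rightarrow>
               (if deg x E = 0 then search_value E L'
                else fadd (fmul (fcompl r) (search_value (delete_node x E) L')) (fmul r (search_value E L')))))"
  by pat_completeness auto
termination
  by (relation "Wellfounded.measure (\<lambda>(E, L). 2 * length E + length L)")
    (auto dest: length_delete_endpoints_less length_delete_edge_less
      intro: search_measure le_imp_less_Suc simp: length_delete_node_le)

text \<open>The extra \<open>1 +\<close> per edge in the case without leaves accounts for the work of \<open>best\<close>.\<close>

function calls :: "entry list \<Rightarrow> entry list \<Rightarrow> nat" where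
  "calls E L =
     (if E = [] then 1
      else case find_leaf E E of
        Some (u, v, r) \<Rightarrow>
          1 + calls (delete_node u E) ((v, v, fcompl (fmul r (availability u L))) # delete_node u L)
      | None \<Rightarrow>
          (case L of
             [] \<Rightarrow> 1 + (\<Sum>(u, v, r)\<leftarrow>E. 1 + calls (delete_node v (delete_node u E)) [] + calls (delete_edge u v E) [])
           | (x, y, r) # L' \<Rightarrow>
               (if deg x E = 0 then 1 + calls E L'
                else 1 + calls (delete_node x E) L' + calls E L')))"
  by pat_completeness auto
termination
  by (relation "Wellfounded.measure (\<lambda>(E, L). 2 * length E + length L)")
    (auto dest: length_delete_endpoints_less length_delete_edge_less
      intro: search_measure le_imp_less_Suc simp: length_delete_node_le)

declare search_value.simps [simp del] calls.simps [simp del]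

lemma search_value_simps:
  "search_value [] L = (0, 1)"
  "E \<noteq> [] \<Longrightarrow> find_leaf E E = Some (u, v, r) \<Longrightarrow>
     search_value E L = fadd (fmul (availability v L) (fmul r (availability u L)))
       (search_value (delete_node u E) ((v, v, fcompl (fmul r (availability u L))) # delete_node u L))"
  "E \<noteq> [] \<Longrightarrow> find_leaf E E = None \<Longrightarrow> search_value E [] = fst (best (score (\<lambda>F. search_value F []) E) E)"
  "E \<noteq> [] \<Longrightarrow> find_leaf E E = None \<Longrightarrow> deg x E = 0 \<Longrightarrow> search_value E ((x, y, r) # L) = search_value E L"
  "E \<noteq> [] \<Longrightarrow> find_leaf E E = None \<Longrightarrow> deg x E \<noteq> 0 \<Longrightarrow>
     search_value E ((x, y, r) # L) = fadd (fmul (fcompl r) (search_value (delete_node x E) L)) (fmul r (search_value E L))"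
  by (subst search_value.simps; simp)+

lemma calls_simps:
  "calls [] L = 1"
  "E \<noteq> [] \<Longrightarrow> find_leaf E E = Some (u, v, r) \<Longrightarrow>
     calls E L = 1 + calls (delete_node u E) ((v, v, fcompl (fmul r (availability u L))) # delete_node u L)"
  "E \<noteq> [] \<Longrightarrow> find_leaf E E = None \<Longrightarrow>
     calls E [] = 1 + (\<Sum>(u, v, r)\<leftarrow>E. 1 + calls (delete_node v (delete_node u E)) [] + calls (delete_edge u v E) [])"
  "E \<noteq> [] \<Longrightarrow> find_leaf E E = None \<Longrightarrow> deg x E = 0 \<Longrightarrow> calls E ((x, y, r) # L) = 1 + calls E L"
  "E \<noteq> [] \<Longrightarrow> find_leaf E E = None \<Longrightarrow> deg x E \<noteq> 0 \<Longrightarrow>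
     calls E ((x, y, r) # L) = 1 + calls (delete_node x E) L + calls E L"
  by (subst calls.simps; simp)+

lemma search_induct [case_names empty leaf skip branch choose]:
  assumes "\<And>L. P [] L"
    and "\<And>E L u v r. E \<noteq> [] \<Longrightarrow> find_leaf E E = Some (u, v, r) \<Longrightarrow>
      (\<And>s. P (delete_node u E) ((v, v, s) # delete_node u L)) \<Longrightarrow> P E L"
    and "\<And>E x y r L. E \<noteq> [] \<Longrightarrow> find_leaf E E = None \<Longrightarrow> deg x E = 0 \<Longrightarrow> P E L \<Longrightarrow> P E ((x, y, r) # L)"
    and "\<And>E x y r L. E \<noteq> [] \<Longrightarrow> find_leaf E E = None \<Longrightarrow> deg x E \<noteq> 0 \<Longrightarrow>
      P (delete_node x E) L \<Longrightarrow> P E L \<Longrightarrow> P E ((x, y, r) # L)"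
    and "\<And>E. E \<noteq> [] \<Longrightarrow> find_leaf E E = None \<Longrightarrow>
      (\<And>u v r. (u, v, r) \<in> set E \<Longrightarrow> P (delete_node v (delete_node u E)) []) \<Longrightarrow>
      (\<And>u v r. (u, v, r) \<in> set E \<Longrightarrow> P (delete_edge u v E) []) \<Longrightarrow> P E []"
  shows "P E L"
proof (induction "2 * length E + length L" arbitrary: E L rule: less_induct)
  case less
  show ?case
  proof (cases "E = []")
    case False
    show ?thesis
    proof (cases "find_leaf E E")
      case None
      show ?thesis
      proof (cases L)
        case Nil
        show ?thesis unfolding Nil
          using length_delete_endpoints_less[of _ _ _ E] length_delete_edge_less[of _ _ _ E]
          by (intro assms(5)[OF False None] less) (auto simp: Nil)
      next
        case (Cons c L')
        obtain x y r where c: "c = (x, y, r)" by (cases c)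
        have "P E L'" "P (delete_node x E) L'"
          using length_delete_node_le[of x E] by (intro less; simp add: Cons)+
        then show ?thesis using assms(3,4) False None unfolding Cons c by blast
      qed
    next
      case (Some e)
      obtain u v r where e: "e = (u, v, r)" by (cases e)
      show ?thesis using search_measure[of E u v r L] Some unfolding e
        by (intro assms(2)[OF False] less) auto
    qed
  qed (simp add: assms(1))
qed

section \<open>Correctness of the algorithm\<close>

definition frac_val :: "nat \<times> nat \<Rightarrow> real" where
  "frac_val x = real (fst x) / real (snd x)"

definition proper :: "nat \<times> nat \<Rightarrow> bool" where
  "proper x \<longleftrightarrow> 0 < snd x \<and> fst x \<le> snd x"

lemma frac_val_fmul: "frac_val (fmul x y) = frac_val x * frac_val y"
  by (simp add: frac_val_def fmul_def)

lemma frac_val_fadd: "0 < snd x \<Longrightarrow> 0 < snd y \<Longrightarrow> frac_val (fadd x y) = frac_val x + frac_val y"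
  by (simp add: frac_val_def fadd_def field_simps)

lemma frac_val_fcompl: "proper x \<Longrightarrow> frac_val (fcompl x) = 1 - frac_val x"
  by (simp add: frac_val_def fcompl_def proper_def of_nat_diff field_simps)

lemma snd_frac: "snd (fmul x y) = snd x * snd y" "snd (fadd x y) = snd x * snd y" "snd (fcompl x) = snd x"
  by (simp_all add: fmul_def fadd_def fcompl_def)

lemma proper_fmul: "proper x \<Longrightarrow> proper y \<Longrightarrow> proper (fmul x y)"
  by (simp add: proper_def fmul_def mult_le_mono)

lemma proper_fcompl: "proper x \<Longrightarrow> proper (fcompl x)"
  by (simp add: proper_def fcompl_def)

definition describes_edges :: "(nat set \<Rightarrow> real) \<Rightarrow> entry list \<Rightarrow> bool" where
  "describes_edges p E \<longleftrightarrow> distinct (map ends E) \<and>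
     (\<forall>(u, v, r) \<in> set E. u \<noteq> v \<and> p {u, v} = frac_val r \<and> proper r)"

definition node_entries :: "entry list \<Rightarrow> bool" where
  "node_entries L \<longleftrightarrow> (\<forall>(x, y, r) \<in> set L. x = y \<and> proper r)"

definition avail_list :: "entry list \<Rightarrow> (nat \<times> real) list" where
  "avail_list L = map (\<lambda>(x, y, r). (x, frac_val r)) L"

lemma describes_edges_filter: "describes_edges p E \<Longrightarrow> describes_edges p (filter P E)"
  by (auto simp: describes_edges_def distinct_map_filter)

lemma describes_edges_delete:
  assumes "describes_edges p E"
  shows "describes_edges p (delete_node x E)" "describes_edges p (delete_edge x y E)"
  using describes_edges_filter[OF assms] by (simp_all add: delete_node_def delete_edge_def)

lemma node_entries_delete: "node_entries L \<Longrightarrow> node_entries (delete_node x L)"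
  by (auto simp: node_entries_def delete_node_def)

lemma edge_set_delete:
  "edge_set (delete_node x E) = {f \<in> edge_set E. x \<notin> f}"
  "edge_set (delete_edge x y E) = edge_set E - {{x, y}}"
  by (auto simp: edge_set_def delete_node_def delete_edge_def)

lemma finite_edge_set [simp]: "finite (edge_set E)"
  by (simp add: edge_set_def)

lemma describes_edges_prob: "describes_edges p E \<Longrightarrow> prob_on p (edge_set E)"
  by (fastforce simp: describes_edges_def prob_on_def edge_set_def frac_val_def proper_def)

lemma availability_correct:
  assumes "node_entries L"
  shows "proper (availability x L)" "frac_val (availability x L) = avail_prob (avail_list L) x"
  using assms
  by (induction L) (auto simp: node_entries_def avail_list_def frac_val_fmul proper_fmul,
      auto simp: proper_def frac_val_def)

lemma avail_list_delete:
  "node_entries L \<Longrightarrow> avail_list (delete_node x L) = filter (\<lambda>(y, r). y \<noteq> x) (avail_list L)"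
  by (induction L) (auto simp: avail_list_def delete_node_def node_entries_def)

lemma deg_eq_0_iff: "deg x E = 0 \<longleftrightarrow> x \<notin> \<Union>(edge_set E)"
  by (auto simp: deg_def edge_set_def filter_empty_conv)

lemma deg_eq_1:
  assumes "deg x E = 1" "e \<in> set E" "x \<in> ends e"
  shows "filter (\<lambda>e. x \<in> ends e) E = [e]"
proof -
  obtain f where "filter (\<lambda>e. x \<in> ends e) E = [f]"
    using assms(1) by (auto simp: deg_def length_Suc_conv)
  moreover have "e \<in> set (filter (\<lambda>e. x \<in> ends e) E)" using assms by simp
  ultimately show ?thesis by simp
qed

lemma deg_eq_1_unique:
  assumes "deg x E = 1" "e \<in> set E" "x \<in> ends e" "f \<in> set E" "x \<in> ends f"
  shows "f = e"
  using deg_eq_1[OF assms(1-3)] deg_eq_1[OF assms(1,4,5)] by simp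

lemma find_leaf_pendant:
  assumes "describes_edges p E" "find_leaf E E = Some (u, v, r)"
  shows "u \<noteq> v" "{u, v} \<in> edge_set E" "\<And>f. f \<in> edge_set E \<Longrightarrow> u \<in> f \<Longrightarrow> f = {u, v}"
    "p {u, v} = frac_val r" "proper r"
proof -
  obtain e where e: "e \<in> set E" "e = (u, v, r) \<or> e = (v, u, r)" and d: "deg u E = 1"
    using find_leaf_Some[OF assms(2)] by blast
  have ends: "ends e = {u, v}" using e(2) by auto
  show "u \<noteq> v" "p {u, v} = frac_val r" "proper r"
    using e assms(1) by (auto simp: describes_edges_def insert_commute)
  show "{u, v} \<in> edge_set E" using e(1) ends by (force simp: edge_set_def)
  show "f = {u, v}" if "f \<in> edge_set E" "u \<in> f" for f
    using that deg_eq_1_unique[OF d e(1)] ends by (auto simp: edge_set_def)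
qed

lemma best_correct:
  assumes "T \<noteq> []" "\<And>c. c \<in> set T \<Longrightarrow> 0 < snd (s c)"
  shows "\<exists>(u, v, r) \<in> set T. best s T = (s (u, v, r), (u, v)) \<and>
    (\<forall>c\<in>set T. frac_val (s c) \<le> frac_val (s (u, v, r)))"
  using assms
proof (induction T)
  case (Cons c T)
  obtain u v r where c: "c = (u, v, r)" by (cases c)
  have pos: "0 < snd (s c)" using Cons.prems by simp
  show ?case
  proof (cases "T = []")
    case True
    then show ?thesis by (auto simp: c)
  next
    case False
    then obtain u' v' r' where IH: "(u', v', r') \<in> set T" "best s T = (s (u', v', r'), (u', v'))"
      "\<And>c. c \<in> set T \<Longrightarrow> frac_val (s c) \<le> frac_val (s (u', v', r'))"
      using Cons by auto
    have pos': "0 < snd (s (u', v', r'))" using Cons.prems IH(1) by simp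
    have less: "fst (s c) * snd (s (u', v', r')) < fst (s (u', v', r')) * snd (s c)
        \<longleftrightarrow> frac_val (s c) < frac_val (s (u', v', r'))"
      using pos pos' by (simp add: frac_val_def divide_less_eq less_divide_eq flip: of_nat_mult)
    show ?thesis
    proof (cases "frac_val (s c) < frac_val (s (u', v', r'))")
      case True
      have "frac_val (s d) \<le> frac_val (s (u', v', r'))" if "d \<in> set (c # T)" for d
        using that IH(3)[of d] True by auto
      moreover have "best s (c # T) = best s T" using True less IH(2) by (simp add: c Let_def)
      ultimately show ?thesis using IH(1,2) by (intro bexI[of _ "(u', v', r')"]) auto
    next
      case F: False
      have "frac_val (s d) \<le> frac_val (s c)" if "d \<in> set (c # T)" for d
        using that IH(3)[of d] F by auto
      moreover have "best s (c # T) = (s c, (u, v))" using F less IH(2) by (simp add: c Let_def)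
      ultimately show ?thesis by (intro bexI[of _ c]) (auto simp: c)
    qed
  qed
qed simp

definition query_value :: "('a set \<Rightarrow> real) \<Rightarrow> 'a set set \<Rightarrow> 'a set \<Rightarrow> real" where
  "query_value p E e = p e * (1 + opt p {f \<in> E - {e}. f \<inter> e = {}}) + (1 - p e) * opt p (E - {e})"

lemma score_correct:
  assumes E: "describes_edges p E" and c: "(u, v, r) \<in> set E"
    and "\<And>F. F \<in> {delete_node v (delete_node u E), delete_edge u v E} \<Longrightarrow>
      0 < snd (val F) \<and> frac_val (val F) = opt p (edge_set F)"
  shows "0 < snd (score val E (u, v, r))" "frac_val (score val E (u, v, r)) = query_value p (edge_set E) {u, v}"
proof -
  let ?F = "delete_node v (delete_node u E)" and ?H = "delete_edge u v E"
  have r: "proper r" "0 < snd r" "p {u, v} = frac_val r"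
    using E c by (auto simp: describes_edges_def proper_def)
  have F: "0 < snd (val ?F)" "frac_val (val ?F) = opt p (edge_set ?F)"
    and H: "0 < snd (val ?H)" "frac_val (val ?H) = opt p (edge_set ?H)"
    using assms(3) by blast+
  have "edge_set ?F = {f \<in> edge_set E - {{u, v}}. f \<inter> {u, v} = {}}"
    by (auto simp: edge_set_delete)
  note F = F(1) F(2)[unfolded this] and H = H(1) H(2)[unfolded edge_set_delete]
  have sc: "score val E (u, v, r) = fadd (fmul r (fadd (1, 1) (val ?F))) (fmul (fcompl r) (val ?H))"
    by (simp add: score_def)
  have one: "frac_val (1, 1) = 1" by (simp add: frac_val_def)
  have pos: "0 < snd (fadd (1, 1) (val ?F))" using F(1) by (simp add: snd_frac)
  have pos': "0 < snd (fmul r (fadd (1, 1) (val ?F)))" "0 < snd (fmul (fcompl r) (val ?H))"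
    using F(1) H(1) r(2) by (simp_all add: snd_frac)
  show "0 < snd (score val E (u, v, r))" using pos' by (simp add: sc snd_frac(2))
  have "frac_val (score val E (u, v, r)) = frac_val r * (1 + frac_val (val ?F)) + (1 - frac_val r) * frac_val (val ?H)"
    unfolding sc using pos' F(1) r(1) by (simp only: frac_val_fadd frac_val_fmul frac_val_fcompl one snd_conv less_one zero_less_one)
  then show "frac_val (score val E (u, v, r)) = query_value p (edge_set E) {u, v}"
    unfolding F(2) H(2) query_value_def r(3) .
qed

lemma best_query_value:
  assumes E: "describes_edges p E" "E \<noteq> []"
    and "\<And>u v r. (u, v, r) \<in> set E \<Longrightarrow>
      0 < snd (s (u, v, r)) \<and> frac_val (s (u, v, r)) = query_value p (edge_set E) {u, v}"
  obtains u v r where "(u, v, r) \<in> set E" "best s E = (s (u, v, r), (u, v))"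
    "query_value p (edge_set E) {u, v} = opt p (edge_set E)"
proof -
  have "0 < snd (s c)" if "c \<in> set E" for c using assms(3) that by (cases c) auto
  then obtain u v r where b: "(u, v, r) \<in> set E" "best s E = (s (u, v, r), (u, v))"
    "\<And>c. c \<in> set E \<Longrightarrow> frac_val (s c) \<le> frac_val (s (u, v, r))"
    using best_correct[OF E(2), of s] by auto
  have uv: "{u, v} \<in> edge_set E" using b(1) by (force simp: edge_set_def)
  have "query_value p (edge_set E) {u, v} \<le> opt p (edge_set E)"
    unfolding query_value_def using uv by (intro opt_ge) auto
  moreover have "opt p (edge_set E) \<le> query_value p (edge_set E) {u, v}"
  proof -
    obtain e where e: "e \<in> edge_set E" "opt p (edge_set E) = query_value p (edge_set E) e"
      using opt_attained[of "edge_set E" p] uv finite_edge_set unfolding query_value_def by blast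
    then obtain u' v' r' where "(u', v', r') \<in> set E" "e = {u', v'}" by (force simp: edge_set_def)
    then show ?thesis using e b(3)[of "(u', v', r')"] assms(3) b(1) by simp
  qed
  ultimately show ?thesis using that b by simp
qed

lemma search_value_correct:
  assumes "describes_edges p E" "node_entries L"
  shows "0 < snd (search_value E L) \<and> frac_val (search_value E L) = avail_opt p (avail_list L) (edge_set E)"
  using assms
proof (induction E L rule: search_induct)
  case (empty L)
  have "avail_opt p M {} = 0" for M :: "(nat \<times> real) list"
    by (induction M) auto
  then show ?case by (simp add: search_value_simps(1) frac_val_def edge_set_def)
next
  case (leaf E L u v r)
  note pend = find_leaf_pendant[OF leaf(4,2)]
  let ?q = "fmul r (availability u L)"
  have q: "proper ?q" "frac_val ?q = p {u, v} * avail_prob (avail_list L) u"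
    using availability_correct[OF leaf(5), of u] pend(4,5) by (simp_all add: proper_fmul frac_val_fmul)
  let ?M = "(v, v, fcompl ?q) # delete_node u L"
  have M: "node_entries ?M"
    using node_entries_delete[OF leaf(5)] proper_fcompl[OF q(1)] by (auto simp: node_entries_def)
  have es: "edge_set (delete_node u E) = edge_set E - {{u, v}}"
    unfolding edge_set_delete using pend(2,3) by blast
  have IH: "0 < snd (search_value (delete_node u E) ?M)"
    "frac_val (search_value (delete_node u E) ?M) = avail_opt p (avail_list ?M) (edge_set E - {{u, v}})"
    using leaf(3)[OF describes_edges_delete(1)[OF leaf(4)] M] by (simp_all add: es)
  have "u \<notin> \<Union>(edge_set E - {{u, v}})" using pend(3) by blast
  then have "avail_opt p (filter (\<lambda>(y, r). y \<noteq> u) ((v, 1 - frac_val ?q) # avail_list L)) (edge_set E - {{u, v}})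
      = avail_opt p ((v, 1 - frac_val ?q) # avail_list L) (edge_set E - {{u, v}})"
    by (rule avail_opt_filter_absent)
  moreover have "avail_list ?M = filter (\<lambda>(y, r). y \<noteq> u) ((v, 1 - frac_val ?q) # avail_list L)"
    using pend(1) avail_list_delete[OF leaf(5), of u] q(1) by (simp add: avail_list_def frac_val_fcompl)
  ultimately have "avail_opt p (avail_list L) (edge_set E) = avail_prob (avail_list L) v * frac_val ?q
      + frac_val (search_value (delete_node u E) ?M)"
    using avail_opt_pendant[OF finite_edge_set describes_edges_prob[OF leaf(4)] pend(1-3)] IH(2) q(2)
    by simp
  moreover have "proper (availability v L)" "frac_val (availability v L) = avail_prob (avail_list L) v"
    using availability_correct[OF leaf(5)] by auto
  ultimately show ?case using IH(1) q(1)
    by (simp add: search_value_simps(2)[OF leaf(1,2)] snd_frac frac_val_fadd frac_val_fmul proper_def)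
next
  case (skip E x y r L)
  have "node_entries L" using skip by (simp add: node_entries_def)
  moreover have "avail_opt p (avail_list ((x, y, r) # L)) (edge_set E) = avail_opt p (avail_list L) (edge_set E)"
    using avail_opt_absent[of x "edge_set E"] skip(3) by (simp add: avail_list_def deg_eq_0_iff)
  ultimately show ?case using skip by (simp add: search_value_simps(4)[OF skip(1-3)])
next
  case (branch E x y r L)
  have L: "node_entries L" "proper r" using branch by (auto simp: node_entries_def)
  have "avail_opt p (avail_list ((x, y, r) # L)) (edge_set E) =
      (1 - frac_val r) * avail_opt p (avail_list L) (edge_set (delete_node x E))
      + frac_val r * avail_opt p (avail_list L) (edge_set E)"
    by (simp add: avail_list_def edge_set_delete)
  then show ?case
    using branch(4)[OF describes_edges_delete(1)[OF branch(6)] L(1)] branch(5)[OF branch(6) L(1)] L(2)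
    by (simp add: search_value_simps(5)[OF branch(1-3)] snd_frac frac_val_fadd frac_val_fmul frac_val_fcompl proper_def)
next
  case (choose E)
  have IH: "0 < snd (score (\<lambda>F. search_value F []) E (u, v, r)) \<and>
      frac_val (score (\<lambda>F. search_value F []) E (u, v, r)) = query_value p (edge_set E) {u, v}" if "(u, v, r) \<in> set E" for u v r
  proof -
    have "0 < snd (search_value F []) \<and> frac_val (search_value F []) = opt p (edge_set F)"
      if "F \<in> {delete_node v (delete_node u E), delete_edge u v E}" for F
      using that choose(3,4)[OF \<open>(u, v, r) \<in> set E\<close>] choose(6) describes_edges_delete[OF choose(5)]
        describes_edges_delete(1)[OF describes_edges_delete(1)[OF choose(5)]]
      by (auto simp: avail_list_def)
    then show ?thesis using score_correct[OF choose(5) that, of "\<lambda>F. search_value F []"] by blast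
  qed
  obtain u v r where "(u, v, r) \<in> set E"
    "best (score (\<lambda>F. search_value F []) E) E = (score (\<lambda>F. search_value F []) E (u, v, r), (u, v))"
    "query_value p (edge_set E) {u, v} = opt p (edge_set E)"
    by (rule best_query_value[OF choose(5,1) IH])
  then show ?case using IH by (simp add: search_value_simps(3)[OF choose(1,2)] avail_list_def)
qed

section \<open>The number of recursive calls\<close>

lemma find_leaf_None:
  "find_leaf T E = None \<Longrightarrow> (u, v, r) \<in> set T \<Longrightarrow> 2 \<le> deg u E \<and> 2 \<le> deg v E"
  by (induction T E rule: find_leaf.induct) (auto split: if_splits)

lemma min_degree_two_edge_set:
  assumes "describes_edges p E" "find_leaf E E = None"
  shows "min_degree_two (edge_set E)"
  unfolding min_degree_two_def
proof
  fix x assume "x \<in> \<Union>(edge_set E)"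
  then obtain u v r where "(u, v, r) \<in> set E" "x \<in> {u, v}" by (auto simp: edge_set_def)
  then have "2 \<le> deg x E" using find_leaf_None[OF assms(2)] by blast
  then obtain a b M where M: "filter (\<lambda>e. x \<in> ends e) E = a # b # M"
    unfolding deg_def by (metis Suc_le_length_iff numeral_2_eq_2)
  have "distinct (map ends (a # b # M))"
    using describes_edges_filter[OF assms(1), of "\<lambda>e. x \<in> ends e"] M by (simp add: describes_edges_def)
  moreover have "{a, b} \<subseteq> set (filter (\<lambda>e. x \<in> ends e) E)" using M by simp
  ultimately show "\<exists>e\<in>edge_set E. \<exists>f\<in>edge_set E. e \<noteq> f \<and> x \<in> e \<and> x \<in> f"
    unfolding edge_set_def by (intro bexI[of _ "ends a"] bexI[of _ "ends b"]) auto
qed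

definition potential_le :: "'a set set \<Rightarrow> 'a set set \<Rightarrow> nat \<Rightarrow> bool" where
  "potential_le X E k \<longleftrightarrow>
     (\<forall>C\<subseteq>E. min_degree_two C \<longrightarrow> C \<noteq> {} \<longrightarrow> C \<inter> X \<noteq> {}) \<and>
     (\<forall>F\<subseteq>E. card F + card (F \<inter> X) \<le> card (\<Union>F) + k)"

lemma potential_le_subset: "potential_le X E k \<Longrightarrow> F \<subseteq> E \<Longrightarrow> potential_le X F k"
  unfolding potential_le_def by (meson subset_trans)

lemma potential_le_psubset:
  assumes "describes_edges p E" "find_leaf E E = None" "potential_le X (edge_set E) k" "F \<subset> edge_set E"
  obtains k' where "k = Suc k'" "potential_le X F k'"
proof -
  let ?K = "edge_set E"
  have less: "card F' + card (F' \<inter> X) < card (\<Union>F') + k" if "F' \<subseteq> F" for F'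
  proof -
    have "card F' + card (F' \<inter> X) + card (\<Union>?K) < card ?K + card (?K \<inter> X) + card (\<Union>F')"
    proof (rule min_degree_two_potential)
      show "min_degree_two ?K" by (rule min_degree_two_edge_set[OF assms(1,2)])
      show "card e = 2" if "e \<in> ?K" for e
        using that assms(1) by (auto simp: edge_set_def describes_edges_def)
      show "F' \<subset> ?K" using that assms(4) by blast
      show "C \<inter> X \<noteq> {}" if "C \<subseteq> ?K" "min_degree_two C" "C \<noteq> {}" for C
        using assms(3) that unfolding potential_le_def by blast
    qed simp
    moreover have "card ?K + card (?K \<inter> X) \<le> card (\<Union>?K) + k"
      using assms(3) unfolding potential_le_def by blast
    ultimately show ?thesis by linarith
  qed
  then obtain k' where k': "k = Suc k'" using less[of "{}"] by (cases k) auto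
  moreover have "potential_le X F k'"
    unfolding potential_le_def
  proof (intro conjI allI impI)
    show "C \<inter> X \<noteq> {}" if "C \<subseteq> F" "min_degree_two C" "C \<noteq> {}" for C
      using potential_le_subset[OF assms(3), of F] assms(4) that unfolding potential_le_def by blast
    show "card F' + card (F' \<inter> X) \<le> card (\<Union>F') + k'" if "F' \<subseteq> F" for F'
      using less[OF that] k' by simp
  qed
  ultimately show ?thesis by (rule that)
qed

lemma calls_le:
  assumes "describes_edges p E" "potential_le X (edge_set E) k" "2 * length E + length L + 2 \<le> N"
  shows "calls E L \<le> N ^ k * (2 * length E + length L + 1)"
  using assms
proof (induction E L arbitrary: k rule: search_induct)
  case (empty L)
  then have "0 < N" by simp
  then show ?case by (simp add: calls_simps(1) Suc_le_eq)
next
  case (leaf E L u v r)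
  let ?s = "fcompl (fmul r (availability u L))"
  have m: "2 * length (delete_node u E) + length ((v, v, ?s) # delete_node u L) + 1 \<le> 2 * length E + length L"
    using search_measure[OF leaf(2), of L] by simp
  have "calls (delete_node u E) ((v, v, ?s) # delete_node u L)
      \<le> N ^ k * (2 * length (delete_node u E) + length ((v, v, ?s) # delete_node u L) + 1)"
    using m leaf(6) by (intro leaf(3) describes_edges_delete leaf(4) potential_le_subset[OF leaf(5)])
      (auto simp: edge_set_delete)
  also have "\<dots> \<le> N ^ k * (2 * length E + length L)" using m by (intro mult_le_mono2) simp
  finally have "calls E L \<le> 1 + N ^ k * (2 * length E + length L)"
    unfolding calls_simps(2)[OF leaf(1,2)] by simp
  moreover have "1 \<le> N ^ k" using leaf(6) by simp
  ultimately show ?case by (simp add: algebra_simps)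
next
  case (skip E x y r L)
  have "calls E L \<le> N ^ k * (2 * length E + length L + 1)" using skip by (intro skip(4)) auto
  moreover have "1 \<le> N ^ k" using skip(7) by simp
  ultimately show ?case unfolding calls_simps(4)[OF skip(1-3)] by (simp add: algebra_simps)
next
  case (branch E x y r L)
  have "edge_set (delete_node x E) \<subset> edge_set E"
    using branch(3) by (auto simp: edge_set_delete deg_eq_0_iff)
  then obtain k' where k': "k = Suc k'" "potential_le X (edge_set (delete_node x E)) k'"
    using potential_le_psubset[OF branch(6,2,7)] by blast
  let ?m = "2 * length E + length L + 1"
  have "calls (delete_node x E) L \<le> N ^ k' * (2 * length (delete_node x E) + length L + 1)"
    using branch(8) length_delete_node_le[of x E]
    by (intro branch(4) describes_edges_delete branch(6) k') auto
  also have "\<dots> \<le> N ^ k' * ?m" using length_delete_node_le[of x E] by (intro mult_le_mono2) simp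
  finally have 1: "calls (delete_node x E) L \<le> N ^ k' * ?m" .
  have 2: "calls E L \<le> N ^ k * ?m" using branch by (intro branch(5)) auto
  have "1 \<le> N ^ k'" using branch(8) by simp
  then have "1 + N ^ k' * ?m \<le> N ^ k' * (?m + 1)" by (simp add: algebra_simps)
  also have "\<dots> \<le> N ^ k' * N" using branch(8) by (intro mult_le_mono2) simp
  finally have "1 + N ^ k' * ?m \<le> N ^ k" by (simp add: k'(1) mult.commute)
  with 1 2 have "calls E ((x, y, r) # L) \<le> N ^ k + N ^ k * ?m"
    unfolding calls_simps(5)[OF branch(1-3)] by linarith
  then show ?case by (simp add: algebra_simps)
next
  case (choose E)
  have sub: "edge_set (delete_node v (delete_node u E)) \<subset> edge_set E" "edge_set (delete_edge u v E) \<subset> edge_set E"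
    if "(u, v, r) \<in> set E" for u v r
  proof -
    have "{u, v} \<in> edge_set E" using that by (force simp: edge_set_def)
    moreover have "{u, v} \<notin> edge_set (delete_node v (delete_node u E))" "{u, v} \<notin> edge_set (delete_edge u v E)"
      by (simp_all add: edge_set_delete)
    moreover have "edge_set (delete_node v (delete_node u E)) \<subseteq> edge_set E" "edge_set (delete_edge u v E) \<subseteq> edge_set E"
      by (auto simp: edge_set_delete)
    ultimately show "edge_set (delete_node v (delete_node u E)) \<subset> edge_set E" "edge_set (delete_edge u v E) \<subset> edge_set E"
      by (metis psubsetI)+
  qed
  obtain c where "c \<in> set E" using choose(1) by (cases E) auto
  moreover obtain u v r where "c = (u, v, r)" by (cases c)
  ultimately have "edge_set (delete_edge u v E) \<subset> edge_set E" using sub(2) by simp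
  then obtain k' where k: "k = Suc k'" by (rule potential_le_psubset[OF choose(5,2,6)])
  let ?n = "length E"
  have *: "calls F [] \<le> N ^ k' * (2 * ?n)"
    if "c = (u, v, r)" "c \<in> set E" "F = delete_node v (delete_node u E) \<or> F = delete_edge u v E" for c u v r F
  proof -
    have c: "(u, v, r) \<in> set E" using that by simp
    have len: "length F < ?n"
      using that(3) length_delete_endpoints_less[OF c] length_delete_edge_less[OF c] by auto
    have "edge_set F \<subset> edge_set E" using sub[OF c] that(3) by presburger
    then have "potential_le X (edge_set F) k'" by (rule potential_le_psubset[OF choose(5,2,6)]) (simp add: k)
    moreover have "describes_edges p F" using that(3) choose(5) by (auto intro!: describes_edges_delete)
    ultimately have "calls F [] \<le> N ^ k' * (2 * length F + length ([] :: entry list) + 1)"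
      using that(3) len choose(7) choose(3,4)[OF c] by auto
    also have "\<dots> \<le> N ^ k' * (2 * ?n)" using len by (intro mult_le_mono2) simp
    finally show ?thesis .
  qed
  have "(\<Sum>(u, v, r)\<leftarrow>E. 1 + calls (delete_node v (delete_node u E)) [] + calls (delete_edge u v E) [])
      \<le> (\<Sum>c\<leftarrow>E. 1 + 2 * (N ^ k' * (2 * ?n)))"
    by (rule sum_list_mono) (auto intro!: add_mono dest: *[OF refl] simp: mult_2)
  also have "\<dots> = ?n * (1 + 2 * (N ^ k' * (2 * ?n)))" by (simp add: sum_list_triv)
  finally have "calls E [] \<le> 1 + ?n + 4 * ?n * ?n * N ^ k'"
    unfolding calls_simps(3)[OF choose(1,2)] by (simp add: algebra_simps)
  also have "\<dots> \<le> (1 + ?n) * N ^ k' + 4 * ?n * ?n * N ^ k'"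
    using mult_le_mono2[of 1 "N ^ k'" "1 + ?n"] choose(7) by simp
  also have "\<dots> \<le> (2 * ?n + 2) * (2 * ?n + 1) * N ^ k'"
    unfolding add_mult_distrib[symmetric] by (intro mult_le_mono1) (simp add: algebra_simps)
  also have "\<dots> \<le> N * (2 * ?n + 1) * N ^ k'" using choose(7) by (intro mult_le_mono) auto
  finally show ?case by (simp add: k algebra_simps)
qed

section \<open>Evaluation as a partial function\<close>

lemma eval_iff:
  "eval P env (Var i) v t \<longleftrightarrow> i < length env \<and> v = env ! i \<and> t = 1"
  "eval P env (Lit k) v t \<longleftrightarrow> v = Num k \<and> t = 1"
  "eval P env (Arith f x y) v t \<longleftrightarrow>
     (\<exists>m n t1 t2. eval P env x (Num m) t1 \<and> eval P env y (Num n) t2 \<and> v = Num (arith f m n) \<and>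
        t = t1 + t2 + floorlog 2 m + floorlog 2 n + 1)"
  "eval P env (Cons_cell x y) v t \<longleftrightarrow>
     (\<exists>a b t1 t2. eval P env x a t1 \<and> eval P env y b t2 \<and> v = Cell a b \<and> t = t1 + t2 + 1)"
  "eval P env (Left x) v t \<longleftrightarrow> (\<exists>w t1. eval P env x (Cell v w) t1 \<and> t = t1 + 1)"
  "eval P env (Right x) v t \<longleftrightarrow> (\<exists>w t1. eval P env x (Cell w v) t1 \<and> t = t1 + 1)"
  "eval P env (If_nonzero x y z) v t \<longleftrightarrow>
     (\<exists>u t1 t2. eval P env x u t1 \<and> eval P env (if u = Num 0 then z else y) v t2 \<and> t = t1 + t2 + 1)"
  "eval P env (Let_in x y) v t \<longleftrightarrow>
     (\<exists>u t1 t2. eval P env x u t1 \<and> eval P (u # env) y v t2 \<and> t = t1 + t2 + 1)"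
  "eval P env (Call g xs) v t \<longleftrightarrow>
     (\<exists>vs t1 t2. evals P env xs vs t1 \<and> g < length P \<and> eval P vs (P ! g) v t2 \<and> t = t1 + t2 + 1)"
  "evals P env [] vs t \<longleftrightarrow> vs = [] \<and> t = 0"
  "evals P env (x # xs) vs t \<longleftrightarrow>
     (\<exists>v ws t1 t2. eval P env x v t1 \<and> evals P env xs ws t2 \<and> vs = v # ws \<and> t = t1 + t2)"
proof goal_cases
  case 1 show ?case by (subst eval.simps) auto
next
  case 2 show ?case by (subst eval.simps) auto
next
  case 3 show ?case by (subst eval.simps) auto
next
  case 4 show ?case by (subst eval.simps) auto
next
  case 5 show ?case by (subst eval.simps) auto
next
  case 6 show ?case by (subst eval.simps) auto
next
  case 7 show ?case by (subst eval.simps) auto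
next
  case 8 show ?case by (subst eval.simps) auto
next
  case 9 show ?case by (subst eval.simps) auto
next
  case 10 show ?case by (subst evals.simps) auto
next
  case 11 show ?case by (subst evals.simps) auto
qed

lemma eval_deterministic:
  "eval P env x v t \<Longrightarrow> eval P env x v' t' \<Longrightarrow> v' = v \<and> t' = t"
  "evals P env xs vs t \<Longrightarrow> evals P env xs vs' t' \<Longrightarrow> vs' = vs \<and> t' = t"
proof (induction arbitrary: v' t' and vs' t' rule: eval_evals.inducts)
  case Var
  show ?case using Var(2) by (auto simp: eval_iff)
next
  case Lit
  show ?case using Lit(1) by (auto simp: eval_iff)
next
  case Arith
  show ?case using Arith(5) by (auto simp: eval_iff dest!: Arith(2,4))
next
  case Cons_cell
  show ?case using Cons_cell(5) by (auto simp: eval_iff dest!: Cons_cell(2,4))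
next
  case Left
  show ?case using Left(3) by (auto simp: eval_iff dest!: Left(2))
next
  case Right
  show ?case using Right(3) by (auto simp: eval_iff dest!: Right(2))
next
  case If_then
  show ?case using If_then(6) by (auto simp: eval_iff If_then(5) dest!: If_then(2,4))
next
  case If_else
  show ?case using If_else(5) by (auto simp: eval_iff dest!: If_else(2,4))
next
  case Let_in
  show ?case using Let_in(5) by (auto simp: eval_iff dest!: Let_in(2,4))
next
  case Call
  show ?case using Call(6) by (auto simp: eval_iff dest!: Call(2,5))
next
  case Nil
  show ?case using Nil(1) by (auto simp: eval_iff)
next
  case Cons
  show ?case using Cons(5) by (auto simp: eval_iff dest!: Cons(2,4))
qed

text \<open>With \<open>den\<close>, function bodies can be executed symbolically by rewriting.\<close>

definition den :: "program \<Rightarrow> val list \<Rightarrow> expr \<Rightarrow> (val \<times> nat) option" where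
  "den P env x = (if \<exists>v t. eval P env x v t then Some (THE r. eval P env x (fst r) (snd r)) else None)"

definition dens :: "program \<Rightarrow> val list \<Rightarrow> expr list \<Rightarrow> (val list \<times> nat) option" where
  "dens P env x = (if \<exists>v t. evals P env x v t then Some (THE r. evals P env x (fst r) (snd r)) else None)"

lemma den_eq_Some: "den P env x = Some (v, t) \<longleftrightarrow> eval P env x v t"
proof -
  have "(THE r. eval P env x (fst r) (snd r)) = (v, t)" if "eval P env x v t" for v t
  proof (rule the_equality)
    fix r assume "eval P env x (fst r) (snd r)"
    from eval_deterministic(1)[OF that this] show "r = (v, t)" by (simp add: prod_eq_iff)
  qed (simp add: that)
  then show ?thesis by (auto simp: den_def)
qed

lemma dens_eq_Some: "dens P env x = Some (v, t) \<longleftrightarrow> evals P env x v t"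
proof -
  have "(THE r. evals P env x (fst r) (snd r)) = (v, t)" if "evals P env x v t" for v t
  proof (rule the_equality)
    fix r assume "evals P env x (fst r) (snd r)"
    from eval_deterministic(2)[OF that this] show "r = (v, t)" by (simp add: prod_eq_iff)
  qed (simp add: that)
  then show ?thesis by (auto simp: dens_def)
qed

lemma option_pair_eqI:
  assumes "\<And>v t. a = Some (v, t) \<longleftrightarrow> b = Some (v, t)"
  shows "a = b"
proof (cases b)
  case None
  show ?thesis
  proof (cases a)
    case (Some r)
    then show ?thesis using assms[of "fst r" "snd r"] by simp
  qed (simp add: None)
next
  case (Some r)
  then show ?thesis using assms[of "fst r" "snd r"] by simp
qed

definition call :: "program \<Rightarrow> nat \<Rightarrow> val list \<Rightarrow> (val \<times> nat) option" where
  "call P f vs = (if f < length P then den P vs (P ! f) else None)"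

lemma den_Var:
  "den P env (Var i) = (if i < length env then Some (env ! i, 1) else None)"
  by (rule option_pair_eqI) (auto simp: den_eq_Some dens_eq_Some eval_iff)

lemma den_Lit:
  "den P env (Lit n) = Some (Num n, 1)"
  by (rule option_pair_eqI) (auto simp: den_eq_Some dens_eq_Some eval_iff)

lemma den_Arith:
  "den P env (Arith f x y) =
     (case den P env x of Some (Num m, t1) \<Rightarrow>
        (case den P env y of Some (Num n, t2) \<Rightarrow>
           Some (Num (arith f m n), t1 + t2 + floorlog 2 m + floorlog 2 n + 1) | _ \<Rightarrow> None) | _ \<Rightarrow> None)"
  by (rule option_pair_eqI, subst den_eq_Some, subst eval_iff, simp only: den_eq_Some[symmetric] dens_eq_Some[symmetric] call_def)
    (cases "den P env x"; cases "den P env y"; auto split: val.splits)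

lemma den_Cons_cell:
  "den P env (Cons_cell x y) =
     (case den P env x of Some (v, t1) \<Rightarrow>
        (case den P env y of Some (w, t2) \<Rightarrow> Some (Cell v w, t1 + t2 + 1) | _ \<Rightarrow> None) | _ \<Rightarrow> None)"
  by (rule option_pair_eqI, subst den_eq_Some, subst eval_iff, simp only: den_eq_Some[symmetric] dens_eq_Some[symmetric] call_def)
    (cases "den P env x"; cases "den P env y"; auto)

lemma den_Left:
  "den P env (Left x) = (case den P env x of Some (Cell v w, t) \<Rightarrow> Some (v, t + 1) | _ \<Rightarrow> None)"
  by (rule option_pair_eqI, subst den_eq_Some, subst eval_iff, simp only: den_eq_Some[symmetric] dens_eq_Some[symmetric] call_def)
    (cases "den P env x"; auto split: val.splits)

lemma den_Right:
  "den P env (Right x) = (case den P env x of Some (Cell v w, t) \<Rightarrow> Some (w, t + 1) | _ \<Rightarrow> None)"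
  by (rule option_pair_eqI, subst den_eq_Some, subst eval_iff, simp only: den_eq_Some[symmetric] dens_eq_Some[symmetric] call_def)
    (cases "den P env x"; auto split: val.splits)

lemma den_If:
  "den P env (If_nonzero x y z) =
     (case den P env x of Some (u, t1) \<Rightarrow>
        (case den P env (if u = Num 0 then z else y) of Some (v, t2) \<Rightarrow> Some (v, t1 + t2 + 1) | None \<Rightarrow> None)
      | None \<Rightarrow> None)"
proof (rule option_pair_eqI)
  fix v t
  show "den P env (If_nonzero x y z) = Some (v, t) \<longleftrightarrow>
     (case den P env x of Some (u, t1) \<Rightarrow>
        (case den P env (if u = Num 0 then z else y) of Some (v, t2) \<Rightarrow> Some (v, t1 + t2 + 1) | None \<Rightarrow> None)
      | None \<Rightarrow> None) = Some (v, t)"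
    unfolding den_eq_Some eval_iff unfolding den_eq_Some[symmetric]
    by (cases "den P env x") (auto split: option.splits split del: if_split)
qed

lemma den_Let:
  "den P env (Let_in x y) =
     (case den P env x of Some (u, t1) \<Rightarrow>
        (case den P (u # env) y of Some (v, t2) \<Rightarrow> Some (v, t1 + t2 + 1) | None \<Rightarrow> None)
      | None \<Rightarrow> None)"
  by (rule option_pair_eqI, subst den_eq_Some, subst eval_iff, simp only: den_eq_Some[symmetric] dens_eq_Some[symmetric] call_def)
    (cases "den P env x"; auto split: option.splits)

lemma den_Call:
  "den P env (Call g xs) =
     (case dens P env xs of Some (vs, t1) \<Rightarrow>
        (case call P g vs of Some (v, t2) \<Rightarrow> Some (v, t1 + t2 + 1) | None \<Rightarrow> None)
      | None \<Rightarrow> None)"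
  by (rule option_pair_eqI, subst den_eq_Some, subst eval_iff, simp only: den_eq_Some[symmetric] dens_eq_Some[symmetric] call_def)
    (cases "dens P env xs"; auto split: option.splits if_splits)

lemma den_Nil:
  "dens P env [] = Some ([], 0)"
  by (rule option_pair_eqI) (auto simp: den_eq_Some dens_eq_Some eval_iff)

lemma den_Cons:
  "dens P env (x # xs) =
     (case den P env x of Some (v, t1) \<Rightarrow>
        (case dens P env xs of Some (vs, t2) \<Rightarrow> Some (v # vs, t1 + t2) | None \<Rightarrow> None)
      | None \<Rightarrow> None)"
  by (rule option_pair_eqI, subst dens_eq_Some, subst eval_iff, simp only: den_eq_Some[symmetric] dens_eq_Some[symmetric] call_def)
    (cases "den P env x"; cases "dens P env xs"; auto)

lemmas den_simps = den_Var den_Lit den_Arith den_Cons_cell den_Left den_Right den_If den_Let den_Call den_Nil den_Cons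

section \<open>The program\<close>

text \<open>
  The functions are numbered as in \<open>prog\<close> below: 0 main, 1 residual graph, 2 \<open>delete_node\<close>,
  3 \<open>delete_edge\<close>, 4 \<open>deg\<close>, 5 \<open>find_leaf\<close>, 6 \<open>availability\<close>, 7 \<open>search_value\<close>, 8 \<open>best\<close>, 9 \<open>score\<close>,
  10 \<open>fmul\<close>, 11 \<open>fadd\<close>, 12 \<open>fcompl\<close>.
\<close>

definition ne :: "expr \<Rightarrow> expr \<Rightarrow> expr" where
  "ne x y = Arith Plus (Arith Minus x y) (Arith Minus y x)"

definition main_body :: expr where
  "main_body = Let_in (Call 1 [Var 0, Var 1]) (Let_in (Right (Call 8 [Var 0, Var 0]))
     (If_nonzero (Arith Minus (Left (Var 0)) (Right (Var 0)))
       (Cons_cell (Right (Var 0)) (Left (Var 0))) (Var 0)))"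

definition residual_body :: expr where
  "residual_body = If_nonzero (Var 1)
     (Call 1 [If_nonzero (Right (Left (Var 1)))
         (Call 2 [Right (Left (Left (Var 1))), Call 2 [Left (Left (Left (Var 1))), Var 0]])
         (Call 3 [Left (Left (Left (Var 1))), Right (Left (Left (Var 1))), Var 0]),
       Right (Var 1)])
     (Var 0)"

definition delete_node_body :: expr where
  "delete_node_body = If_nonzero (Var 1)
     (Let_in (Call 2 [Var 0, Right (Var 1)])
       (If_nonzero (ne (Left (Left (Left (Var 2)))) (Var 1))
         (If_nonzero (ne (Right (Left (Left (Var 2)))) (Var 1))
           (Cons_cell (Left (Var 2)) (Var 0)) (Var 0)) (Var 0)))
     (Lit 0)"

definition delete_edge_body :: expr where
  "delete_edge_body = If_nonzero (Var 2)
     (Let_in (Call 3 [Var 0, Var 1, Right (Var 2)])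
       (If_nonzero (Arith Plus (ne (Left (Left (Left (Var 3)))) (Var 1)) (ne (Right (Left (Left (Var 3)))) (Var 2)))
         (If_nonzero (Arith Plus (ne (Left (Left (Left (Var 3)))) (Var 2)) (ne (Right (Left (Left (Var 3)))) (Var 1)))
           (Cons_cell (Left (Var 3)) (Var 0)) (Var 0)) (Var 0)))
     (Lit 0)"

definition deg_body :: expr where
  "deg_body = If_nonzero (Var 1)
     (Let_in (Call 4 [Var 0, Right (Var 1)])
       (If_nonzero (ne (Left (Left (Left (Var 2)))) (Var 1))
         (If_nonzero (ne (Right (Left (Left (Var 2)))) (Var 1))
           (Var 0) (Arith Plus (Var 0) (Lit 1))) (Arith Plus (Var 0) (Lit 1))))
     (Lit 0)"

definition find_leaf_body :: expr where
  "find_leaf_body = If_nonzero (Var 0)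
     (If_nonzero (Arith Minus (Call 4 [Left (Left (Left (Var 0))), Var 1]) (Lit 1))
       (If_nonzero (Arith Minus (Call 4 [Right (Left (Left (Var 0))), Var 1]) (Lit 1))
         (Call 5 [Right (Var 0), Var 1])
         (Cons_cell (Cons_cell (Right (Left (Left (Var 0)))) (Left (Left (Left (Var 0)))))
           (Right (Left (Var 0)))))
       (Left (Var 0)))
     (Lit 0)"

definition availability_body :: expr where
  "availability_body = If_nonzero (Var 1)
     (Let_in (Call 6 [Var 0, Right (Var 1)])
       (If_nonzero (ne (Left (Left (Left (Var 2)))) (Var 1))
         (Var 0) (Call 10 [Right (Left (Var 2)), Var 0])))
     (Cons_cell (Lit 1) (Lit 1))"

definition search_value_body :: expr where
  "search_value_body = If_nonzero (Var 0)
     (Let_in (Call 5 [Var 0, Var 0])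
       (If_nonzero (Var 0)
         (Let_in (Call 10 [Right (Var 0), Call 6 [Left (Left (Var 0)), Var 2]])
           (Call 11 [Call 10 [Call 6 [Right (Left (Var 1)), Var 3], Var 0],
              Call 7 [Call 2 [Left (Left (Var 1)), Var 2],
                Cons_cell
                  (Cons_cell (Cons_cell (Right (Left (Var 1))) (Right (Left (Var 1)))) (Call 12 [Var 0]))
                  (Call 2 [Left (Left (Var 1)), Var 3])]]))
         (If_nonzero (Var 2)
           (Let_in (Call 7 [Var 1, Right (Var 2)])
             (If_nonzero (Call 4 [Left (Left (Left (Var 3))), Var 2])
               (Call 11 [Call 10 [Call 12 [Right (Left (Var 3))],
                    Call 7 [Call 2 [Left (Left (Left (Var 3))), Var 2], Right (Var 3)]],
                  Call 10 [Right (Left (Var 3)), Var 0]])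
               (Var 0)))
           (Left (Call 8 [Var 1, Var 1])))))
     (Cons_cell (Lit 0) (Lit 1))"

definition best_body :: expr where
  "best_body = If_nonzero (Var 0)
     (Let_in (Call 8 [Right (Var 0), Var 1])
       (Let_in (Call 9 [Left (Var 1), Var 2])
         (If_nonzero (Arith Minus (Arith Times (Left (Left (Var 1))) (Right (Var 0)))
             (Arith Times (Left (Var 0)) (Right (Left (Var 1)))))
           (Var 1) (Cons_cell (Var 0) (Left (Left (Var 2)))))))
     (Cons_cell (Cons_cell (Lit 0) (Lit 1)) (Cons_cell (Lit 0) (Lit 0)))"

definition score_body :: expr where
  "score_body = Call 11
     [Call 10 [Right (Var 0), Call 11 [Cons_cell (Lit 1) (Lit 1),
        Call 7 [Call 2 [Right (Left (Var 0)), Call 2 [Left (Left (Var 0)), Var 1]], Lit 0]]],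
      Call 10 [Call 12 [Right (Var 0)],
        Call 7 [Call 3 [Left (Left (Var 0)), Right (Left (Var 0)), Var 1], Lit 0]]]"

definition fmul_body :: expr where
  "fmul_body = Cons_cell (Arith Times (Left (Var 0)) (Left (Var 1)))
     (Arith Times (Right (Var 0)) (Right (Var 1)))"

definition fadd_body :: expr where
  "fadd_body = Cons_cell
     (Arith Plus (Arith Times (Left (Var 0)) (Right (Var 1))) (Arith Times (Left (Var 1)) (Right (Var 0))))
     (Arith Times (Right (Var 0)) (Right (Var 1)))"

definition fcompl_body :: expr where
  "fcompl_body = Cons_cell (Arith Minus (Right (Var 0)) (Left (Var 0))) (Right (Var 0))"

definition prog :: program where
  "prog = [main_body, residual_body, delete_node_body, delete_edge_body, deg_body, find_leaf_body,
     availability_body, search_value_body, best_body, score_body, fmul_body, fadd_body, fcompl_body]"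

lemma call_prog:
  "call prog 0 vs = den prog vs main_body"
  "call prog (Suc 0) vs = den prog vs residual_body"
  "call prog 2 vs = den prog vs delete_node_body"
  "call prog 3 vs = den prog vs delete_edge_body"
  "call prog 4 vs = den prog vs deg_body"
  "call prog 5 vs = den prog vs find_leaf_body"
  "call prog 6 vs = den prog vs availability_body"
  "call prog 7 vs = den prog vs search_value_body"
  "call prog 8 vs = den prog vs best_body"
  "call prog 9 vs = den prog vs score_body"
  "call prog 10 vs = den prog vs fmul_body"
  "call prog 11 vs = den prog vs fadd_body"
  "call prog 12 vs = den prog vs fcompl_body"
  by (simp_all add: call_def prog_def)

definition runs :: "nat \<Rightarrow> val list \<Rightarrow> val \<Rightarrow> nat \<Rightarrow> bool" where
  "runs f vs v T \<longleftrightarrow> (\<exists>t\<le>T. call prog f vs = Some (v, t))"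

lemma runsE:
  assumes "runs f vs v T"
  obtains t where "t \<le> T" "call prog f vs = Some (v, t)"
  using assms by (auto simp: runs_def)

lemma runs_mono: "runs f vs v T \<Longrightarrow> T \<le> T' \<Longrightarrow> runs f vs v T'"
  by (auto simp: runs_def)

definition num_dist :: "nat \<Rightarrow> nat \<Rightarrow> nat" where
  "num_dist m n = (m - n) + (n - m)"

definition num_dist_cost :: "nat \<Rightarrow> nat \<Rightarrow> nat" where
  "num_dist_cost m n = 2 * floorlog 2 m + 2 * floorlog 2 n + floorlog 2 (m - n) + floorlog 2 (n - m) + 3"

lemma num_dist_eq_0 [simp]: "num_dist m n = 0 \<longleftrightarrow> m = n"
  by (auto simp: num_dist_def)

lemma den_ne:
  "den P env (ne x y) =
     (case den P env x of Some (Num m, t1) \<Rightarrow>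
        (case den P env y of Some (Num n, t2) \<Rightarrow>
           Some (Num (num_dist m n), 2 * t1 + 2 * t2 + num_dist_cost m n) | _ \<Rightarrow> None) | _ \<Rightarrow> None)"
  by (auto simp: ne_def den_simps num_dist_def num_dist_cost_def split: option.splits val.splits)

lemma floorlog_le: "x < 2 ^ n \<Longrightarrow> floorlog 2 x \<le> n"
  by (auto simp: floorlog_le_iff)

lemma num_dist_bound:
  assumes "m < 2 ^ n" "k < 2 ^ n"
  shows "num_dist_cost m k \<le> 6 * n + 3" "floorlog 2 (num_dist m k) \<le> n"
proof -
  have "m - k < 2 ^ n" "k - m < 2 ^ n" using assms by linarith+
  then show "num_dist_cost m k \<le> 6 * n + 3"
    using assms[THEN floorlog_le] floorlog_le[of "m - k" n] floorlog_le[of "k - m" n]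
    by (simp add: num_dist_cost_def)
  have "num_dist m k < 2 ^ n" using assms by (auto simp: num_dist_def)
  then show "floorlog 2 (num_dist m k) \<le> n" by (rule floorlog_le)
qed

fun frac_enc :: "nat \<times> nat \<Rightarrow> val" where
  "frac_enc (a, b) = Cell (Num a) (Num b)"

fun entry_enc :: "entry \<Rightarrow> val" where
  "entry_enc (u, v, r) = Cell (Cell (Num u) (Num v)) (frac_enc r)"

abbreviation entries_enc :: "entry list \<Rightarrow> val" where
  "entries_enc \<equiv> list_val entry_enc"

lemma list_val_simps [simp]:
  "list_val f [] = Num 0" "list_val f (x # xs) = Cell (f x) (list_val f xs)"
  by (simp_all add: list_val_def)

lemma frac_enc_eq: "frac_enc r = Cell (Num (fst r)) (Num (snd r))"
  by (cases r) simp

definition small_nodes :: "nat \<Rightarrow> entry list \<Rightarrow> bool" where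
  "small_nodes n E \<longleftrightarrow> (\<forall>(u, v, r) \<in> set E. u < 2 ^ n \<and> v < 2 ^ n)"

lemma small_nodes_Cons [simp]:
  "small_nodes n ((u, v, r) # E) \<longleftrightarrow> u < 2 ^ n \<and> v < 2 ^ n \<and> small_nodes n E"
  by (auto simp: small_nodes_def)

lemma delete_node_simps [simp]:
  "delete_node x [] = []"
  "delete_node x ((u, v, r) # E) = (if u \<noteq> x \<and> v \<noteq> x then (u, v, r) # delete_node x E else delete_node x E)"
  by (auto simp: delete_node_def)

lemma delete_edge_simps [simp]:
  "delete_edge x y [] = []"
  "delete_edge x y ((u, v, r) # E) =
     (if (u = x \<and> v = y) \<or> (u = y \<and> v = x) then delete_edge x y E else (u, v, r) # delete_edge x y E)"
  by (auto simp: delete_edge_def doubleton_eq_iff)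

lemma deg_simps [simp]:
  "deg x [] = 0"
  "deg x ((u, v, r) # E) = (if u = x \<or> v = x then deg x E + 1 else deg x E)"
  by (auto simp: deg_def)

lemma deg_le_length: "deg x E \<le> length E"
  by (simp add: deg_def)

lemma runs_delete_node:
  assumes "small_nodes n E" "x < 2 ^ n"
  shows "runs 2 [Num x, entries_enc E] (entries_enc (delete_node x E)) ((length E + 1) * (50 * (n + 1)))"
  using assms(1)
proof (induction E)
  case Nil
  show ?case by (simp add: runs_def call_prog delete_node_body_def den_simps)
next
  case (Cons e E)
  obtain u v r where e: "e = (u, v, r)" by (cases e)
  have b: "u < 2 ^ n" "v < 2 ^ n" using Cons.prems by (auto simp: e)
  obtain t where t: "t \<le> (length E + 1) * (50 * (n + 1))"
    "call prog 2 [Num x, entries_enc E] = Some (entries_enc (delete_node x E), t)"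
    using Cons by (auto simp: e elim: runsE)
  note c = num_dist_bound(1)[OF b(1) assms(2)] num_dist_bound(1)[OF b(2) assms(2)]
  have "call prog 2 [Num x, entries_enc (e # E)] = den prog [Num x, entries_enc (e # E)] delete_node_body"
    by (rule call_prog)
  then show ?case using t(1) c
    by (auto simp: runs_def delete_node_body_def den_simps den_ne t(2) e)
qed

lemma runs_delete_edge:
  assumes "small_nodes n E" "x < 2 ^ n" "y < 2 ^ n"
  shows "runs 3 [Num x, Num y, entries_enc E] (entries_enc (delete_edge x y E)) ((length E + 1) * (100 * (n + 1)))"
  using assms(1)
proof (induction E)
  case Nil
  show ?case by (simp add: runs_def call_prog delete_edge_body_def den_simps)
next
  case (Cons e E)
  obtain u v r where e: "e = (u, v, r)" by (cases e)
  have b: "u < 2 ^ n" "v < 2 ^ n" using Cons.prems by (auto simp: e)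
  obtain t where t: "t \<le> (length E + 1) * (100 * (n + 1))"
    "call prog 3 [Num x, Num y, entries_enc E] = Some (entries_enc (delete_edge x y E), t)"
    using Cons by (auto simp: e elim: runsE)
  note c = num_dist_bound[OF b(1) assms(2)] num_dist_bound[OF b(2) assms(2)]
    num_dist_bound[OF b(1) assms(3)] num_dist_bound[OF b(2) assms(3)]
  have "call prog 3 [Num x, Num y, entries_enc (e # E)] = den prog [Num x, Num y, entries_enc (e # E)] delete_edge_body"
    by (rule call_prog)
  then show ?case using t(1) c
    by (cases "u = x"; cases "v = y"; cases "u = y"; cases "v = x")
      (simp_all add: runs_def delete_edge_body_def den_simps den_ne t(2) e)
qed

lemma floorlog_one: "floorlog 2 (Suc 0) \<le> Suc 0"
  using floorlog_le[of 1 1] by simp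

lemma floorlog_le_self: "m \<le> n \<Longrightarrow> floorlog 2 m \<le> n"
  using less_exp[of n] by (intro floorlog_le) linarith

lemma runs_deg:
  assumes "small_nodes n E" "x < 2 ^ n" "length E \<le> n"
  shows "runs 4 [Num x, entries_enc E] (Num (deg x E)) ((length E + 1) * (50 * (n + 1)))"
  using assms(1,3)
proof (induction E)
  case Nil
  show ?case by (simp add: runs_def call_prog deg_body_def den_simps)
next
  case (Cons e E)
  obtain u v r where e: "e = (u, v, r)" by (cases e)
  have b: "u < 2 ^ n" "v < 2 ^ n" using Cons.prems by (auto simp: e)
  obtain t where t: "t \<le> (length E + 1) * (50 * (n + 1))"
    "call prog 4 [Num x, entries_enc E] = Some (Num (deg x E), t)"
    using Cons by (auto simp: e elim: runsE)
  have "floorlog 2 (deg x E) \<le> n" using deg_le_length[of x E] Cons.prems by (intro floorlog_le_self) simp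
  note c = num_dist_bound(1)[OF b(1) assms(2)] num_dist_bound(1)[OF b(2) assms(2)] this floorlog_one
  have "call prog 4 [Num x, entries_enc (e # E)] = den prog [Num x, entries_enc (e # E)] deg_body"
    by (rule call_prog)
  then show ?case using t(1) c
    by (auto simp: runs_def deg_body_def den_simps den_ne t(2) e)
qed

lemma length_cost_bound:
  fixes l n c :: nat
  assumes "l \<le> n"
  shows "(l + 1) * (c * (n + 1)) \<le> c * (n + 1)\<^sup>2"
proof -
  have "(l + 1) * (c * (n + 1)) \<le> (n + 1) * (c * (n + 1))" using assms by (intro mult_le_mono1) simp
  also have "\<dots> = c * (n + 1)\<^sup>2" by (simp only: power2_eq_square mult_ac)
  finally show ?thesis .
qed

fun leaf_enc :: "entry option \<Rightarrow> val" where
  "leaf_enc None = Num 0"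
| "leaf_enc (Some e) = entry_enc e"

lemma runs_find_leaf:
  assumes "small_nodes n T" "small_nodes n E" "length E \<le> n"
  shows "runs 5 [entries_enc T, entries_enc E] (leaf_enc (find_leaf T E)) ((length T + 1) * (150 * (n + 1)\<^sup>2))"
  using assms(1)
proof (induction T)
  case Nil
  have "4 \<le> 150 * (n + 1)\<^sup>2" by (simp add: power2_eq_square)
  then show ?case by (simp add: runs_def call_prog find_leaf_body_def den_simps)
next
  case (Cons e T)
  obtain u v r where e: "e = (u, v, r)" by (cases e)
  have b: "u < 2 ^ n" "v < 2 ^ n" using Cons.prems by (auto simp: e)
  obtain t where t: "t \<le> (length T + 1) * (150 * (n + 1)\<^sup>2)"
    "call prog 5 [entries_enc T, entries_enc E] = Some (leaf_enc (find_leaf T E), t)"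
    using Cons by (auto simp: e elim: runsE)
  have le: "(length E + 1) * (50 * (n + 1)) \<le> 50 * (n + 1)\<^sup>2"
    using assms(3) by (rule length_cost_bound)
  obtain t1 where t1: "t1 \<le> 50 * (n + 1)\<^sup>2" "call prog 4 [Num u, entries_enc E] = Some (Num (deg u E), t1)"
    using runs_mono[OF runs_deg[OF assms(2) b(1) assms(3)] le] by (rule runsE)
  obtain t2 where t2: "t2 \<le> 50 * (n + 1)\<^sup>2" "call prog 4 [Num v, entries_enc E] = Some (Num (deg v E), t2)"
    using runs_mono[OF runs_deg[OF assms(2) b(2) assms(3)] le] by (rule runsE)
  have "floorlog 2 (deg u E) \<le> n" "floorlog 2 (deg v E) \<le> n"
    using deg_le_length[of _ E] assms(3) le_trans by (blast intro: floorlog_le_self)+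
  moreover have "n + 1 \<le> (n + 1)\<^sup>2" by (simp add: power2_eq_square)
  moreover have "call prog 5 [entries_enc (e # T), entries_enc E] = den prog [entries_enc (e # T), entries_enc E] find_leaf_body"
    by (rule call_prog)
  ultimately show ?case using t(1) t1(1) t2(1) floorlog_one
    by (auto simp: runs_def find_leaf_body_def den_simps t(2) t1(2) t2(2) e)
qed

definition bounded_frac :: "nat \<Rightarrow> nat \<times> nat \<Rightarrow> bool" where
  "bounded_frac w x \<longleftrightarrow> fst x \<le> 2 ^ w \<and> snd x \<le> 2 ^ w"

lemma bounded_frac_mono: "bounded_frac w x \<Longrightarrow> w \<le> w' \<Longrightarrow> bounded_frac w' x"
  unfolding bounded_frac_def by (meson le_trans one_le_numeral power_increasing)

lemma bounded_frac_fmul: "bounded_frac a x \<Longrightarrow> bounded_frac b y \<Longrightarrow> bounded_frac (a + b) (fmul x y)"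
  by (auto simp: bounded_frac_def fmul_def power_add mult_le_mono)

lemma bounded_frac_fadd:
  assumes "bounded_frac a x" "bounded_frac b y"
  shows "bounded_frac (a + b + 1) (fadd x y)"
proof -
  have "fst x * snd y \<le> 2 ^ a * 2 ^ b" "snd x * fst y \<le> 2 ^ a * 2 ^ b" "snd x * snd y \<le> 2 ^ a * 2 ^ b"
    using assms by (auto simp: bounded_frac_def intro!: mult_le_mono)
  then show ?thesis by (simp add: bounded_frac_def fadd_def power_add mult.commute)
qed

lemma bounded_frac_fcompl: "bounded_frac a x \<Longrightarrow> bounded_frac a (fcompl x)"
  by (auto simp: bounded_frac_def fcompl_def)

lemma floorlog_le_Suc: "x \<le> 2 ^ w \<Longrightarrow> floorlog 2 x \<le> w + 1"
  by (rule floorlog_le) (simp add: le_less_trans)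

lemma bounded_frac_floorlog:
  "bounded_frac w x \<Longrightarrow> floorlog 2 (fst x) \<le> w + 1" "bounded_frac w x \<Longrightarrow> floorlog 2 (snd x) \<le> w + 1"
  unfolding bounded_frac_def by (blast intro: floorlog_le_Suc)+

lemma runs_fmul:
  assumes "bounded_frac a x" "bounded_frac b y"
  shows "runs 10 [frac_enc x, frac_enc y] (frac_enc (fmul x y)) (2 * a + 2 * b + 20)"
  using bounded_frac_floorlog[OF assms(1)] bounded_frac_floorlog[OF assms(2)]
  by (simp add: runs_def call_prog fmul_body_def den_simps frac_enc_eq fmul_def)

lemma runs_fadd:
  assumes "bounded_frac a x" "bounded_frac b y"
  shows "runs 11 [frac_enc x, frac_enc y] (frac_enc (fadd x y)) (5 * a + 5 * b + 40)"
proof -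
  have "fst x * snd y \<le> 2 ^ (a + b)" "fst y * snd x \<le> 2 ^ (a + b)"
    using assms mult_le_mono[of "fst x" "2 ^ a" "snd y" "2 ^ b"] mult_le_mono[of "snd x" "2 ^ a" "fst y" "2 ^ b"]
    by (auto simp: bounded_frac_def power_add mult.commute)
  from this[THEN floorlog_le_Suc] show ?thesis
    using bounded_frac_floorlog[OF assms(1)] bounded_frac_floorlog[OF assms(2)]
    by (simp add: runs_def call_prog fadd_body_def den_simps frac_enc_eq fadd_def)
qed

lemma runs_fcompl:
  assumes "bounded_frac a x"
  shows "runs 12 [frac_enc x] (frac_enc (fcompl x)) (2 * a + 10)"
  using bounded_frac_floorlog[OF assms]
  by (simp add: runs_def call_prog fcompl_body_def den_simps frac_enc_eq fcompl_def)

definition denoms :: "entry list \<Rightarrow> nat" where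
  "denoms E = prod_list (map (\<lambda>(u, v, r). snd r) E)"

lemma denoms_simps [simp]: "denoms [] = 1" "denoms ((u, v, r) # E) = snd r * denoms E"
  by (simp_all add: denoms_def)

lemma availability_denoms:
  "node_entries L \<Longrightarrow> snd (availability x L) * denoms (delete_node x L) = denoms L"
  by (induction L) (auto simp: node_entries_def snd_frac)

definition proper_entries :: "entry list \<Rightarrow> bool" where
  "proper_entries E \<longleftrightarrow> (\<forall>(u, v, r) \<in> set E. proper r)"

lemma node_entries_proper: "node_entries L \<Longrightarrow> proper_entries L"
  by (auto simp: node_entries_def proper_entries_def)

lemma proper_entries_Cons [simp]: "proper_entries ((u, v, r) # E) \<longleftrightarrow> proper r \<and> proper_entries E"
  by (auto simp: proper_entries_def)

lemma denoms_pos: "proper_entries E \<Longrightarrow> 0 < denoms E"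
  by (induction E) (auto simp: proper_entries_def proper_def)

lemma denoms_filter_le: "proper_entries E \<Longrightarrow> denoms (filter P E) \<le> denoms E"
proof (induction E)
  case (Cons e E)
  obtain u v r where e: "e = (u, v, r)" by (cases e)
  have "1 \<le> snd r" "denoms (filter P E) \<le> denoms E" using Cons by (auto simp: e proper_def)
  then show ?case using mult_le_mono[of 1 "snd r" "denoms (filter P E)" "denoms E"] by (auto simp: e)
qed simp

lemma denoms_mem_le: "proper_entries E \<Longrightarrow> (u, v, r) \<in> set E \<Longrightarrow> snd r \<le> denoms E"
proof (induction E)
  case (Cons e E)
  obtain u' v' r' where e: "e = (u', v', r')" by (cases e)
  have p: "1 \<le> snd r'" "1 \<le> denoms E" using Cons.prems denoms_pos[of E] by (auto simp: e proper_def)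
  show ?case
  proof (cases "(u, v, r) \<in> set E")
    case True
    then have "snd r \<le> denoms E" using Cons by (simp add: e)
    then show ?thesis using p(1) mult_le_mono[of 1 "snd r'" "snd r" "denoms E"] by (simp add: e)
  next
    case False
    then have "r = r'" using Cons.prems by (simp add: e)
    then show ?thesis using p(2) by (simp add: e)
  qed
qed simp

lemma proper_bounded_frac: "proper x \<Longrightarrow> snd x \<le> 2 ^ n \<Longrightarrow> bounded_frac n x"
  by (simp add: proper_def bounded_frac_def)

lemma bounded_frac_entry: "proper_entries E \<Longrightarrow> (u, v, r) \<in> set E \<Longrightarrow> denoms E \<le> 2 ^ n \<Longrightarrow> bounded_frac n r"
  using denoms_mem_le[of E u v r] by (intro proper_bounded_frac) (auto simp: proper_entries_def)

lemma bounded_frac_availability: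
  assumes "node_entries L" "denoms L \<le> 2 ^ n"
  shows "bounded_frac n (availability x L)"
proof (rule proper_bounded_frac)
  show "proper (availability x L)" using availability_correct(1)[OF assms(1)] .
  have "0 < denoms (delete_node x L)"
    using denoms_pos[OF node_entries_proper[OF node_entries_delete[OF assms(1)]]] .
  then have "snd (availability x L) \<le> denoms L"
    using availability_denoms[OF assms(1), of x] by (metis Suc_leI One_nat_def mult.right_neutral mult_le_mono2)
  then show "snd (availability x L) \<le> 2 ^ n" using assms(2) by simp
qed

lemma runs_availability:
  assumes "node_entries L" "small_nodes n L" "denoms L \<le> 2 ^ n" "x < 2 ^ n"
  shows "runs 6 [Num x, entries_enc L] (frac_enc (availability x L)) ((length L + 1) * (60 * (n + 1)))"
  using assms(1-3)
proof (induction L)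
  case Nil
  show ?case by (simp add: runs_def call_prog availability_body_def den_simps)
next
  case (Cons e L)
  obtain u v r where e: "e = (u, v, r)" by (cases e)
  have b: "u < 2 ^ n" using Cons.prems by (auto simp: e)
  have L: "node_entries L" "small_nodes n L" "denoms L \<le> 2 ^ n"
    using Cons.prems denoms_filter_le[OF node_entries_proper[OF Cons.prems(1)], of "\<lambda>c. True"]
    by (auto simp: e node_entries_def proper_def) (metis One_nat_def Suc_leI le_trans mult.left_neutral mult_le_mono1)
  obtain t where t: "t \<le> (length L + 1) * (60 * (n + 1))"
    "call prog 6 [Num x, entries_enc L] = Some (frac_enc (availability x L), t)"
    using Cons.IH[OF L] by (rule runsE)
  have r: "bounded_frac n r"
    using Cons.prems(3) by (intro bounded_frac_entry[OF node_entries_proper[OF Cons.prems(1)], of u v]) (auto simp: e)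
  obtain t' where t': "t' \<le> 2 * n + 2 * n + 20"
    "call prog 10 [frac_enc r, frac_enc (availability x L)] = Some (frac_enc (fmul r (availability x L)), t')"
    using runs_fmul[OF r bounded_frac_availability[OF L(1,3)]] by (rule runsE)
  have "call prog 6 [Num x, entries_enc (e # L)] = den prog [Num x, entries_enc (e # L)] availability_body"
    by (rule call_prog)
  then show ?case using t(1) t'(1) num_dist_bound(1)[OF b assms(4)]
    by (auto simp: runs_def availability_body_def den_simps den_ne t(2) t'(2) e)
qed

text \<open>
  The product of the denominators is the quantity that leaf elimination preserves: the denominators of
  the leaf and of its edge move into the new entry.
\<close>

definition search_inv :: "nat \<Rightarrow> entry list \<Rightarrow> entry list \<Rightarrow> bool" where
  "search_inv n E L \<longleftrightarrow> length E + length L \<le> n \<and> small_nodes n E \<and> small_nodes n L \<and>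
     proper_entries E \<and> node_entries L \<and> denoms E * denoms L \<le> 2 ^ n"

lemma search_inv_denoms:
  assumes "search_inv n E L"
  shows "denoms E \<le> 2 ^ n" "denoms L \<le> 2 ^ n"
proof -
  have "0 < denoms E" "0 < denoms L" "denoms E * denoms L \<le> 2 ^ n"
    using assms denoms_pos node_entries_proper by (auto simp: search_inv_def)
  moreover from this have "denoms E \<le> denoms E * denoms L" "denoms L \<le> denoms E * denoms L"
    by simp_all
  ultimately show "denoms E \<le> 2 ^ n" "denoms L \<le> 2 ^ n" by linarith+
qed

lemma search_inv_filter:
  assumes "search_inv n E L"
  shows "search_inv n (filter P E) L"
proof -
  have "denoms (filter P E) * denoms L \<le> denoms E * denoms L"
    using assms by (intro mult_le_mono1 denoms_filter_le) (simp add: search_inv_def)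
  moreover have "denoms E * denoms L \<le> 2 ^ n" "length E + length L \<le> n" using assms by (simp_all add: search_inv_def)
  ultimately have "denoms (filter P E) * denoms L \<le> 2 ^ n" "length (filter P E) + length L \<le> n"
    using length_filter_le[of P E] by linarith+
  then show ?thesis using assms
    unfolding search_inv_def small_nodes_def proper_entries_def by auto
qed

lemma search_inv_delete:
  assumes "search_inv n E L"
  shows "search_inv n (delete_node x E) L" "search_inv n (delete_edge x y E) L"
  using search_inv_filter[OF assms] by (simp_all add: delete_node_def delete_edge_def)

lemma search_inv_tail:
  assumes "search_inv n E ((x, y, r) # L)"
  shows "search_inv n E L"
proof -
  have "1 \<le> snd r" using assms by (auto simp: search_inv_def node_entries_def proper_def)
  then have "denoms E * denoms L \<le> denoms E * denoms ((x, y, r) # L)" by simp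
  also have "\<dots> \<le> 2 ^ n" using assms by (simp only: search_inv_def)
  finally show ?thesis using assms by (auto simp: search_inv_def node_entries_def)
qed

lemma denoms_delete_node:
  "denoms (delete_node x E) * denoms (filter (\<lambda>e. x \<in> ends e) E) = denoms E"
  by (induction E) auto

lemma search_inv_leaf:
  assumes inv: "search_inv n E L" and leaf: "find_leaf E E = Some (u, v, r)"
  shows "search_inv n (delete_node u E) ((v, v, fcompl (fmul r (availability u L))) # delete_node u L)"
    "u < 2 ^ n" "v < 2 ^ n" "proper r" "snd r \<le> 2 ^ n"
proof -
  obtain e where e: "e \<in> set E" "e = (u, v, r) \<or> e = (v, u, r)" and d: "deg u E = 1"
    using find_leaf_Some[OF leaf] by blast
  show uv: "u < 2 ^ n" "v < 2 ^ n" and r: "proper r"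
    using e inv by (auto simp: search_inv_def small_nodes_def proper_entries_def)
  have pE: "proper_entries E" and L: "node_entries L" using inv by (auto simp: search_inv_def)
  have ue: "u \<in> ends e" using e(2) by auto
  have "denoms (delete_node u E) * snd r = denoms E"
    using denoms_delete_node[of u E] deg_eq_1[OF d e(1) ue] e(2) by auto
  moreover have "snd (availability u L) * denoms (delete_node u L) = denoms L"
    by (rule availability_denoms[OF L])
  ultimately have "denoms (delete_node u E) * denoms ((v, v, fcompl (fmul r (availability u L))) # delete_node u L)
      = denoms E * denoms L"
    by (simp add: snd_frac) (metis mult.assoc)
  moreover have "node_entries ((v, v, fcompl (fmul r (availability u L))) # delete_node u L)"
    using node_entries_delete[OF L, of u] r availability_correct(1)[OF L, of u]
    by (auto simp: node_entries_def proper_fcompl proper_fmul)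
  moreover have "length (delete_node u E) + length (delete_node u L) < length E + length L"
    using find_leaf_length_less[OF leaf] length_delete_node_le[of u L] by simp
  moreover have "small_nodes n (delete_node u L)" using inv by (auto simp: search_inv_def small_nodes_def delete_node_def)
  ultimately show "search_inv n (delete_node u E) ((v, v, fcompl (fmul r (availability u L))) # delete_node u L)"
    using inv search_inv_delete(1)[OF inv, of u] uv by (simp add: search_inv_def)
  show "snd r \<le> 2 ^ n"
    using e search_inv_denoms(1)[OF inv] denoms_mem_le[OF pE, of u v r] denoms_mem_le[OF pE, of v u r] by auto
qed

lemma bounded_frac_score:
  assumes "bounded_frac n r" "bounded_frac a (val (delete_node v (delete_node u E)))"
    "bounded_frac b (val (delete_edge u v E))"
  shows "bounded_frac (2 * n + a + b + 2) (score val E (u, v, r))"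
proof -
  have "bounded_frac 0 (1, 1)" by (simp add: bounded_frac_def)
  from bounded_frac_fadd[OF bounded_frac_fmul[OF assms(1) bounded_frac_fadd[OF this assms(2)]]
      bounded_frac_fmul[OF bounded_frac_fcompl[OF assms(1)] assms(3)]]
  show ?thesis by (simp add: score_def) (erule bounded_frac_mono, simp)
qed

lemma bounded_frac_best:
  "(\<And>c. c \<in> set T \<Longrightarrow> bounded_frac w (s c)) \<Longrightarrow> bounded_frac w (fst (best s T))"
  by (induction T) (auto simp: Let_def bounded_frac_def)

lemma calls_choose_ge:
  assumes "E \<noteq> []" "find_leaf E E = None" "(u, v, r) \<in> set E"
  shows "1 + calls (delete_node v (delete_node u E)) [] + calls (delete_edge u v E) [] \<le> calls E []"
proof -
  let ?f = "\<lambda>(u, v, r). 1 + calls (delete_node v (delete_node u E)) [] + calls (delete_edge u v E) []"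
  have "?f (u, v, r) \<in> ?f ` set E" using assms(3) by (rule imageI)
  then have "?f (u, v, r) \<in> set (map ?f E)" by (simp only: set_map)
  then have "?f (u, v, r) \<le> sum_list (map ?f E)" by (rule member_le_sum_list) simp
  then show ?thesis unfolding calls_simps(3)[OF assms(1,2)] by simp
qed

lemma bounded_frac_search_value:
  "search_inv n E L \<Longrightarrow> bounded_frac (calls E L * (4 * n + 4)) (search_value E L)"
proof (induction E L rule: search_induct)
  case (empty L)
  show ?case by (simp add: search_value_simps(1) bounded_frac_def)
next
  case (leaf E L u v r)
  note inv = search_inv_leaf[OF leaf(4,2)]
  have L: "node_entries L" using leaf(4) by (simp add: search_inv_def)
  have r: "bounded_frac n r" using inv(4,5) by (rule proper_bounded_frac)
  note av = bounded_frac_availability[OF L search_inv_denoms(2)[OF leaf(4)]]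
  show ?case
    unfolding search_value_simps(2)[OF leaf(1,2)] calls_simps(2)[OF leaf(1,2)]
    by (rule bounded_frac_mono[OF bounded_frac_fadd[OF bounded_frac_fmul[OF av bounded_frac_fmul[OF r av]] leaf(3)[OF inv(1)]]])
      (simp add: algebra_simps)
next
  case (skip E x y r L)
  show ?case unfolding search_value_simps(4)[OF skip(1-3)] calls_simps(4)[OF skip(1-3)]
    by (rule bounded_frac_mono[OF skip(4)[OF search_inv_tail[OF skip(5)]]]) simp
next
  case (branch E x y r L)
  note tail = search_inv_tail[OF branch(6)]
  have r: "bounded_frac n r"
    using branch(6) search_inv_denoms(2)[OF branch(6)]
    by (intro bounded_frac_entry[OF node_entries_proper, of "(x, y, r) # L" x y]) (auto simp: search_inv_def)
  show ?case
    unfolding search_value_simps(5)[OF branch(1-3)] calls_simps(5)[OF branch(1-3)]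
    by (rule bounded_frac_mono[OF bounded_frac_fadd[OF
          bounded_frac_fmul[OF bounded_frac_fcompl[OF r] branch(4)[OF search_inv_delete(1)[OF tail]]]
          bounded_frac_fmul[OF r branch(5)[OF tail]]]])
      (simp add: algebra_simps)
next
  case (choose E)
  show ?case unfolding search_value_simps(3)[OF choose(1,2)]
  proof (rule bounded_frac_best)
    fix c assume c: "c \<in> set E"
    obtain u v r where uvr: "c = (u, v, r)" by (cases c)
    have cE: "(u, v, r) \<in> set E" using c uvr by simp
    have r: "bounded_frac n r"
      using choose(5) search_inv_denoms(1)[OF choose(5)] cE
      by (intro bounded_frac_entry[of E u v]) (auto simp: search_inv_def)
    have "bounded_frac (2 * n + calls (delete_node v (delete_node u E)) [] * (4 * n + 4)
        + calls (delete_edge u v E) [] * (4 * n + 4) + 2) (score (\<lambda>F. search_value F []) E (u, v, r))"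
      using choose(3)[OF cE] choose(4)[OF cE] choose(5) search_inv_delete
      by (intro bounded_frac_score r) blast+
    moreover have "2 * n + calls (delete_node v (delete_node u E)) [] * (4 * n + 4)
        + calls (delete_edge u v E) [] * (4 * n + 4) + 2 \<le> calls E [] * (4 * n + 4)"
      using mult_le_mono1[OF calls_choose_ge[OF choose(1,2) cE], of "4 * n + 4"] by (simp add: algebra_simps)
    ultimately show "bounded_frac (calls E [] * (4 * n + 4)) (score (\<lambda>F. search_value F []) E c)"
      unfolding uvr by (rule bounded_frac_mono)
  qed
qed

fun best_enc :: "(nat \<times> nat) \<times> nat \<times> nat \<Rightarrow> val" where
  "best_enc (s, u, v) = Cell (frac_enc s) (Cell (Num u) (Num v))"

lemma runs_best:
  assumes "\<And>c. c \<in> set T \<Longrightarrow> runs 9 [entry_enc c, x] (frac_enc (s c)) (\<tau> c)"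
    "\<And>c. c \<in> set T \<Longrightarrow> bounded_frac w (s c)"
  shows "runs 8 [entries_enc T, x] (best_enc (best s T)) ((\<Sum>c\<leftarrow>T. \<tau> c + (10 * w + 100)) + 20)"
  using assms
proof (induction T)
  case Nil
  show ?case by (simp add: runs_def call_prog best_body_def den_simps)
next
  case (Cons c T)
  obtain u v r where c: "c = (u, v, r)" by (cases c)
  obtain b u' v' where b: "best s T = (b, u', v')" by (cases "best s T")
  obtain t where t: "t \<le> (\<Sum>c\<leftarrow>T. \<tau> c + (10 * w + 100)) + 20"
    "call prog 8 [entries_enc T, x] = Some (best_enc (b, u', v'), t)"
    using Cons unfolding b by (auto elim: runsE)
  obtain t' where t': "t' \<le> \<tau> c" "call prog 9 [entry_enc c, x] = Some (frac_enc (s c), t')"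
    using Cons.prems(1)[of c] by (auto elim: runsE)
  have sc: "bounded_frac w (s c)" and bb: "bounded_frac w b"
    using Cons.prems(2) bounded_frac_best[of T w s] by (simp_all add: b)
  have "fst b * snd (s c) \<le> 2 ^ (w + w)" "fst (s c) * snd b \<le> 2 ^ (w + w)"
    using sc bb by (auto simp: bounded_frac_def power_add intro!: mult_le_mono)
  note fl = this[THEN floorlog_le_Suc] bounded_frac_floorlog[OF sc] bounded_frac_floorlog[OF bb]
  have "call prog 8 [entries_enc (c # T), x] = den prog [entries_enc (c # T), x] best_body"
    by (rule call_prog)
  then show ?case using t(1) t'(1) fl
    by (cases "fst (s c) * snd b < fst b * snd (s c)")
      (simp_all add: runs_def best_body_def den_simps t(2) t'(2)[unfolded c entry_enc.simps] c b Let_def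
        frac_enc_eq[of "s (u, v, r)"] frac_enc_eq[of b])
qed

lemma runs_score:
  assumes inv: "search_inv n E []" and c: "(u, v, r) \<in> set E"
    and F: "runs 7 [entries_enc (delete_node v (delete_node u E)), Num 0]
      (frac_enc (search_value (delete_node v (delete_node u E)) [])) T1"
      "bounded_frac w (search_value (delete_node v (delete_node u E)) [])"
    and H: "runs 7 [entries_enc (delete_edge u v E), Num 0] (frac_enc (search_value (delete_edge u v E) [])) T2"
      "bounded_frac w (search_value (delete_edge u v E) [])"
  shows "runs 9 [entry_enc (u, v, r), entries_enc E] (frac_enc (score (\<lambda>F. search_value F []) E (u, v, r)))
    (T1 + T2 + (1000 * (n + 1)\<^sup>2 + 30 * w))"
proof -
  have uv: "u < 2 ^ n" "v < 2 ^ n" and len: "length E \<le> n" and sE: "small_nodes n E"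
    using inv c by (auto simp: search_inv_def small_nodes_def)
  have r: "bounded_frac n r"
    using inv search_inv_denoms(1)[OF inv] c by (intro bounded_frac_entry[of E u v]) (auto simp: search_inv_def)
  define F where "F = delete_node v (delete_node u E)"
  define H where "H = delete_edge u v E"
  define x where "x = search_value F []"
  define y where "y = search_value H []"
  have len': "length (delete_node u E) \<le> n" using len length_delete_node_le[of u E] by simp
  have sE': "small_nodes n (delete_node u E)" using sE by (auto simp: small_nodes_def delete_node_def)
  have x: "bounded_frac w x" and y: "bounded_frac w y"
    using assms by (simp_all add: x_def y_def F_def H_def)
  obtain t1 where t1: "t1 \<le> 50 * (n + 1)\<^sup>2" "call prog 2 [Num u, entries_enc E] = Some (entries_enc (delete_node u E), t1)"
    using runs_mono[OF runs_delete_node[OF sE uv(1)] length_cost_bound[OF len]] by (rule runsE)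
  obtain t2 where t2: "t2 \<le> 50 * (n + 1)\<^sup>2" "call prog 2 [Num v, entries_enc (delete_node u E)] = Some (entries_enc F, t2)"
    using runs_mono[OF runs_delete_node[OF sE' uv(2)] length_cost_bound[OF len']] unfolding F_def by (rule runsE)
  obtain t3 where t3: "t3 \<le> 100 * (n + 1)\<^sup>2" "call prog 3 [Num u, Num v, entries_enc E] = Some (entries_enc H, t3)"
    using runs_mono[OF runs_delete_edge[OF sE uv] length_cost_bound[OF len]] unfolding H_def by (rule runsE)
  obtain t4 where t4: "t4 \<le> T1" "call prog 7 [entries_enc F, Num 0] = Some (frac_enc x, t4)"
    using assms(3) unfolding F_def x_def by (rule runsE)
  obtain t5 where t5: "t5 \<le> T2" "call prog 7 [entries_enc H, Num 0] = Some (frac_enc y, t5)"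
    using assms(5) unfolding H_def y_def by (rule runsE)
  have one: "bounded_frac 0 (1, 1)" by (simp add: bounded_frac_def)
  define z where "z = fadd (1, 1) x"
  have b1: "bounded_frac (w + 1) z" using bounded_frac_fadd[OF one x] by (simp add: z_def)
  note b2 = bounded_frac_fmul[OF r b1]
  note b3 = bounded_frac_fcompl[OF r]
  note b4 = bounded_frac_fmul[OF b3 y]
  obtain t6 where t6: "t6 \<le> 5 * 0 + 5 * w + 40"
    "call prog 11 [Cell (Num (Suc 0)) (Num (Suc 0)), frac_enc x] = Some (frac_enc (z), t6)"
    using runs_fadd[OF one x] unfolding z_def[symmetric] by (auto elim: runsE)
  obtain t7 where t7: "t7 \<le> 2 * n + 2 * (w + 1) + 20"
    "call prog 10 [frac_enc r, frac_enc (z)] = Some (frac_enc (fmul r z), t7)"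
    using runs_fmul[OF r b1] by (rule runsE)
  obtain t8 where t8: "t8 \<le> 2 * n + 10" "call prog 12 [frac_enc r] = Some (frac_enc (fcompl r), t8)"
    using runs_fcompl[OF r] by (rule runsE)
  obtain t9 where t9: "t9 \<le> 2 * n + 2 * w + 20"
    "call prog 10 [frac_enc (fcompl r), frac_enc y] = Some (frac_enc (fmul (fcompl r) y), t9)"
    using runs_fmul[OF b3 y] by (rule runsE)
  obtain t10 where t10: "t10 \<le> 5 * (n + (w + 1)) + 5 * (n + w) + 40"
    "call prog 11 [frac_enc (fmul r z), frac_enc (fmul (fcompl r) y)]
       = Some (frac_enc (fadd (fmul r z) (fmul (fcompl r) y)), t10)"
    using runs_fadd[OF b2 b4] by (rule runsE)
  have sc: "score (\<lambda>F. search_value F []) E (u, v, r) = fadd (fmul r z) (fmul (fcompl r) y)"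
    by (simp add: score_def x_def y_def z_def F_def H_def)
  obtain m where m: "m = (n + 1)\<^sup>2" by blast
  have n2: "n + 1 \<le> (n + 1)\<^sup>2" by (simp add: power2_eq_square)
  have "\<exists>t\<le>t1 + t2 + t3 + t4 + t5 + t6 + t7 + t8 + t9 + t10 + 100.
      call prog 9 [entry_enc (u, v, r), entries_enc E] = Some (frac_enc (fadd (fmul r z) (fmul (fcompl r) y)), t)"
    by (simp add: call_prog(10) score_body_def den_simps t1(2) t2(2) t3(2) t4(2) t5(2) t6(2) t7(2) t8(2) t9(2) t10(2))
  then obtain t where t: "t \<le> t1 + t2 + t3 + t4 + t5 + t6 + t7 + t8 + t9 + t10 + 100"
    "call prog 9 [entry_enc (u, v, r), entries_enc E] = Some (frac_enc (score (\<lambda>F. search_value F []) E (u, v, r)), t)"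
    unfolding sc by blast
  have "t \<le> T1 + T2 + (1000 * (n + 1)\<^sup>2 + 30 * w)"
    using t(1) t1(1) t2(1) t3(1) t4(1) t5(1) t6(1) t7(1) t8(1) t9(1) t10(1) n2
    unfolding m[symmetric] by simp
  then show ?thesis using t(2) by (auto simp: runs_def)
qed

definition step_cost :: "nat \<Rightarrow> nat \<Rightarrow> nat" where
  "step_cost n w = 3000 * (n + 1) ^ 3 + 100 * w"

lemma entries_enc_eq_0: "entries_enc E = Num 0 \<longleftrightarrow> E = []"
  by (cases E) auto

lemma square_le_cube: "(n + 1)\<^sup>2 \<le> (n + 1 :: nat) ^ 3" "n + 1 \<le> (n + 1 :: nat) ^ 3"
  by (simp_all add: power2_eq_square power3_eq_cube)

lemma runs_search_value:
  assumes "search_inv n E L" "calls E L * (4 * n + 4) \<le> w"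
  shows "runs 7 [entries_enc E, entries_enc L] (frac_enc (search_value E L)) (calls E L * step_cost n w)"
proof -
  obtain m2 m3 where m: "m2 = (n + 1)\<^sup>2" "m3 = (n + 1) ^ 3" by blast
  note cube = square_le_cube[of n, folded m]
  show ?thesis
    using assms
  proof (induction E L rule: search_induct)
    case (empty L)
    have "5 \<le> step_cost n w" using cube unfolding step_cost_def m[symmetric] by simp
    then show ?case by (simp add: runs_def call_prog search_value_body_def den_simps search_value_simps(1) calls_simps(1))
  next
    case (leaf E L u v r)
    note inv = search_inv_leaf[OF leaf(4,2)]
    have sE: "small_nodes n E" and sL: "small_nodes n L" and L: "node_entries L"
      and len: "length E \<le> n" "length L \<le> n"
      using leaf(4) by (auto simp: search_inv_def)
    have r: "bounded_frac n r" using inv(4,5) by (rule proper_bounded_frac)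
    note av = bounded_frac_availability[OF L search_inv_denoms(2)[OF leaf(4)]]
    define q where "q = fmul r (availability u L)"
    have q: "bounded_frac (n + n) q" unfolding q_def by (rule bounded_frac_fmul[OF r av])
    let ?M = "(v, v, fcompl q) # delete_node u L"
    define x where "x = search_value (delete_node u E) ?M"
    have cl: "calls E L = 1 + calls (delete_node u E) ?M"
      unfolding q_def by (rule calls_simps(2)[OF leaf(1,2)])
    have invM: "search_inv n (delete_node u E) ?M" unfolding q_def by (rule inv(1))
    have w': "calls (delete_node u E) ?M * (4 * n + 4) \<le> w" using leaf(5) by (simp add: cl)
    have x: "bounded_frac w x"
      unfolding x_def by (rule bounded_frac_mono[OF bounded_frac_search_value[OF invM] w'])
    obtain t1 where t1: "t1 \<le> (length E + 1) * (150 * (n + 1)\<^sup>2)"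
      "call prog 5 [entries_enc E, entries_enc E] = Some (entry_enc (u, v, r), t1)"
      using runs_find_leaf[OF sE sE len(1)] by (auto simp: leaf(2) elim: runsE)
    have "t1 \<le> (n + 1) * (150 * (n + 1)\<^sup>2)" using t1(1) len(1) mult_le_mono1[of "length E + 1" "n + 1"] by (meson add_le_mono1 le_trans)
    then have t1': "t1 \<le> 150 * (n + 1) ^ 3" by (simp add: power2_eq_square power3_eq_cube algebra_simps)
    obtain t2 where t2: "t2 \<le> 60 * (n + 1)\<^sup>2" "call prog 6 [Num u, entries_enc L] = Some (frac_enc (availability u L), t2)"
      using runs_mono[OF runs_availability[OF L sL search_inv_denoms(2)[OF leaf(4)] inv(2)] length_cost_bound[OF len(2)]]
      by (rule runsE)
    obtain t3 where t3: "t3 \<le> 2 * n + 2 * n + 20" "call prog 10 [frac_enc r, frac_enc (availability u L)] = Some (frac_enc q, t3)"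
      using runs_fmul[OF r av] unfolding q_def by (rule runsE)
    obtain t4 where t4: "t4 \<le> 60 * (n + 1)\<^sup>2" "call prog 6 [Num v, entries_enc L] = Some (frac_enc (availability v L), t4)"
      using runs_mono[OF runs_availability[OF L sL search_inv_denoms(2)[OF leaf(4)] inv(3)] length_cost_bound[OF len(2)]]
      by (rule runsE)
    obtain t5 where t5: "t5 \<le> 2 * n + 2 * (n + n) + 20"
      "call prog 10 [frac_enc (availability v L), frac_enc q] = Some (frac_enc (fmul (availability v L) q), t5)"
      using runs_fmul[OF av q] by (rule runsE)
    obtain t6 where t6: "t6 \<le> 2 * (n + n) + 10" "call prog 12 [frac_enc q] = Some (frac_enc (fcompl q), t6)"
      using runs_fcompl[OF q] by (rule runsE)
    obtain t7 where t7: "t7 \<le> 50 * (n + 1)\<^sup>2" "call prog 2 [Num u, entries_enc E] = Some (entries_enc (delete_node u E), t7)"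
      using runs_mono[OF runs_delete_node[OF sE inv(2)] length_cost_bound[OF len(1)]] by (rule runsE)
    obtain t8 where t8: "t8 \<le> 50 * (n + 1)\<^sup>2" "call prog 2 [Num u, entries_enc L] = Some (entries_enc (delete_node u L), t8)"
      using runs_mono[OF runs_delete_node[OF sL inv(2)] length_cost_bound[OF len(2)]] by (rule runsE)
    obtain t9 where t9: "t9 \<le> calls (delete_node u E) ?M * step_cost n w"
      "call prog 7 [entries_enc (delete_node u E),
         Cell (Cell (Cell (Num v) (Num v)) (frac_enc (fcompl q))) (entries_enc (delete_node u L))] = Some (frac_enc x, t9)"
      using leaf(3)[OF invM w'] unfolding x_def by (auto elim: runsE)
    obtain t10 where t10: "t10 \<le> 5 * (n + (n + n)) + 5 * w + 40"
      "call prog 11 [frac_enc (fmul (availability v L) q), frac_enc x] = Some (frac_enc (fadd (fmul (availability v L) q) x), t10)"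
      using runs_fadd[OF bounded_frac_fmul[OF av q] x] by (rule runsE)
    have search_value: "search_value E L = fadd (fmul (availability v L) q) x"
      unfolding x_def q_def by (rule search_value_simps(2)[OF leaf(1,2)])
    have "\<exists>t\<le>t1 + t2 + t3 + t4 + t5 + t6 + t7 + t8 + t9 + t10 + 100.
        call prog 7 [entries_enc E, entries_enc L] = Some (frac_enc (fadd (fmul (availability v L) q) x), t)"
      unfolding call_prog(8)[of "[entries_enc E, entries_enc L]"]
      by (simp add: search_value_body_def den_simps entries_enc_eq_0 leaf(1)
          t1(2)[unfolded entry_enc.simps] t2(2) t3(2) t4(2) t5(2) t6(2) t7(2) t8(2) t9(2) t10(2))
    then obtain t where t: "t \<le> t1 + t2 + t3 + t4 + t5 + t6 + t7 + t8 + t9 + t10 + 100"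
      "call prog 7 [entries_enc E, entries_enc L] = Some (frac_enc (search_value E L), t)"
      unfolding search_value by blast
    have "t1 + t2 + t3 + t4 + t5 + t6 + t7 + t8 + t10 + 100 \<le> step_cost n w"
      using t1' t2(1) t3(1) t4(1) t5(1) t6(1) t7(1) t8(1) t10(1) cube unfolding step_cost_def m[symmetric] by simp
    then have "t \<le> calls (delete_node u E) ?M * step_cost n w + step_cost n w" using t(1) t9(1) by linarith
    then show ?case using t(2) by (auto simp: runs_def cl)
  next
    case (skip E x y r L)
    have sE: "small_nodes n E" and len: "length E \<le> n" and x: "x < 2 ^ n"
      using skip(5) by (auto simp: search_inv_def)
    have cl: "calls E ((x, y, r) # L) = 1 + calls E L" by (rule calls_simps(4)[OF skip(1-3)])
    have w': "calls E L * (4 * n + 4) \<le> w" using skip(6) by (simp add: cl)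
    obtain t1 where t1: "t1 \<le> (length E + 1) * (150 * (n + 1)\<^sup>2)"
      "call prog 5 [entries_enc E, entries_enc E] = Some (Num 0, t1)"
      using runs_find_leaf[OF sE sE len] by (auto simp: skip(2) elim: runsE)
    have "t1 \<le> (n + 1) * (150 * (n + 1)\<^sup>2)" using t1(1) len mult_le_mono1[of "length E + 1" "n + 1"] by (meson add_le_mono1 le_trans)
    then have t1': "t1 \<le> 150 * (n + 1) ^ 3" by (simp add: power2_eq_square power3_eq_cube algebra_simps)
    obtain t2 where t2: "t2 \<le> calls E L * step_cost n w" "call prog 7 [entries_enc E, entries_enc L] = Some (frac_enc (search_value E L), t2)"
      using skip(4)[OF search_inv_tail[OF skip(5)] w'] by (rule runsE)
    obtain t3 where t3: "t3 \<le> 50 * (n + 1)\<^sup>2" "call prog 4 [Num x, entries_enc E] = Some (Num 0, t3)"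
      using runs_mono[OF runs_deg[OF sE x len] length_cost_bound[OF len]] unfolding skip(3) by (rule runsE)
    have "\<exists>t\<le>t1 + t2 + t3 + 100.
        call prog 7 [entries_enc E, entries_enc ((x, y, r) # L)] = Some (frac_enc (search_value E L), t)"
      unfolding call_prog(8)[of "[entries_enc E, entries_enc ((x, y, r) # L)]"]
      by (simp add: search_value_body_def den_simps entries_enc_eq_0 skip(1) t1(2) t2(2) t3(2))
    then obtain t where t: "t \<le> t1 + t2 + t3 + 100"
      "call prog 7 [entries_enc E, entries_enc ((x, y, r) # L)] = Some (frac_enc (search_value E ((x, y, r) # L)), t)"
      unfolding search_value_simps(4)[OF skip(1-3)] by blast
    have "t1 + t3 + 100 \<le> step_cost n w" using t1' t3(1) cube unfolding step_cost_def m[symmetric] by simp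
    then have "t \<le> calls E L * step_cost n w + step_cost n w" using t(1) t2(1) by linarith
    then show ?case using t(2) by (auto simp: runs_def cl)
  next
    case (branch E x y r L)
    note tail = search_inv_tail[OF branch(6)]
    have sE: "small_nodes n E" and len: "length E \<le> n" and x: "x < 2 ^ n"
      using branch(6) by (auto simp: search_inv_def)
    have r: "bounded_frac n r"
      using branch(6) search_inv_denoms(2)[OF branch(6)]
      by (intro bounded_frac_entry[OF node_entries_proper, of "(x, y, r) # L" x y]) (auto simp: search_inv_def)
    have cl: "calls E ((x, y, r) # L) = 1 + calls (delete_node x E) L + calls E L"
      by (rule calls_simps(5)[OF branch(1-3)])
    have w': "calls E L * (4 * n + 4) \<le> w" "calls (delete_node x E) L * (4 * n + 4) \<le> w"
      using branch(7) unfolding cl by (simp_all add: algebra_simps)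
    define a where "a = search_value (delete_node x E) L"
    define b where "b = search_value E L"
    have a: "bounded_frac w a" and b: "bounded_frac w b" unfolding a_def b_def
      using bounded_frac_mono[OF bounded_frac_search_value w'(2)] bounded_frac_mono[OF bounded_frac_search_value w'(1)] tail search_inv_delete(1)
      by blast+
    obtain t1 where t1: "t1 \<le> (length E + 1) * (150 * (n + 1)\<^sup>2)"
      "call prog 5 [entries_enc E, entries_enc E] = Some (Num 0, t1)"
      using runs_find_leaf[OF sE sE len] by (auto simp: branch(2) elim: runsE)
    have "t1 \<le> (n + 1) * (150 * (n + 1)\<^sup>2)" using t1(1) len mult_le_mono1[of "length E + 1" "n + 1"] by (meson add_le_mono1 le_trans)
    then have t1': "t1 \<le> 150 * (n + 1) ^ 3" by (simp add: power2_eq_square power3_eq_cube algebra_simps)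
    obtain t2 where t2: "t2 \<le> calls E L * step_cost n w" "call prog 7 [entries_enc E, entries_enc L] = Some (frac_enc b, t2)"
      using branch(5)[OF tail w'(1)] unfolding b_def by (rule runsE)
    obtain t3 where t3: "t3 \<le> 50 * (n + 1)\<^sup>2" "call prog 4 [Num x, entries_enc E] = Some (Num (deg x E), t3)"
      using runs_mono[OF runs_deg[OF sE x len] length_cost_bound[OF len]] by (rule runsE)
    obtain t4 where t4: "t4 \<le> 2 * n + 10" "call prog 12 [frac_enc r] = Some (frac_enc (fcompl r), t4)"
      using runs_fcompl[OF r] by (rule runsE)
    obtain t5 where t5: "t5 \<le> 50 * (n + 1)\<^sup>2" "call prog 2 [Num x, entries_enc E] = Some (entries_enc (delete_node x E), t5)"
      using runs_mono[OF runs_delete_node[OF sE x] length_cost_bound[OF len]] by (rule runsE)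
    obtain t6 where t6: "t6 \<le> calls (delete_node x E) L * step_cost n w"
      "call prog 7 [entries_enc (delete_node x E), entries_enc L] = Some (frac_enc a, t6)"
      using branch(4)[OF search_inv_delete(1)[OF tail] w'(2)] unfolding a_def by (rule runsE)
    obtain t7 where t7: "t7 \<le> 2 * n + 2 * w + 20"
      "call prog 10 [frac_enc (fcompl r), frac_enc a] = Some (frac_enc (fmul (fcompl r) a), t7)"
      using runs_fmul[OF bounded_frac_fcompl[OF r] a] by (rule runsE)
    obtain t8 where t8: "t8 \<le> 2 * n + 2 * w + 20" "call prog 10 [frac_enc r, frac_enc b] = Some (frac_enc (fmul r b), t8)"
      using runs_fmul[OF r b] by (rule runsE)
    obtain t9 where t9: "t9 \<le> 5 * (n + w) + 5 * (n + w) + 40"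
      "call prog 11 [frac_enc (fmul (fcompl r) a), frac_enc (fmul r b)] = Some (frac_enc (fadd (fmul (fcompl r) a) (fmul r b)), t9)"
      using runs_fadd[OF bounded_frac_fmul[OF bounded_frac_fcompl[OF r] a] bounded_frac_fmul[OF r b]] by (rule runsE)
    have search_value: "search_value E ((x, y, r) # L) = fadd (fmul (fcompl r) a) (fmul r b)"
      unfolding a_def b_def by (rule search_value_simps(5)[OF branch(1-3)])
    have "\<exists>t\<le>t1 + t2 + t3 + t4 + t5 + t6 + t7 + t8 + t9 + 100.
        call prog 7 [entries_enc E, entries_enc ((x, y, r) # L)] = Some (frac_enc (fadd (fmul (fcompl r) a) (fmul r b)), t)"
      using branch(3) unfolding call_prog(8)[of "[entries_enc E, entries_enc ((x, y, r) # L)]"]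
      by (simp add: search_value_body_def den_simps entries_enc_eq_0 branch(1) t1(2) t2(2) t3(2) t4(2) t5(2) t6(2) t7(2) t8(2) t9(2))
    then obtain t where t: "t \<le> t1 + t2 + t3 + t4 + t5 + t6 + t7 + t8 + t9 + 100"
      "call prog 7 [entries_enc E, entries_enc ((x, y, r) # L)] = Some (frac_enc (search_value E ((x, y, r) # L)), t)"
      unfolding search_value by blast
    have "t1 + t3 + t4 + t5 + t7 + t8 + t9 + 100 \<le> step_cost n w"
      using t1' t3(1) t4(1) t5(1) t7(1) t8(1) t9(1) cube unfolding step_cost_def m[symmetric] by simp
    then have "t \<le> calls E L * step_cost n w + calls (delete_node x E) L * step_cost n w + step_cost n w"
      using t(1) t2(1) t6(1) by linarith
    then show ?case using t(2) by (auto simp: runs_def cl algebra_simps)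
  next
    case (choose E)
    have sE: "small_nodes n E" and len: "length E \<le> n" using choose(5) by (auto simp: search_inv_def)
    let ?c1 = "\<lambda>(u, v, r). calls (delete_node v (delete_node u E)) []"
    let ?c2 = "\<lambda>(u, v, r). calls (delete_edge u v E) []"
    let ?s = "score (\<lambda>F. search_value F []) E"
    have sc: "runs 9 [entry_enc c, entries_enc E] (frac_enc (?s c))
        (?c1 c * step_cost n w + ?c2 c * step_cost n w + (1000 * (n + 1)\<^sup>2 + 30 * w)) \<and> bounded_frac w (?s c)"
      if c: "c \<in> set E" for c
    proof -
      obtain u v r where uvr: "c = (u, v, r)" by (cases c)
      have cE: "(u, v, r) \<in> set E" using c uvr by simp
      let ?F = "delete_node v (delete_node u E)" and ?H = "delete_edge u v E"
      have invF: "search_inv n ?F []" and invH: "search_inv n ?H []"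
        using choose(5) search_inv_delete by blast+
      have "(1 + calls ?F [] + calls ?H []) * (4 * n + 4) \<le> calls E [] * (4 * n + 4)"
        by (rule mult_le_mono1[OF calls_choose_ge[OF choose(1,2) cE]])
      then have tot: "(1 + calls ?F [] + calls ?H []) * (4 * n + 4) \<le> w" using choose(6) by (rule le_trans)
      then have wF: "calls ?F [] * (4 * n + 4) \<le> w" and wH: "calls ?H [] * (4 * n + 4) \<le> w"
        by (simp_all add: algebra_simps)
      have rF: "runs 7 [entries_enc ?F, Num 0] (frac_enc (search_value ?F [])) (calls ?F [] * step_cost n w)"
        using choose(3)[OF cE invF wF] by simp
      have rH: "runs 7 [entries_enc ?H, Num 0] (frac_enc (search_value ?H [])) (calls ?H [] * step_cost n w)"
        using choose(4)[OF cE invH wH] by simp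
      have r: "bounded_frac n r"
        using choose(5) search_inv_denoms(1)[OF choose(5)] cE
        by (intro bounded_frac_entry[of E u v]) (auto simp: search_inv_def)
      have "bounded_frac (2 * n + calls ?F [] * (4 * n + 4) + calls ?H [] * (4 * n + 4) + 2) (?s (u, v, r))"
        by (intro bounded_frac_score r bounded_frac_search_value invF invH)
      then have "bounded_frac w (?s (u, v, r))" by (rule bounded_frac_mono) (use tot in \<open>simp add: algebra_simps\<close>)
      moreover note runs_score[OF choose(5) cE rF bounded_frac_mono[OF bounded_frac_search_value[OF invF] wF]
          rH bounded_frac_mono[OF bounded_frac_search_value[OF invH] wH]]
      ultimately show ?thesis by (simp add: uvr)
    qed
    obtain t1 where t1: "t1 \<le> (length E + 1) * (150 * (n + 1)\<^sup>2)"
      "call prog 5 [entries_enc E, entries_enc E] = Some (Num 0, t1)"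
      using runs_find_leaf[OF sE sE len] by (auto simp: choose(2) elim: runsE)
    have "t1 \<le> (n + 1) * (150 * (n + 1)\<^sup>2)" using t1(1) len mult_le_mono1[of "length E + 1" "n + 1"] by (meson add_le_mono1 le_trans)
    then have t1': "t1 \<le> 150 * (n + 1) ^ 3" by (simp add: power2_eq_square power3_eq_cube algebra_simps)
    obtain s u v where b: "best ?s E = (s, u, v)" by (cases "best ?s E")
    let ?\<tau> = "\<lambda>c. ?c1 c * step_cost n w + ?c2 c * step_cost n w + (1000 * (n + 1)\<^sup>2 + 30 * w)"
    obtain t2 where t2: "t2 \<le> (\<Sum>c\<leftarrow>E. ?\<tau> c + (10 * w + 100)) + 20"
      "call prog 8 [entries_enc E, entries_enc E] = Some (Cell (frac_enc s) (Cell (Num u) (Num v)), t2)"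
      using runs_best[of E "entries_enc E" ?s ?\<tau> w] sc unfolding b by (auto elim: runsE)
    have "\<exists>t\<le>t1 + t2 + 50. call prog 7 [entries_enc E, Num 0] = Some (frac_enc s, t)"
      by (simp add: call_prog(8) search_value_body_def den_simps entries_enc_eq_0 choose(1) t1(2) t2(2))
    then obtain t where t: "t \<le> t1 + t2 + 50" "call prog 7 [entries_enc E, Num 0] = Some (frac_enc s, t)" by blast
    have "(\<Sum>c\<leftarrow>E. ?\<tau> c + (10 * w + 100)) \<le> (\<Sum>c\<leftarrow>E. (1 + ?c1 c + ?c2 c) * step_cost n w)"
    proof (rule sum_list_mono)
      fix c
      have "(1000 * (n + 1)\<^sup>2 + 30 * w) + (10 * w + 100) \<le> step_cost n w"
        using cube unfolding step_cost_def m[symmetric] by simp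
      then show "?\<tau> c + (10 * w + 100) \<le> (1 + ?c1 c + ?c2 c) * step_cost n w"
        unfolding add_mult_distrib by linarith
    qed
    also have "\<dots> = (\<Sum>c\<leftarrow>E. 1 + ?c1 c + ?c2 c) * step_cost n w" by (rule sum_list_mult_const)
    finally have t2': "t2 \<le> (\<Sum>c\<leftarrow>E. 1 + ?c1 c + ?c2 c) * step_cost n w + 20" using t2(1) by linarith
    have cl: "calls E [] = 1 + (\<Sum>c\<leftarrow>E. 1 + ?c1 c + ?c2 c)"
      unfolding calls_simps(3)[OF choose(1,2)] by (simp add: case_prod_unfold)
    have "t1 + 70 \<le> step_cost n w" using t1' cube unfolding step_cost_def m[symmetric] by simp
    then have "t \<le> step_cost n w + (\<Sum>c\<leftarrow>E. 1 + ?c1 c + ?c2 c) * step_cost n w" using t(1) t2' by linarith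
    then show ?case using t(2) unfolding cl search_value_simps(3)[OF choose(1,2)] b by (auto simp: runs_def)
  qed
qed

section \<open>The strategy\<close>

fun residual_list :: "entry list \<Rightarrow> nat history \<Rightarrow> entry list" where
  "residual_list E [] = E"
| "residual_list E ((e, b) # h) =
     residual_list (if b then delete_node (Max e) (delete_node (Min e) E) else delete_edge (Min e) (Max e) E) h"

definition strategy :: "description \<Rightarrow> nat strategy" where
  "strategy D h = (let R = residual_list D h; (u, v) = snd (best (score (\<lambda>F. search_value F []) R) R) in {u, v})"

lemma describes_edges_residual_list: "describes_edges p E \<Longrightarrow> describes_edges p (residual_list E h)"
  by (induction E h rule: residual_list.induct) (simp_all add: describes_edges_delete)

lemma search_inv_residual_list: "search_inv n E [] \<Longrightarrow> search_inv n (residual_list E h) []"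
  by (induction E h rule: residual_list.induct) (simp_all add: search_inv_delete)

lemma two_element_set: "card (e :: nat set) = 2 \<Longrightarrow> {Min e, Max e} = e"
  by (auto simp: card_2_iff)

lemma residual_list_correct:
  assumes "edge_set D = edges G" "\<And>e b. (e, b) \<in> set h \<Longrightarrow> card e = 2"
  shows "edge_set (residual_list D h) = residual G h"
proof -
  have "edge_set (residual_list E h) =
      fold (\<lambda>(e, present) R. if present then {f \<in> R. f \<inter> e = {}} else R - {e}) h (edge_set E)" for E
    using assms(2)
  proof (induction h arbitrary: E)
    case (Cons a h)
    obtain e b where a: "a = (e, b)" by force
    have e: "{Min e, Max e} = e" using Cons.prems[of e b] by (intro two_element_set) (simp add: a)
    have "edge_set (delete_node (Max e) (delete_node (Min e) E)) = {f \<in> edge_set E. f \<inter> {Min e, Max e} = {}}"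
      "edge_set (delete_edge (Min e) (Max e) E) = edge_set E - {{Min e, Max e}}"
      by (auto simp: edge_set_delete)
    note del = this[unfolded e]
    have "edge_set (residual_list F h) =
        fold (\<lambda>(e, present) R. if present then {f \<in> R. f \<inter> e = {}} else R - {e}) h (edge_set F)" for F
    proof (rule Cons.IH)
      show "card e' = 2" if "(e', b') \<in> set h" for e' b' using Cons.prems[of e' b'] that by simp
    qed
    then show ?case by (cases b) (simp_all add: a del)
  qed simp
  then show ?thesis using assms(1) by (simp add: residual_def)
qed

lemma history_val_simps [simp]:
  "history_val [] = Num 0"
  "history_val ((e, b) # h) = Cell (Cell (Cell (Num (Min e)) (Num (Max e))) (Num (of_bool b))) (history_val h)"
  by (simp_all add: history_val_def edge_val_def)

lemma small_nodes_delete: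
  assumes "small_nodes n E"
  shows "small_nodes n (delete_node x E)" "small_nodes n (delete_edge x y E)"
  using assms by (auto simp: small_nodes_def delete_node_def delete_edge_def)

lemma length_delete_edge_le: "length (delete_edge x y E) \<le> length E"
  by (simp add: delete_edge_def)

lemma runs_residual:
  assumes "small_nodes n E" "length E \<le> n" "\<And>e b. (e, b) \<in> set h \<Longrightarrow> Min e < 2 ^ n \<and> Max e < 2 ^ n"
  shows "runs 1 [entries_enc E, history_val h] (entries_enc (residual_list E h)) ((length h + 1) * (150 * (n + 1)\<^sup>2))"
  using assms
proof (induction h arbitrary: E)
  case Nil
  have "4 \<le> 150 * (n + 1)\<^sup>2" by (simp add: power2_eq_square)
  then show ?case by (simp add: runs_def call_prog residual_body_def den_simps)
next
  case (Cons a h)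
  obtain e b where a: "a = (e, b)" by force
  have e: "Min e < 2 ^ n" "Max e < 2 ^ n" using Cons.prems(3)[of e b] by (auto simp: a)
  obtain m where m: "m = (n + 1)\<^sup>2" by blast
  have m1: "1 \<le> m" by (simp add: m)
  let ?E1 = "delete_node (Min e) E"
  have E1: "small_nodes n ?E1" "length ?E1 \<le> n"
    using Cons.prems(1,2) length_delete_node_le[of "Min e" E] small_nodes_delete by (blast, linarith)
  define F where "F = (if b then delete_node (Max e) ?E1 else delete_edge (Min e) (Max e) E)"
  have F: "small_nodes n F" "length F \<le> n"
    using Cons.prems(1,2) E1 length_delete_node_le[of "Max e" ?E1] length_delete_edge_le[of "Min e" "Max e" E]
      small_nodes_delete unfolding F_def by (presburger, (cases b; simp))
  obtain t1 where t1: "t1 \<le> 50 * m" "call prog 2 [Num (Min e), entries_enc E] = Some (entries_enc ?E1, t1)"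
    using runs_mono[OF runs_delete_node[OF Cons.prems(1) e(1)] length_cost_bound[OF Cons.prems(2)]] unfolding m by (rule runsE)
  obtain t2 where t2: "t2 \<le> 50 * m"
    "call prog 2 [Num (Max e), entries_enc ?E1] = Some (entries_enc (delete_node (Max e) ?E1), t2)"
    using runs_mono[OF runs_delete_node[OF E1(1) e(2)] length_cost_bound[OF E1(2)]] unfolding m by (rule runsE)
  obtain t3 where t3: "t3 \<le> 100 * m"
    "call prog 3 [Num (Min e), Num (Max e), entries_enc E] = Some (entries_enc (delete_edge (Min e) (Max e) E), t3)"
    using runs_mono[OF runs_delete_edge[OF Cons.prems(1) e] length_cost_bound[OF Cons.prems(2)]] unfolding m by (rule runsE)
  obtain t4 where t4: "t4 \<le> (length h + 1) * (150 * m)"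
    "call prog (Suc 0) [entries_enc F, history_val h] = Some (entries_enc (residual_list F h), t4)"
    using Cons.IH[OF F] Cons.prems(3) unfolding m by (auto elim: runsE)
  have r: "residual_list E (a # h) = residual_list F h" by (simp add: a F_def)
  have "\<exists>t\<le>100 * m + t4 + 50. call prog 1 [entries_enc E, history_val (a # h)] = Some (entries_enc (residual_list F h), t)"
    unfolding One_nat_def call_prog(2)[of "[entries_enc E, history_val (a # h)]"]
    using t1(1) t2(1) t3(1) t4(2) m1
    by (cases b) (simp_all add: a F_def residual_body_def den_simps t1(2) t2(2) t3(2))
  then obtain t where t: "t \<le> 100 * m + t4 + 50"
    "call prog 1 [entries_enc E, history_val (a # h)] = Some (entries_enc (residual_list E (a # h)), t)"
    unfolding r by blast
  have "t \<le> (length (a # h) + 1) * (150 * m)" using t(1) t4(1) m1 by simp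
  then show ?case using t(2) unfolding m by (auto simp: runs_def)
qed

lemma edge_val_pair: "edge_val {u, v} = (if u - v \<noteq> 0 then Cell (Num v) (Num u) else Cell (Num u) (Num v))"
  by (simp add: edge_val_def)

lemma best_mem:
  "T \<noteq> [] \<Longrightarrow> \<exists>r. (fst (snd (best s T)), snd (snd (best s T)), r) \<in> set T"
proof (induction T)
  case (Cons c T)
  obtain u v r where c: "c = (u, v, r)" by (cases c)
  show ?case
  proof (cases "T = []")
    case True
    then show ?thesis by (auto simp: c)
  next
    case False
    show ?thesis
    proof (cases "fst (s c) * snd (fst (best s T)) < fst (fst (best s T)) * snd (s c)")
      case True
      then show ?thesis using Cons.IH[OF False] by (auto simp: c Let_def)
    next
      case F: False
      then have "best s (c # T) = (s c, (u, v))" by (simp add: c Let_def)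
      then show ?thesis using c by (metis fst_conv snd_conv list.set_intros(1))
    qed
  qed
qed simp

definition total_cost :: "nat \<Rightarrow> nat \<Rightarrow> nat" where
  "total_cost n c = 150 * (n + 1) ^ 3 +
     n * (2 * c * step_cost n ((2 * c + 1) * (4 * n + 4)) + 1000 * (n + 1)\<^sup>2 + 40 * ((2 * c + 1) * (4 * n + 4)) + 100) + 2 * n + 100"

lemma runs_main:
  assumes inv: "search_inv n D []" and h: "\<And>e b. (e, b) \<in> set h \<Longrightarrow> Min e < 2 ^ n \<and> Max e < 2 ^ n"
    and len: "length h \<le> n"
    and ne: "residual_list D h \<noteq> []"
    and c: "\<And>F. F \<in> {delete_node v (delete_node u (residual_list D h)) | u v. True} \<union>
        {delete_edge u v (residual_list D h) | u v. True} \<Longrightarrow> calls F [] \<le> c"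
  shows "runs 0 [entries_enc D, history_val h] (edge_val (strategy D h)) (total_cost n c)"
proof -
  define R where "R = residual_list D h"
  let ?s = "score (\<lambda>F. search_value F []) R"
  define w where "w = (2 * c + 1) * (4 * n + 4)"
  have D: "small_nodes n D" "length D \<le> n" using inv by (auto simp: search_inv_def)
  have invR: "search_inv n R []" unfolding R_def by (rule search_inv_residual_list[OF inv])
  have R: "small_nodes n R" "length R \<le> n" using invR by (auto simp: search_inv_def)
  have sc: "runs 9 [entry_enc e, entries_enc R] (frac_enc (?s e))
      (2 * c * step_cost n w + (1000 * (n + 1)\<^sup>2 + 30 * w)) \<and> bounded_frac w (?s e)" if "e \<in> set R" for e
  proof -
    obtain u v r where uvr: "e = (u, v, r)" by (cases e)
    have cE: "(u, v, r) \<in> set R" using that uvr by simp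
    let ?F = "delete_node v (delete_node u R)" and ?H = "delete_edge u v R"
    have invF: "search_inv n ?F []" and invH: "search_inv n ?H []" using invR search_inv_delete by blast+
    have cF: "calls ?F [] \<le> c" and cH: "calls ?H [] \<le> c" using c unfolding R_def by blast+
    have wF: "calls ?F [] * (4 * n + 4) \<le> c * (4 * n + 4)" and wH: "calls ?H [] * (4 * n + 4) \<le> c * (4 * n + 4)"
      using mult_le_mono1[OF cF] mult_le_mono1[OF cH] by blast+
    have cw: "2 * n + c * (4 * n + 4) + c * (4 * n + 4) + 2 \<le> w" "c * (4 * n + 4) \<le> w"
      by (simp_all add: w_def algebra_simps)
    have bF: "bounded_frac (c * (4 * n + 4)) (search_value ?F [])" and bH: "bounded_frac (c * (4 * n + 4)) (search_value ?H [])"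
      using bounded_frac_mono[OF bounded_frac_search_value[OF invF] wF] bounded_frac_mono[OF bounded_frac_search_value[OF invH] wH] by blast+
    have r: "bounded_frac n r"
      using invR search_inv_denoms(1)[OF invR] cE by (intro bounded_frac_entry[of R u v]) (auto simp: search_inv_def)
    have "bounded_frac w (?s (u, v, r))" by (rule bounded_frac_mono[OF bounded_frac_score[OF r bF bH] cw(1)])
    moreover have "runs 7 [entries_enc ?F, Num 0] (frac_enc (search_value ?F [])) (c * step_cost n w)"
      using runs_mono[OF runs_search_value[OF invF le_trans[OF wF cw(2)]] mult_le_mono1[OF cF]] unfolding list_val_simps(1) .
    moreover have "runs 7 [entries_enc ?H, Num 0] (frac_enc (search_value ?H [])) (c * step_cost n w)"
      using runs_mono[OF runs_search_value[OF invH le_trans[OF wH cw(2)]] mult_le_mono1[OF cH]] unfolding list_val_simps(1) .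
    moreover have "2 * c * step_cost n w = c * step_cost n w + c * step_cost n w" by simp
    ultimately show ?thesis unfolding uvr
      using runs_score[OF invR cE _ bounded_frac_mono[OF bF cw(2)] _ bounded_frac_mono[OF bH cw(2)]] by presburger
  qed
  obtain s u v where b: "best ?s R = (s, u, v)" by (cases "best ?s R")
  have "\<exists>r. (u, v, r) \<in> set R" using best_mem[of R ?s] ne by (simp add: R_def[symmetric] b)
  then have uv: "u < 2 ^ n" "v < 2 ^ n" using R(1) by (auto simp: small_nodes_def)
  have st: "strategy D h = {u, v}" by (simp add: strategy_def R_def[symmetric] b)
  have "runs 1 [entries_enc D, history_val h] (entries_enc R) ((length h + 1) * (150 * (n + 1)\<^sup>2))"
    unfolding R_def using D h by (intro runs_residual) blast+
  then obtain t1 where t1: "t1 \<le> (length h + 1) * (150 * (n + 1)\<^sup>2)"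
    "call prog 1 [entries_enc D, history_val h] = Some (entries_enc R, t1)" by (rule runsE)
  have "t1 \<le> (n + 1) * (150 * (n + 1)\<^sup>2)" using t1(1) len mult_le_mono1[of "length h + 1" "n + 1"] by (meson add_le_mono1 le_trans)
  then have t1': "t1 \<le> 150 * (n + 1) ^ 3" by (simp add: power2_eq_square power3_eq_cube algebra_simps)
  let ?\<tau> = "2 * c * step_cost n w + (1000 * (n + 1)\<^sup>2 + 30 * w)"
  obtain t2 where t2: "t2 \<le> (\<Sum>e\<leftarrow>R. ?\<tau> + (10 * w + 100)) + 20"
    "call prog 8 [entries_enc R, entries_enc R] = Some (Cell (frac_enc s) (Cell (Num u) (Num v)), t2)"
    using runs_best[of R "entries_enc R" ?s "\<lambda>_. ?\<tau>" w] sc unfolding b by (auto elim: runsE)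
  have "(\<Sum>e\<leftarrow>R. ?\<tau> + (10 * w + 100)) \<le> n * (?\<tau> + (10 * w + 100))"
    unfolding sum_list_triv of_nat_id by (rule mult_le_mono1[OF R(2)])
  then have t2': "t2 \<le> n * (?\<tau> + (10 * w + 100)) + 20" using t2(1) by linarith
  have "floorlog 2 u \<le> n" "floorlog 2 v \<le> n" using uv[THEN floorlog_le] .
  then have "\<exists>t\<le>t1 + t2 + 2 * n + 50. call prog 0 [entries_enc D, history_val h] = Some (edge_val {u, v}, t)"
    unfolding call_prog(1) edge_val_pair
    by (cases "u - v = 0") (simp_all add: main_body_def den_simps t1(2)[unfolded One_nat_def] t2(2))
  then obtain t where t: "t \<le> t1 + t2 + 2 * n + 50"
    "call prog 0 [entries_enc D, history_val h] = Some (edge_val {u, v}, t)" by blast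
  have "?\<tau> + (10 * w + 100) = 2 * c * step_cost n w + 1000 * (n + 1)\<^sup>2 + 40 * w + 100" by simp
  then have "t \<le> total_cost n c"
    using t(1) t1' t2' unfolding total_cost_def w_def[symmetric] by (simp only:)
  then show ?thesis using t(2) st by (auto simp: runs_def)
qed

lemma histories_length:
  assumes "weighted_graph G" "querying_strategy G s" "h \<in> histories G s"
  shows "length h \<le> card (edges G)"
proof -
  obtain \<sigma> m where \<sigma>: "\<sigma> \<subseteq> edges G" "h = transcript G s \<sigma> m" using assms(3) by (auto simp: histories_def)
  have "length (transcript G s \<sigma> m) + card (residual G (transcript G s \<sigma> m)) \<le> card (edges G)"
  proof (induction m)
    case (Suc m)
    let ?h = "transcript G s \<sigma> m"
    show ?case
    proof (cases "residual G ?h = {}")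
      case False
      have e: "s ?h \<in> residual G ?h"
        using False assms(2) transcript_in_histories[OF \<sigma>(1)] unfolding querying_strategy_def by blast
      have fin: "finite (residual G ?h)"
        using assms(1) residual_subset[of G ?h] by (auto simp: weighted_graph_def finite_subset)
      have t: "transcript G s \<sigma> (Suc m) = ?h @ [(s ?h, s ?h \<in> \<sigma>)]" using False by (simp add: Let_def)
      have "s ?h \<notin> residual G (?h @ [(s ?h, s ?h \<in> \<sigma>)])"
        by (rule residual_not_queried[OF assms(1), of _ "s ?h \<in> \<sigma>"]) simp
      then have "residual G (?h @ [(s ?h, s ?h \<in> \<sigma>)]) \<subset> residual G ?h" using e by (auto split: if_splits)
      then have "card (residual G (?h @ [(s ?h, s ?h \<in> \<sigma>)])) < card (residual G ?h)"
        using fin by (rule psubset_card_mono[rotated])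
      then show ?thesis using Suc.IH unfolding t by simp
    qed (use Suc.IH in \<open>simp add: Let_def\<close>)
  qed simp
  then show ?thesis using \<sigma>(2) by simp
qed

lemma less_two_power_floorlog: "x < 2 ^ floorlog 2 x"
  by (cases "x = 0") (use floorlog_bounds[of x 2] in auto)

lemma description_bounds:
  assumes "\<forall>(u, v, a, b) \<in> set D. b \<noteq> 0"
  shows "length D \<le> description_size D" "denoms D \<le> 2 ^ description_size D" "small_nodes (description_size D) D"
proof -
  have "length D \<le> description_size D \<and> denoms D \<le> 2 ^ description_size D \<and> small_nodes (description_size D) D"
    using assms
  proof (induction D)
    case (Cons c D)
    obtain u v a b where c: "c = (u, v, a, b)" by (cases c)
    let ?k = "floorlog 2 u + floorlog 2 v + floorlog 2 a + floorlog 2 b"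
    have sz: "description_size (c # D) = ?k + description_size D" by (simp add: description_size_def c)
    have IH: "length D \<le> description_size D" "denoms D \<le> 2 ^ description_size D" "small_nodes (description_size D) D"
      using Cons by auto
    have mono: "x < 2 ^ k'" if "x < 2 ^ k" "k \<le> k'" for x k k' :: nat
      using that(1) power_increasing[OF that(2), of "2::nat"] by linarith
    have b: "1 \<le> floorlog 2 b" using less_two_power_floorlog[of b] Cons.prems c by (cases "floorlog 2 b") auto
    have "b * denoms D \<le> 2 ^ floorlog 2 b * 2 ^ description_size D"
      using less_two_power_floorlog[of b] IH(2) by (intro mult_le_mono) auto
    also have "\<dots> \<le> 2 ^ (?k + description_size D)"
      unfolding power_add[symmetric] by (rule power_increasing) auto
    finally have 1: "denoms (c # D) \<le> 2 ^ description_size (c # D)" unfolding sz by (simp add: c)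
    have 2: "u < 2 ^ description_size (c # D)" "v < 2 ^ description_size (c # D)"
      by (rule mono[OF less_two_power_floorlog]; simp add: sz)+
    have 3: "small_nodes (description_size (c # D)) D"
      using IH(3) mono[of _ "description_size D" "description_size (c # D)"]
      unfolding small_nodes_def sz by fastforce
    show ?case using 1 2 3 b IH(1) unfolding sz by (simp add: c)
  qed (simp add: small_nodes_def)
  then show "length D \<le> description_size D" "denoms D \<le> 2 ^ description_size D" "small_nodes (description_size D) D"
    by auto
qed

lemma ends_eq: "ends = (\<lambda>(u, v, a, b). {u, v})"
  by auto

lemma description_val_eq: "description_val D = entries_enc D"
proof -
  have "(\<lambda>(u, v, a, b). Cell (Cell (Num u) (Num v)) (Cell (Num a) (Num b))) = entry_enc" by auto
  then show ?thesis by (simp add: description_val_def)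
qed

lemma describes_imp:
  assumes "weighted_graph G" "describes D G"
  shows "describes_edges (prob G) D" "edge_set D = edges G" "search_inv (description_size D) D []"
proof -
  show es: "edge_set D = edges G" using assms(2) by (simp add: describes_def edge_set_def ends_eq)
  have entry: "u \<noteq> v \<and> prob G {u, v} = frac_val (a, b) \<and> proper (a, b)" if "(u, v, a, b) \<in> set D" for u v a b
  proof -
    have b: "b \<noteq> 0" "prob G {u, v} = real a / real b" using assms(2) that by (auto simp: describes_def)
    have "ends (u, v, a, b) \<in> edge_set D" using that unfolding edge_set_def by (rule imageI)
    then have "{u, v} \<in> edges G" using es by simp
    then have e: "card {u, v} = 2" "prob G {u, v} \<le> 1" using assms(1) by (auto simp: weighted_graph_def)
    have "u \<noteq> v" using e(1) by auto
    moreover have "a \<le> b" using e(2) b by (simp add: divide_le_eq)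
    ultimately show ?thesis using b by (simp add: frac_val_def proper_def)
  qed
  then show d: "describes_edges (prob G) D"
    using assms(2) unfolding describes_edges_def describes_def ends_eq by auto
  have "proper_entries D" using d by (auto simp: describes_edges_def proper_entries_def)
  moreover have "\<forall>(u, v, a, b) \<in> set D. b \<noteq> 0" using assms(2) by (auto simp: describes_def)
  ultimately show "search_inv (description_size D) D []"
    using description_bounds[of D] by (simp add: search_inv_def node_entries_def small_nodes_def)
qed

lemma strategy_greedy:
  assumes G: "weighted_graph G" and D: "describes D G"
    and h: "\<And>e b. (e, b) \<in> set h \<Longrightarrow> e \<in> edges G" and ne: "residual G h \<noteq> {}"
  shows "strategy D h \<in> residual G h"
    "query_value (prob G) (residual G h) (strategy D h) = opt (prob G) (residual G h)"
proof -
  define R where "R = residual_list D h"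
  note imp = describes_imp[OF G D]
  have R: "describes_edges (prob G) R" unfolding R_def by (rule describes_edges_residual_list[OF imp(1)])
  have "card e = 2" if "(e, b) \<in> set h" for e b using h[OF that] G by (auto simp: weighted_graph_def)
  then have es: "edge_set R = residual G h" unfolding R_def by (rule residual_list_correct[OF imp(2)])
  have "R \<noteq> []" using ne es by (auto simp: edge_set_def)
  have "0 < snd (score (\<lambda>F. search_value F []) R (u, v, r)) \<and>
      frac_val (score (\<lambda>F. search_value F []) R (u, v, r)) = query_value (prob G) (edge_set R) {u, v}"
    if "(u, v, r) \<in> set R" for u v r
  proof -
    have val: "0 < snd (search_value F []) \<and> frac_val (search_value F []) = opt (prob G) (edge_set F)"
      if "F \<in> {delete_node v (delete_node u R), delete_edge u v R}" for F
    proof -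
      have "describes_edges (prob G) F" using that R describes_edges_delete by blast
      from search_value_correct[OF this, of "[]"] show ?thesis by (simp add: node_entries_def avail_list_def)
    qed
    show ?thesis using score_correct[OF R that, of "\<lambda>F. search_value F []"] val by blast
  qed
  then obtain u v r where uv: "(u, v, r) \<in> set R" "best (score (\<lambda>F. search_value F []) R) R = (score (\<lambda>F. search_value F []) R (u, v, r), (u, v))"
    "query_value (prob G) (edge_set R) {u, v} = opt (prob G) (edge_set R)"
    by (rule best_query_value[OF R \<open>R \<noteq> []\<close>])
  have st: "strategy D h = {u, v}" by (simp add: strategy_def R_def[symmetric] uv(2))
  have "ends (u, v, r) \<in> edge_set R" using uv(1) unfolding edge_set_def by (rule imageI)
  then show "strategy D h \<in> residual G h" using es st by simp
  show "query_value (prob G) (residual G h) (strategy D h) = opt (prob G) (residual G h)"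
    using uv(3) es st by simp
qed

lemma strategy_histories_edges:
  assumes "weighted_graph G" "describes D G" "h \<in> histories G (strategy D)" "(e, b) \<in> set h"
  shows "e \<in> edges G"
proof -
  obtain \<sigma> m where \<sigma>: "\<sigma> \<subseteq> edges G" "h = transcript G (strategy D) \<sigma> m" using assms(3) by (auto simp: histories_def)
  have "\<forall>(e, b) \<in> set (transcript G (strategy D) \<sigma> m). e \<in> edges G"
  proof (induction m)
    case (Suc m)
    let ?h = "transcript G (strategy D) \<sigma> m"
    have "strategy D ?h \<in> edges G" if "residual G ?h \<noteq> {}"
      using strategy_greedy(1)[OF assms(1,2) _ that] Suc residual_subset[of G ?h] by blast
    then show ?case using Suc by (auto simp: Let_def)
  qed simp
  then show ?thesis using assms(4) \<sigma>(2) by blast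
qed

lemma strategy_querying:
  assumes "weighted_graph G" "describes D G"
  shows "querying_strategy G (strategy D)"
  unfolding querying_strategy_def
  using strategy_greedy(1)[OF assms] strategy_histories_edges[OF assms] by blast

lemma strategy_optimal:
  assumes "weighted_graph G" "describes D G"
  shows "optimal_strategy G (strategy D)"
proof (rule optimal_strategyI[OF assms(1)])
  fix h assume h: "h \<in> histories G (strategy D)" "residual G h \<noteq> {}"
  note greedy = strategy_greedy[OF assms strategy_histories_edges[OF assms h(1)] h(2)]
  show "strategy D h \<in> residual G h" by (rule greedy(1))
  show "opt (prob G) (residual G h) =
      prob G (strategy D h) * (1 + opt (prob G) {f \<in> residual G h - {strategy D h}. f \<inter> strategy D h = {}})
      + (1 - prob G (strategy D h)) * opt (prob G) (residual G h - {strategy D h})"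
    using greedy(2) unfolding query_value_def by (rule sym)
qed

definition polynomial :: "(nat \<Rightarrow> nat) \<Rightarrow> bool" where
  "polynomial f \<longleftrightarrow> (\<exists>q. \<forall>n. poly q n = f n)"

lemma polynomial_const: "polynomial (\<lambda>n. c)"
  unfolding polynomial_def by (rule exI[of _ "[:c:]"]) simp

lemma polynomial_id: "polynomial (\<lambda>n. n)"
  unfolding polynomial_def by (rule exI[of _ "[:0, 1:]"]) simp

lemma polynomial_add: "polynomial f \<Longrightarrow> polynomial g \<Longrightarrow> polynomial (\<lambda>n. f n + g n)"
  unfolding polynomial_def by (metis poly_add)

lemma polynomial_mult: "polynomial f \<Longrightarrow> polynomial g \<Longrightarrow> polynomial (\<lambda>n. f n * g n)"
  unfolding polynomial_def by (metis poly_mult)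

lemma polynomial_power: "polynomial f \<Longrightarrow> polynomial (\<lambda>n. f n ^ k)"
  unfolding polynomial_def by (metis poly_power)

lemma polynomial_total_cost: "polynomial (\<lambda>n. total_cost n ((2 * n + 2) ^ k * (2 * n + 1)))"
  unfolding total_cost_def step_cost_def
  by (intro polynomial_add polynomial_mult polynomial_power polynomial_id polynomial_const)

theorem theorem1:
  fixes d :: int and C :: "nat wgraph set"
  assumes "C = {G. weighted_graph G \<and> connected_graph G \<and>
                   int (card (edges G)) \<le> int (card (nodes G)) + d}"
  shows "\<exists>S. polytime_computable C S \<and>
             (\<forall>G\<in>C. \<forall>D. describes D G \<longrightarrow> optimal_strategy G (S D))"
proof (intro exI conjI ballI allI impI)
  fix G D assume "G \<in> C" "describes D G"
  then show "optimal_strategy G (strategy D)" using assms by (intro strategy_optimal) auto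
next
  define k where "k = nat (2 * (d + 1))"
  obtain q :: "nat poly" where q: "\<And>n. poly q n = total_cost n ((2 * n + 2) ^ k * (2 * n + 1))"
    using polynomial_total_cost[of k] unfolding polynomial_def by blast
  show "polytime_computable C strategy"
    unfolding polytime_computable_def
  proof (intro exI[of _ prog] exI[of _ q] ballI allI impI)
    fix G D h
    assume GC: "G \<in> C" and D: "describes D G" and h: "h \<in> histories G (strategy D)" and ne: "residual G h \<noteq> {}"
    define n where "n = description_size D"
    have G: "weighted_graph G" "connected_graph G" "int (card (edges G)) \<le> int (card (nodes G)) + d"
      using GC assms by auto
    note imp = describes_imp[OF G(1) D, folded n_def]
    have hE: "e \<in> edges G" if "(e, b) \<in> set h" for e b using strategy_histories_edges[OF G(1) D h that] .
    have card2: "card e = 2" if "e \<in> edges G" for e using that G(1) by (auto simp: weighted_graph_def)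
    define R where "R = residual_list D h"
    have esR: "edge_set R = residual G h"
      unfolding R_def by (rule residual_list_correct[OF imp(2)]) (use hE card2 in blast)
    have R: "describes_edges (prob G) R" "search_inv n R []"
      unfolding R_def using describes_edges_residual_list[OF imp(1)] search_inv_residual_list[OF imp(3)] by auto
    obtain X where X: "\<And>C. C \<subseteq> edges G \<Longrightarrow> min_degree_two C \<Longrightarrow> C \<noteq> {} \<Longrightarrow> C \<inter> X \<noteq> {}"
      "\<And>F. F \<subseteq> edges G \<Longrightarrow> card F + card (F \<inter> X) \<le> card (\<Union>F) + k"
      using sparse_potential_bound[OF G] unfolding k_def by blast
    have pot: "potential_le X (edges G) k" using X unfolding potential_le_def by blast
    have small: "Min e < 2 ^ n \<and> Max e < 2 ^ n" if "(e, b) \<in> set h" for e b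
    proof -
      have "e \<in> edge_set D" using hE[OF that] imp(2) by simp
      then obtain u v r where uv: "(u, v, r) \<in> set D" "e = {u, v}" by (auto simp: edge_set_def)
      then have "u < 2 ^ n" "v < 2 ^ n" using imp(3) by (auto simp: search_inv_def small_nodes_def)
      then show ?thesis using uv(2) by simp
    qed
    have "length h \<le> card (edges G)" by (rule histories_length[OF G(1) strategy_querying[OF G(1) D] h])
    also have "\<dots> \<le> length D" unfolding imp(2)[symmetric] edge_set_def by (meson card_image_le card_length finite_set le_trans)
    also have "\<dots> \<le> n" using imp(3) by (simp add: search_inv_def)
    finally have len: "length h \<le> n" .
    have calls: "calls F [] \<le> (2 * n + 2) ^ k * (2 * n + 1)"
      if "F \<in> {delete_node v (delete_node u R) | u v. True} \<union> {delete_edge u v R | u v. True}" for F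
    proof -
      have F: "describes_edges (prob G) F" "search_inv n F []" "edge_set F \<subseteq> edge_set R"
        using that R describes_edges_delete search_inv_delete by (auto simp: edge_set_delete)
      have "edge_set F \<subseteq> edges G" using F(3) esR residual_subset[of G h] by simp
      then have "calls F [] \<le> (2 * n + 2) ^ k * (2 * length F + length ([] :: entry list) + 1)"
        using F(2) by (intro calls_le[OF F(1) potential_le_subset[OF pot]]) (auto simp: search_inv_def)
      also have "\<dots> \<le> (2 * n + 2) ^ k * (2 * n + 1)"
        using F(2) by (intro mult_le_mono2) (simp add: search_inv_def)
      finally show ?thesis .
    qed
    have "R \<noteq> []" using ne esR by (auto simp: edge_set_def)
    then have "runs 0 [entries_enc D, history_val h] (edge_val (strategy D h)) (total_cost n ((2 * n + 2) ^ k * (2 * n + 1)))"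
      using small calls unfolding R_def by (intro runs_main[OF imp(3) _ len]) blast+
    then obtain t where t: "t \<le> poly q n" "call prog 0 [entries_enc D, history_val h] = Some (edge_val (strategy D h), t)"
      unfolding q by (rule runsE)
    have "prog \<noteq> []" by (simp add: prog_def)
    then have "eval prog [entries_enc D, history_val h] (prog ! 0) (edge_val (strategy D h)) t"
      using t(2) by (simp add: call_def den_eq_Some)
    then show "computes_within prog [description_val D, history_val h] (edge_val (strategy D h)) (poly q (description_size D))"
      using t(1) \<open>prog \<noteq> []\<close> unfolding computes_within_def description_val_eq n_def by blast
  qed
qed

end
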